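(* Let $X(\mathbb{R}^n)$ be a separable Banach function space. Suppose the Hardy-Littlewood maximal operator $M$ is bounded on $X(\mathbb{R}^n)$ and on its associate space $X'(\mathbb{R}^n)$. Suppose $T$ is a Calderón-Zygmund operator and $\Phi=\{\phi_\alpha\}_{\alpha\in\mathcal{A}}$ is a family of measurable real-valued functions indexed by an arbitrary set $\mathcal{A}$. If the maximally modulated singular integral operator $T^\Phi$ is of weak type $(r,r)$ for all $r\in(1,\infty)$, then $T^\Phi$ extends to a bounded operator on the space $X(\mathbb{R}^n)$.
   Context: Let $\mathcal{M}$ be the set of all Lebesgue measurable complex-valued functions on $\mathbb{R}^n$, $\mathcal{M}^+$ the set of measurable functions with values in $[0,\infty]$, $|E|$ the Lebesgue measure of $E$, $\chi_E$ its characteristic function. Functions equal a.e. are identified. Banach function space: a map $\rho:\mathcal{M}^+\to[0,\infty]$ is a Banach function norm if for all $f,g,f_k\in\mathcal{M}^+$ ($k\in\mathbb{N}$), constants $a\ge0$ and measurable $E\subset\mathbb{R}^n$: (A1) $\rho(f)=0\Leftrightarrow f=0$ a.e., $\rho(af)=a\rho(f)$, $\rho(f+g)\le\rho(f)+\rho(g)$; (A2) $0\le g\le f$ a.e. implies $\rho(g)\le\rho(f)$; (A3) $0\le f_k\uparrow f$ a.e. implies $\rho(f_k)\uparrow\rho(f)$; (A4) $|E|<\infty$ implies $\rho(\chi_E)<\infty$; (A5) $|E|<\infty$ implies $\int_E f(x)\,dx\le C_E\rho(f)$ with $C_E\in(0,\infty)$ which may depend on $E$ and $\rho$ but is independent of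 $f$. The Banach function space $X(\mathbb{R}^n)$ is the set of $f\in\mathcal{M}$ with $\|f\|_{X(\mathbb{R}^n)}:=\rho(|f|)<\infty$. The associate norm is $\rho'(g):=\sup\{\int_{\mathbb{R}^n}f(x)g(x)\,dx: f\in\mathcal{M}^+,\ \rho(f)\le1\}$, $g\in\mathcal{M}^+$; it is again a Banach function norm, and it determines the associate space $X'(\mathbb{R}^n)$. Hardy-Littlewood maximal operator: $(Mf)(x):=\sup_{Q\ni x}\frac{1}{|Q|}\int_Q|f(y)|\,dy$ for $f\in L^1_{\rm loc}(\mathbb{R}^n)$, the supremum being over all cubes $Q$ containing $x$ with sides parallel to the coordinate axes. A sublinear operator $A$ is bounded on a Banach function space $Y$ if there is a constant $C$ with $\|Af\|_Y\le C\|f\|_Y$ for all $f\in Y$. Calderón-Zygmund operator: $L_0^\infty(\mathbb{R}^n)$ is the set of bounded functions with compact support. A Calderón-Zygmund operator is a linear operator $T$ bounded on $L^2(\mathbb{R}^n)$ such that for every $f\in L_0^\infty(\mathbb{R}^n)$, $(Tf)(x)=\int_{\mathbb{R}^n}K(x,y)f(y)\,dy$ for a.e. $x\in\mathbb{R}^n\setminus\operatorname{supp}f$, where the kernel $K:\mathbb{R}^n\times\mathbb{R}^n\setminus\{(x,x):x\in\mathbb{R}^n\}\to\mathbb{C}$ satisfies $|K(x,y)|\le c_0|x-y|^{-n}$ for $x\ne y$ and $|K(x,y)-K(x,y')|+|K(y,x)-K(y',x)|\le c_0|y-y'|^\tau|x-y|^{-n-\tau}$ for $|x-y|>2|y-y'|$,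 with positive constants $c_0,\tau$ independent of $x,y,y'\in\mathbb{R}^n$. Maximally modulated operator: for $\alpha\in\mathcal{A}$ let $(\mathcal{M}^{\phi_\alpha}f)(x):=e^{-i\phi_\alpha(x)}f(x)$, $x\in\mathbb{R}^n$; for $f\in L_0^\infty(\mathbb{R}^n)$, $(T^\Phi f)(x):=\sup_{\alpha\in\mathcal{A}}|T(\mathcal{M}^{\phi_\alpha}f)(x)|$, $x\in\mathbb{R}^n$. Weak type: for $1\le r<\infty$, a sublinear operator $A:L^r(\mathbb{R}^n)\to\mathcal{M}$ is of weak type $(r,r)$ if $|\{x\in\mathbb{R}^n:|(Af)(x)|>\lambda\}|\le\frac{C^r}{\lambda^r}\int_{\mathbb{R}^n}|f(y)|^r\,dy$ for all $f\in L^r(\mathbb{R}^n)$ and $\lambda>0$, where $C$ is a positive constant independent of $f$ and $\lambda$. The same notation is used for an operator defined on a dense subspace and for its bounded extension to the whole space. An operator $A$ defined on a linear subspace $D$ of $\mathcal{M}$ is nonnegative sublinear if $0\le A(f+g)\le Af+Ag$ and $A(\lambda f)=|\lambda|Af$ a.e. on $\mathbb{R}^n$ for all $f,g\in D$, $\lambda\in\mathbb{C}$. The bounded extension of $T^\Phi$ is a nonnegative sublinear operator on $X(\mathbb{R}^n)$ extending $T^\Phi$ whose value at each $f\in X(\mathbb{R}^n)$ has norm at most $C\|f\|_{X(\mathbb{R}^n)}$, with a constant $C>0$ independent of $f$.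
   Formalization: The supremum over 𝒜 defining T^Φ f is taken as the essential supremum (least measurable a.e. majorant), since Tf is only defined a.e. and the pointwise supremum over uncountable 𝒜 is not well defined; for countable 𝒜 the two agree. *)

theory Defs
  imports "HOL-Analysis.Analysis"
begin

(* Functions equal almost everywhere are not quotiented: a function space is a set of
   representatives closed under a.e. equality, and all identities between functions are
   stated a.e.  Nonnegative functions, including M f and T^Phi f, are ennreal-valued. *)

definition banach_function_norm :: "((real^'n \<Rightarrow> ennreal) \<Rightarrow> ennreal) \<Rightarrow> bool" where
  "banach_function_norm \<rho> \<longleftrightarrow>
     (\<forall>f\<in>borel_measurable lebesgue. \<rho> f = 0 \<longleftrightarrow> (AE x in lebesgue. f x = 0)) \<and>
     (\<forall>f\<in>borel_measurable lebesgue. \<forall>a\<ge>0. \<rho> (\<lambda>x. ennreal a * f x) = ennreal a * \<rho> f) \<and>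
     (\<forall>f\<in>borel_measurable lebesgue. \<forall>g\<in>borel_measurable lebesgue.
        \<rho> (\<lambda>x. f x + g x) \<le> \<rho> f + \<rho> g) \<and>
     (\<forall>f\<in>borel_measurable lebesgue. \<forall>g\<in>borel_measurable lebesgue.
        (AE x in lebesgue. g x \<le> f x) \<longrightarrow> \<rho> g \<le> \<rho> f) \<and>
     (\<forall>F f. (\<forall>k::nat. F k \<in> borel_measurable lebesgue) \<longrightarrow> f \<in> borel_measurable lebesgue \<longrightarrow>
        (AE x in lebesgue. incseq (\<lambda>k. F k x) \<and> (\<lambda>k. F k x) \<longlonglongrightarrow> f x) \<longrightarrow>
        incseq (\<lambda>k. \<rho> (F k)) \<and> (\<lambda>k. \<rho> (F k)) \<longlonglongrightarrow> \<rho> f) \<and>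
     (\<forall>E\<in>sets lebesgue. emeasure lebesgue E < \<infinity> \<longrightarrow> \<rho> (indicator E) < \<infinity>) \<and>
     (\<forall>E\<in>sets lebesgue. emeasure lebesgue E < \<infinity> \<longrightarrow>
        (\<exists>C>0. \<forall>f\<in>borel_measurable lebesgue.
           (\<integral>\<^sup>+x\<in>E. f x \<partial>lebesgue) \<le> ennreal C * \<rho> f))"

definition bfs_norm :: "((real^'n \<Rightarrow> ennreal) \<Rightarrow> ennreal) \<Rightarrow> (real^'n \<Rightarrow> complex) \<Rightarrow> ennreal" where
  "bfs_norm \<rho> f = \<rho> (\<lambda>x. ennreal (cmod (f x)))"

definition bfs :: "((real^'n \<Rightarrow> ennreal) \<Rightarrow> ennreal) \<Rightarrow> (real^'n \<Rightarrow> complex) set" where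
  "bfs \<rho> = {f \<in> borel_measurable lebesgue. bfs_norm \<rho> f < \<infinity>}"

definition associate_norm ::
    "((real^'n \<Rightarrow> ennreal) \<Rightarrow> ennreal) \<Rightarrow> (real^'n \<Rightarrow> ennreal) \<Rightarrow> ennreal" where
  "associate_norm \<rho> g =
     (SUP f\<in>{f \<in> borel_measurable lebesgue. \<rho> f \<le> 1}. \<integral>\<^sup>+x. f x * g x \<partial>lebesgue)"

definition bfs_separable :: "((real^'n \<Rightarrow> ennreal) \<Rightarrow> ennreal) \<Rightarrow> bool" where
  "bfs_separable \<rho> \<longleftrightarrow>
     (\<exists>D\<subseteq>bfs \<rho>. countable D \<and>
        (\<forall>f\<in>bfs \<rho>. \<forall>\<epsilon>>0. \<exists>g\<in>D. bfs_norm \<rho> (\<lambda>x. f x - g x) < ennreal \<epsilon>))"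

definition bounded_on_bfs ::
    "((real^'n \<Rightarrow> ennreal) \<Rightarrow> ennreal) \<Rightarrow> ((real^'n \<Rightarrow> complex) \<Rightarrow> real^'n \<Rightarrow> ennreal) \<Rightarrow> bool" where
  "bounded_on_bfs \<rho> A \<longleftrightarrow> (\<exists>C>0. \<forall>f\<in>bfs \<rho>. \<rho> (A f) \<le> ennreal C * bfs_norm \<rho> f)"

(* Closed cubes; open cubes give the same maximal function. *)
definition cubes :: "(real^'n) set set" where
  "cubes = {cbox a (\<chi> i. a $ i + l) | a l. l > 0}"

definition hl_maximal :: "(real^'n \<Rightarrow> complex) \<Rightarrow> real^'n \<Rightarrow> ennreal" where
  "hl_maximal f x =
     (SUP Q\<in>{Q \<in> cubes. x \<in> Q}.
        (\<integral>\<^sup>+y\<in>Q. ennreal (cmod (f y)) \<partial>lebesgue) / emeasure lebesgue Q)"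

definition Lp :: "real \<Rightarrow> (real^'n \<Rightarrow> complex) set" where
  "Lp r = {f \<in> borel_measurable lebesgue. (\<integral>\<^sup>+x. ennreal (cmod (f x) powr r) \<partial>lebesgue) < \<infinity>}"

definition Lp_norm :: "real \<Rightarrow> (real^'n \<Rightarrow> complex) \<Rightarrow> real" where
  "Lp_norm r f = (LINT x|lebesgue. cmod (f x) powr r) powr (1 / r)"

(* The support of an a.e. class: the complement of the largest open set on which f
   vanishes a.e. *)
definition ess_supp :: "(real^'n \<Rightarrow> complex) \<Rightarrow> (real^'n) set" where
  "ess_supp f = - \<Union>{U. open U \<and> (AE x in lebesgue. x \<in> U \<longrightarrow> f x = 0)}"

definition Linf0 :: "(real^'n \<Rightarrow> complex) set" where
  "Linf0 = {f \<in> borel_measurable lebesgue.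
              (\<exists>B. AE x in lebesgue. cmod (f x) \<le> B) \<and> compact (ess_supp f)}"

(* The values of K on the diagonal are irrelevant. *)
definition CZ_kernel :: "(real^'n \<Rightarrow> real^'n \<Rightarrow> complex) \<Rightarrow> bool" where
  "CZ_kernel K \<longleftrightarrow>
     (\<exists>c\<^sub>0>0. \<exists>\<tau>>0.
        (\<forall>x y. x \<noteq> y \<longrightarrow> cmod (K x y) \<le> c\<^sub>0 * norm (x - y) powr (- real CARD('n))) \<and>
        (\<forall>x y y'. norm (x - y) > 2 * norm (y - y') \<longrightarrow>
           cmod (K x y - K x y') + cmod (K y x - K y' x)
             \<le> c\<^sub>0 * norm (y - y') powr \<tau> * norm (x - y) powr (- real CARD('n) - \<tau>)))"

(* Linearity and boundedness force T f = T g a.e. whenever f = g a.e. *)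
definition CZ_operator :: "((real^'n \<Rightarrow> complex) \<Rightarrow> real^'n \<Rightarrow> complex) \<Rightarrow> bool" where
  "CZ_operator T \<longleftrightarrow>
     (\<forall>f\<in>Lp 2. T f \<in> Lp 2) \<and>
     (\<forall>f\<in>Lp 2. \<forall>g\<in>Lp 2. AE x in lebesgue. T (\<lambda>y. f y + g y) x = T f x + T g x) \<and>
     (\<forall>f\<in>Lp 2. \<forall>c. AE x in lebesgue. T (\<lambda>y. c * f y) x = c * T f x) \<and>
     (\<exists>C>0. \<forall>f\<in>Lp 2. Lp_norm 2 (T f) \<le> C * Lp_norm 2 f) \<and>
     (\<exists>K. CZ_kernel K \<and>
        (\<forall>f\<in>Linf0. AE x in lebesgue.
           x \<notin> ess_supp f \<longrightarrow> T f x = (LINT y|lebesgue. K x y * f y)))"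

(* Supremum of a family of a.e. classes, i.e. the least measurable function dominating every
   member a.e.  For countable index sets this is the pointwise supremum (is_ae_SUP_countable).
   For uncountable ones a pointwise supremum of arbitrarily chosen representatives is
   not determined by the classes, nor measurable, whereas ae_SUP always exists (ae_SUP_spec) and is
   unique up to null sets. *)
definition is_ae_SUP ::
    "'i set \<Rightarrow> ('i \<Rightarrow> real^'n \<Rightarrow> ennreal) \<Rightarrow> (real^'n \<Rightarrow> ennreal) \<Rightarrow> bool" where
  "is_ae_SUP I h s \<longleftrightarrow>
     s \<in> borel_measurable lebesgue \<and>
     (\<forall>i\<in>I. AE x in lebesgue. h i x \<le> s x) \<and>
     (\<forall>g\<in>borel_measurable lebesgue.
        (\<forall>i\<in>I. AE x in lebesgue. h i x \<le> g x) \<longrightarrow> (AE x in lebesgue. s x \<le> g x))"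

definition ae_SUP :: "'i set \<Rightarrow> ('i \<Rightarrow> real^'n \<Rightarrow> ennreal) \<Rightarrow> real^'n \<Rightarrow> ennreal" where
  "ae_SUP I h = (SOME s. is_ae_SUP I h s)"

definition modulation :: "(real^'n \<Rightarrow> real) \<Rightarrow> (real^'n \<Rightarrow> complex) \<Rightarrow> real^'n \<Rightarrow> complex" where
  "modulation \<phi> f = (\<lambda>x. exp (- \<i> * complex_of_real (\<phi> x)) * f x)"

definition max_modulated ::
    "((real^'n \<Rightarrow> complex) \<Rightarrow> real^'n \<Rightarrow> complex) \<Rightarrow> 'i set \<Rightarrow> ('i \<Rightarrow> real^'n \<Rightarrow> real) \<Rightarrow>
     (real^'n \<Rightarrow> complex) \<Rightarrow> real^'n \<Rightarrow> ennreal" where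
  "max_modulated T I \<phi> f = ae_SUP I (\<lambda>\<alpha> x. ennreal (cmod (T (modulation (\<phi> \<alpha>) f) x)))"

(* A maps D into the a.e. finite measurable functions and depends only on a.e. classes. *)
definition nonneg_sublinear_on ::
    "(real^'n \<Rightarrow> complex) set \<Rightarrow> ((real^'n \<Rightarrow> complex) \<Rightarrow> real^'n \<Rightarrow> ennreal) \<Rightarrow> bool" where
  "nonneg_sublinear_on D A \<longleftrightarrow>
     (\<forall>f\<in>D. A f \<in> borel_measurable lebesgue \<and> (AE x in lebesgue. A f x < \<infinity>)) \<and>
     (\<forall>f\<in>D. \<forall>g\<in>D. (AE x in lebesgue. f x = g x) \<longrightarrow> (AE x in lebesgue. A f x = A g x)) \<and>
     (\<forall>f\<in>D. \<forall>g\<in>D. AE x in lebesgue. A (\<lambda>y. f y + g y) x \<le> A f x + A g x) \<and>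
     (\<forall>f\<in>D. \<forall>c. AE x in lebesgue. A (\<lambda>y. c * f y) x = ennreal (cmod c) * A f x)"

definition weak_type ::
    "real \<Rightarrow> ((real^'n \<Rightarrow> complex) \<Rightarrow> real^'n \<Rightarrow> ennreal) \<Rightarrow> bool" where
  "weak_type r A \<longleftrightarrow>
     nonneg_sublinear_on (Lp r) A \<and>
     (\<exists>C>0. \<forall>f\<in>Lp r. \<forall>t>0.
        emeasure lebesgue {x. A f x > ennreal t}
          \<le> ennreal (C powr r / t powr r) * (\<integral>\<^sup>+y. ennreal (cmod (f y) powr r) \<partial>lebesgue))"

definition extends_from ::
    "(real^'n \<Rightarrow> complex) set \<Rightarrow> ((real^'n \<Rightarrow> complex) \<Rightarrow> real^'n \<Rightarrow> ennreal) \<Rightarrow>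
     ((real^'n \<Rightarrow> complex) \<Rightarrow> real^'n \<Rightarrow> ennreal) \<Rightarrow> bool" where
  "extends_from D A B \<longleftrightarrow> (\<forall>f\<in>D. AE x in lebesgue. B f x = A f x)"

(* For an operator A given only on Linf0, "of weak type (r,r)" refers to its extension to L^r. *)
definition extends_to_weak_type ::
    "real \<Rightarrow> ((real^'n \<Rightarrow> complex) \<Rightarrow> real^'n \<Rightarrow> ennreal) \<Rightarrow> bool" where
  "extends_to_weak_type r A \<longleftrightarrow> (\<exists>B. extends_from Linf0 A B \<and> weak_type r B)"

definition extends_to_bounded ::
    "((real^'n \<Rightarrow> ennreal) \<Rightarrow> ennreal) \<Rightarrow> ((real^'n \<Rightarrow> complex) \<Rightarrow> real^'n \<Rightarrow> ennreal) \<Rightarrow> bool" where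
  "extends_to_bounded \<rho> A \<longleftrightarrow>
     (\<exists>B. extends_from Linf0 A B \<and> nonneg_sublinear_on (bfs \<rho>) B \<and> bounded_on_bfs \<rho> B)"

lemma is_ae_SUP_countable:
  fixes h :: "'i \<Rightarrow> real^'n \<Rightarrow> ennreal"
  assumes "countable I" "\<And>i. i \<in> I \<Longrightarrow> h i \<in> borel_measurable lebesgue"
  shows "is_ae_SUP I h (\<lambda>x. SUP i\<in>I. h i x)"
  unfolding is_ae_SUP_def
proof (intro conjI ballI impI)
  show "(\<lambda>x. SUP i\<in>I. h i x) \<in> borel_measurable lebesgue"
    using assms by (intro borel_measurable_SUP) auto
  show "AE x in lebesgue. h i x \<le> (SUP i\<in>I. h i x)" if "i \<in> I" for i
    using that by (intro AE_I2 SUP_upper)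
  fix g assume "\<forall>i\<in>I. AE x in lebesgue. h i x \<le> g x"
  then have "AE x in lebesgue. \<forall>i\<in>I. h i x \<le> g x"
    using assms(1) by (simp add: AE_ball_countable)
  then show "AE x in lebesgue. (SUP i\<in>I. h i x) \<le> g x"
    by eventually_elim (auto intro: SUP_least)
qed

lemma ennreal_inverse_antimono:
  assumes xy: "x \<le> y"
  shows "inverse y \<le> inverse (x::ennreal)"
proof (cases "x = 0 \<or> y = top")
  case False
  with xy show ?thesis
    by (cases x; cases y) (auto simp: inverse_ennreal top_unique)
qed auto

lemma ennreal_inverse_inverse: "inverse (inverse x) = (x::ennreal)"
proof (cases "x = 0")
  case False
  then show ?thesis by (cases x) (auto simp: inverse_ennreal)
qed auto

lemma ex_countable_ae_SUP:
  fixes h :: "'i \<Rightarrow> real^'n \<Rightarrow> ennreal"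
  assumes h: "\<And>i. i \<in> I \<Longrightarrow> h i \<in> borel_measurable lebesgue"
  shows "\<exists>J\<subseteq>I. countable J \<and> is_ae_SUP I h (\<lambda>x. SUP i\<in>J. h i x)"
proof -
  obtain w :: "real^'n \<Rightarrow> ennreal" where w: "w \<in> borel_measurable lborel"
    "integral\<^sup>N lborel w \<noteq> \<infinity>" "\<And>x. 0 < w x" "\<And>x. w x < \<infinity>"
    using sigma_finite_measure.Ex_finite_integrable_function[OF sigma_finite_lborel] by auto
  have wm: "w \<in> borel_measurable lebesgue"
    using w(1) by (rule measurable_completion)
  have wfin: "integral\<^sup>N lebesgue w \<noteq> \<infinity>"
    using w(1,2) by (simp add: nn_integral_completion)
  define S where "S J x = (SUP i\<in>J. h i x)" for J x
  define F where "F J x = w x * inverse (1 + S J x)" for J x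
  define V where "V J = integral\<^sup>N lebesgue (F J)" for J
  have Sm: "S J \<in> borel_measurable lebesgue" if "J \<subseteq> I" "countable J" for J
    unfolding S_def using that h by (intro borel_measurable_SUP) auto
  have Fm: "F J \<in> borel_measurable lebesgue" if "J \<subseteq> I" "countable J" for J
    unfolding F_def using wm Sm[OF that] by measurable
  have Fmono: "F J' x \<le> F J x" if "J \<subseteq> J'" for J J' x
    unfolding F_def S_def using that
    by (intro mult_left_mono) (auto intro!: ennreal_inverse_antimono add_left_mono SUP_subset_mono)
  have Fw: "F J x \<le> w x" for J x
  proof -
    have "inverse (1 + S J x) \<le> inverse 1"
      by (intro ennreal_inverse_antimono) simp
    then have "w x * inverse (1 + S J x) \<le> w x * 1"
      by (intro mult_left_mono) auto
    then show ?thesis by (simp add: F_def)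
  qed
  have Vfin: "V J \<noteq> \<infinity>" for J
    using nn_integral_mono[of lebesgue "F J" w] Fw wfin by (auto simp: V_def top_unique)
  let ?C = "{J. J \<subseteq> I \<and> countable J}"
  have ne: "V ` ?C \<noteq> {}" by auto
  obtain v where v: "range v \<subseteq> V ` ?C" "(INF n::nat. v n) = Inf (V ` ?C)"
    using ennreal_Inf_countable_INF[OF ne] by metis
  then have "\<forall>n. \<exists>J. J \<in> ?C \<and> v n = V J" by blast
  then obtain Js where Js: "\<And>n. Js n \<in> ?C" "\<And>n. v n = V (Js n)" by metis
  define J where "J = (\<Union>n. Js n)"
  have J: "J \<subseteq> I" "countable J" using Js(1) by (auto simp: J_def)
  have VJ: "V J \<le> Inf (V ` ?C)"
  proof -
    have "V J \<le> v n" for n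
      unfolding Js(2) V_def by (intro nn_integral_mono Fmono) (auto simp: J_def)
    then show ?thesis unfolding v(2)[symmetric] by (intro INF_greatest)
  qed
  have dom: "AE x in lebesgue. h i x \<le> S J x" if i: "i \<in> I" for i
  proof -
    let ?J = "insert i J"
    have J': "?J \<subseteq> I" "countable ?J" using J i by auto
    have "Inf (V ` ?C) \<le> V ?J" using J' by (intro Inf_lower imageI) simp
    with VJ have "V J \<le> V ?J" by (rule order_trans)
    have le: "F ?J x \<le> F J x" for x by (intro Fmono) auto
    have "(\<integral>\<^sup>+x. F J x - F ?J x \<partial>lebesgue) = V J - V ?J"
      unfolding V_def
      by (rule nn_integral_diff[OF Fm[OF J] Fm[OF J'] Vfin[unfolded V_def] AE_I2[OF le]])
    also have "\<dots> = 0"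
      using \<open>V J \<le> V ?J\<close> Vfin[of ?J] by (simp add: diff_eq_0_iff_ennreal less_top)
    finally have "AE x in lebesgue. F J x - F ?J x = 0"
      using nn_integral_0_iff_AE[OF borel_measurable_minus_ennreal[OF Fm[OF J] Fm[OF J']]] by simp
    then show ?thesis
    proof eventually_elim
      case (elim x)
      have "F J x < \<infinity>" using Fw[of J x] w(4)[of x] by (rule order_le_less_trans)
      then have "F J x \<le> F ?J x"
        using elim by (auto simp: diff_eq_0_iff_ennreal)
      then have "inverse (1 + S J x) \<le> inverse (1 + S ?J x)"
        using w(3,4)[of x] ennreal_mult_le_mult_iff[of "w x"] by (simp add: F_def)
      then have "1 + S ?J x \<le> 1 + S J x"
        using ennreal_inverse_antimono[of "inverse (1 + S J x)" "inverse (1 + S ?J x)"]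
        by (simp only: ennreal_inverse_inverse)
      then have "S ?J x \<le> S J x" by (simp add: ennreal_add_left_cancel_le)
      moreover have "h i x \<le> S ?J x" unfolding S_def by (intro SUP_upper) auto
      ultimately show ?case by simp
    qed
  qed
  have "is_ae_SUP J h (S J)"
    unfolding S_def using J h by (intro is_ae_SUP_countable) auto
  then have "is_ae_SUP I h (S J)"
    using dom J(1) unfolding is_ae_SUP_def by (simp add: subset_eq)
  then have "J \<subseteq> I \<and> countable J \<and> is_ae_SUP I h (\<lambda>x. SUP i\<in>J. h i x)"
    using J unfolding S_def by simp
  then show ?thesis by (rule exI)
qed

lemma ae_SUP_spec:
  fixes h :: "'i \<Rightarrow> real^'n \<Rightarrow> ennreal"
  assumes "\<And>i. i \<in> I \<Longrightarrow> h i \<in> borel_measurable lebesgue"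
  shows "is_ae_SUP I h (ae_SUP I h)"
  unfolding ae_SUP_def
proof (rule someI_ex[of "is_ae_SUP I h"])
  obtain J where "is_ae_SUP I h (\<lambda>x. SUP i\<in>J. h i x)"
    using ex_countable_ae_SUP[of I h] assms by auto
  then show "\<exists>s. is_ae_SUP I h s" by (rule exI[of "is_ae_SUP I h"])
qed

end

theory Submission
  imports Defs
begin

text \<open>
  Fix \<open>f\<close> bounded with compact support. Rubio de Francia's iteration of the maximal operator yields a
  majorant \<open>v \<ge> \<bar>f\<bar>\<close> of comparable norm with \<open>M v \<le> A v\<close>, where \<open>A\<close> does not depend on \<open>f\<close>; such
  weights satisfy a reverse Hoelder inequality with some exponent \<open>r > 1\<close>, also independent of \<open>f\<close>.
  On a cube \<open>Q\<close>, the weak type \<open>(r, r)\<close> controls the local part of \<open>T\<^sup>\<Phi> f\<close> and the smoothness of the kernel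
  controls the rest, so that off a small portion of \<open>Q\<close> the function \<open>T\<^sup>\<Phi> f\<close> differs from a constant
  by at most a multiple of the infimum of \<open>v\<close> over \<open>Q\<close>. Iterating this along dyadic stopping cubes gives
  \<open>\<integral> (T\<^sup>\<Phi> f) g \<le> C \<integral> v (M g)\<close>, and the boundedness of \<open>M\<close> on \<open>X'\<close> together with \<open>X = X''\<close> turns
  this into the norm bound. Separability makes the norm absolutely continuous, hence bounded
  functions with compact support dense, and the operator extends along fast converging sequences.
\<close>

section \<open>Cubes and the maximal function\<close>

text \<open>The assumption for all \<open>r > 1\<close> is forced by the weight: \<open>A\<close>
  comes from the norm of \<open>M\<close> on \<open>X\<close> and may be large, and the exponent
  chosen for the reverse Hoelder inequality approaches 1 as \<open>A\<close> grows, so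
  \<open>r\<close> cannot be fixed beforehand. Domination by \<open>v\<close> makes the local
  estimates uniform: the averages of \<open>\<bar>f\<bar>\<close> over all large balls about the
  corner of a cube, and the local average of the power \<open>r\<close> of
  \<open>\<bar>f\<bar>\<close>, are all controlled by one number, the infimum of \<open>v\<close>
  over the cube. This number times \<open>\<integral> g\<close> over the cube can then be charged to
  \<open>\<integral> v (M g)\<close> over the part of the cube left free by its stopping children.
  The iteration sees only differences from constants attached to cubes. The constants disappear on
  cubes that are large compared with the support of \<open>f\<close>, because there the far part of
  \<open>f\<close> vanishes. As \<open>T\<^sup>\<Phi> f\<close> is an a.e. supremum over a possibly
  uncountable family, every comparison with a constant holds off a null set, and suprema have to be
  reached along sequences of phases.\<close>

definition hcube :: "real^'n \<Rightarrow> real \<Rightarrow> (real^'n) set" where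
  "hcube a l = {y. \<forall>i. a $ i \<le> y $ i \<and> y $ i < a $ i + l}"

text \<open>The maximal operator with both arguments and values in \<open>ennreal\<close>.
  \<open>hl_maximal\<close> takes complex functions to \<open>ennreal\<close>-valued ones and so
  cannot be iterated; this form can.\<close>

definition mx :: "(real^'n \<Rightarrow> ennreal) \<Rightarrow> real^'n \<Rightarrow> ennreal" where
  "mx g x = (SUP Q\<in>{Q \<in> cubes. x \<in> Q}. (\<integral>\<^sup>+y\<in>Q. g y \<partial>lebesgue) / emeasure lebesgue Q)"

lemma hl_maximal_eq_mx: "hl_maximal f = mx (\<lambda>y. ennreal (cmod (f y)))"
  by (rule ext) (simp add: hl_maximal_def mx_def)

lemma emeasure_cube:
  fixes a :: "real^'n"
  assumes "l \<ge> 0"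
  shows "emeasure lebesgue (cbox a (\<chi> i. a $ i + l)) = ennreal (l ^ CARD('n))"
proof -
  have "a \<in> cbox a (\<chi> i. a $ i + l)" using assms by (simp add: mem_box_cart)
  then have "measure lborel (cbox a (\<chi> i. a $ i + l)) = l ^ CARD('n)"
    by (subst content_cbox_cart) auto
  then show ?thesis
    using emeasure_eq_ennreal_measure[of lborel "cbox a (\<chi> i. a $ i + l)"]
      emeasure_lborel_cbox_finite[of a "\<chi> i. a $ i + l"] by simp
qed

text \<open>Half-open cubes are partitioned exactly by dyadic subdivision, while closed cubes enter
  the maximal function. This inclusion, with the equality of the two measures, carries estimates
  from one kind to the other.\<close>

lemma hcube_subset_cube: "hcube a l \<subseteq> cbox a (\<chi> i. a $ i + l)"
  by (auto simp: hcube_def mem_box_cart less_imp_le)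

lemma cube_in_cubes: "l > 0 \<Longrightarrow> cbox a (\<chi> i. a $ i + l) \<in> cubes"
  by (auto simp: cubes_def)

lemma sets_hcube [measurable]: "hcube a l \<in> sets lebesgue"
proof -
  have "hcube a l = (\<Inter>i. {y. a $ i \<le> y $ i} \<inter> {y. y $ i < a $ i + l})"
    by (auto simp: hcube_def)
  also have "\<dots> \<in> sets borel"
    by (intro sets.countable_INT'' sets.Int borel_closed borel_open
        closed_Collect_le open_Collect_less continuous_intros) auto
  finally show ?thesis by simp
qed

lemma sets_cbox_lebesgue [measurable]: "cbox a b \<in> sets lebesgue"
  by simp

lemma emeasure_hcube:
  fixes a :: "real^'n"
  assumes "l > 0"
  shows "emeasure lebesgue (hcube a l) = ennreal (l ^ CARD('n))"
proof (rule antisym)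
  show "emeasure lebesgue (hcube a l) \<le> ennreal (l ^ CARD('n))"
    using emeasure_mono[OF hcube_subset_cube[of a l], of lebesgue] emeasure_cube[of l a] assms
    by simp
  have ne: "box a (\<chi> i. a $ i + l) \<noteq> {}"
    using assms by (simp add: interval_ne_empty_cart)
  have "ennreal (l ^ CARD('n)) = emeasure lebesgue (cbox a (\<chi> i. a $ i + l))"
    using emeasure_cube[of l a] assms by simp
  also have "\<dots> = emeasure lebesgue (box a (\<chi> i. a $ i + l))"
    by (simp add: emeasure_lborel_cbox_eq emeasure_lborel_box_eq)
  also have "\<dots> \<le> emeasure lebesgue (hcube a l)"
    by (intro emeasure_mono) (auto simp: hcube_def mem_box_cart less_imp_le)
  finally show "ennreal (l ^ CARD('n)) \<le> emeasure lebesgue (hcube a l)" .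
qed

lemma ennreal_div_le_iff:
  assumes "c > 0"
  shows "x / ennreal c \<le> y \<longleftrightarrow> x \<le> y * ennreal c"
proof
  assume "x / ennreal c \<le> y"
  then have "x / ennreal c * ennreal c \<le> y * ennreal c" by (rule mult_right_mono) simp
  then show "x \<le> y * ennreal c" using assms by (simp add: ennreal_divide_times)
next
  assume "x \<le> y * ennreal c"
  then show "x / ennreal c \<le> y" using assms
    by (intro divide_le_posI_ennreal) (auto simp: mult.commute)
qed

text \<open>The average is kept multiplied out, since products with a positive finite factor are
  easier in \<open>ennreal\<close> than quotients. \<open>mx_le\<close> is the matching introduction
  rule.\<close>

lemma mx_upper:
  fixes a :: "real^'n"
  assumes "l > 0" "x \<in> cbox a (\<chi> i. a $ i + l)"
  shows "(\<integral>\<^sup>+y\<in>cbox a (\<chi> i. a $ i + l). g y \<partial>lebesgue) \<le> mx g x * ennreal (l ^ CARD('n))"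
proof -
  have "(\<integral>\<^sup>+y\<in>cbox a (\<chi> i. a $ i + l). g y \<partial>lebesgue) / ennreal (l ^ CARD('n)) \<le> mx g x"
    unfolding mx_def using assms cube_in_cubes[of l a] emeasure_cube[of l a]
    by (intro SUP_upper2[of "cbox a (\<chi> i. a $ i + l)"]) auto
  then show ?thesis using assms by (subst (asm) ennreal_div_le_iff) auto
qed

lemma mx_le:
  fixes x :: "real^'n"
  assumes "\<And>a l. l > 0 \<Longrightarrow> x \<in> cbox a (\<chi> i. a $ i + l) \<Longrightarrow>
    (\<integral>\<^sup>+y\<in>cbox a (\<chi> i. a $ i + l). g y \<partial>lebesgue) \<le> c * ennreal (l ^ CARD('n))"
  shows "mx g x \<le> c"
  unfolding mx_def
proof (rule SUP_least)
  fix Q assume "Q \<in> {Q \<in> cubes. x \<in> Q}"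
  then obtain a l where "l > 0" "Q = cbox a (\<chi> i. a $ i + l)" "x \<in> Q"
    by (auto simp: cubes_def)
  with assms[of l a] show "(\<integral>\<^sup>+y\<in>Q. g y \<partial>lebesgue) / emeasure lebesgue Q \<le> c"
    using emeasure_cube[of l a] by (simp add: ennreal_div_le_iff)
qed

lemma mx_upper_hcube:
  fixes a :: "real^'n"
  assumes "l > 0" "x \<in> hcube a l"
  shows "(\<integral>\<^sup>+y\<in>hcube a l. g y \<partial>lebesgue) \<le> mx g x * ennreal (l ^ CARD('n))"
proof -
  have "(\<integral>\<^sup>+y\<in>hcube a l. g y \<partial>lebesgue) \<le> (\<integral>\<^sup>+y\<in>cbox a (\<chi> i. a $ i + l). g y \<partial>lebesgue)"
    using hcube_subset_cube[of a l] by (intro nn_integral_mono) (auto split: split_indicator)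
  also have "\<dots> \<le> mx g x * ennreal (l ^ CARD('n))"
    using assms hcube_subset_cube[of a l] by (intro mx_upper) auto
  finally show ?thesis .
qed

lemma mx_cong_AE:
  assumes "AE x in lebesgue. f x = g x"
  shows "mx f = mx g"
proof -
  have "(\<integral>\<^sup>+y\<in>Q. f y \<partial>lebesgue) = (\<integral>\<^sup>+y\<in>Q. g y \<partial>lebesgue)" for Q
    using assms by (intro nn_integral_cong_AE) (auto elim: eventually_mono)
  then show ?thesis unfolding mx_def by simp
qed

lemma mx_suminf_le:
  fixes f :: "nat \<Rightarrow> real^'n \<Rightarrow> ennreal"
  assumes "\<And>k. f k \<in> borel_measurable lebesgue"
  shows "mx (\<lambda>y. \<Sum>k. f k y) x \<le> (\<Sum>k. mx (f k) x)"
proof (rule mx_le)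
  fix a :: "real^'n" and l :: real assume l: "l > 0" "x \<in> cbox a (\<chi> i. a $ i + l)"
  let ?Q = "cbox a (\<chi> i. a $ i + l)"
  have "(\<integral>\<^sup>+y\<in>?Q. (\<Sum>k. f k y) \<partial>lebesgue) = (\<integral>\<^sup>+y. (\<Sum>k. f k y * indicator ?Q y) \<partial>lebesgue)"
    by (simp add: ennreal_suminf_multc)
  also have "\<dots> = (\<Sum>k. \<integral>\<^sup>+y\<in>?Q. f k y \<partial>lebesgue)"
    using assms by (intro nn_integral_suminf) auto
  also have "\<dots> \<le> (\<Sum>k. mx (f k) x * ennreal (l ^ CARD('n)))"
    using l by (intro suminf_le mx_upper) auto
  finally show "(\<integral>\<^sup>+y\<in>?Q. (\<Sum>k. f k y) \<partial>lebesgue) \<le> (\<Sum>k. mx (f k) x) * ennreal (l ^ CARD('n))"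
    by (simp add: ennreal_suminf_multc)
qed

lemma mx_cmult_le:
  fixes f :: "real^'n \<Rightarrow> ennreal"
  assumes "f \<in> borel_measurable lebesgue"
  shows "mx (\<lambda>y. c * f y) x \<le> c * mx f x"
proof (rule mx_le)
  fix a :: "real^'n" and l :: real assume l: "l > 0" "x \<in> cbox a (\<chi> i. a $ i + l)"
  let ?Q = "cbox a (\<chi> i. a $ i + l)"
  have "(\<integral>\<^sup>+y\<in>?Q. c * f y \<partial>lebesgue) = c * (\<integral>\<^sup>+y\<in>?Q. f y \<partial>lebesgue)"
    using assms by (subst nn_integral_cmult[symmetric]) (auto simp: mult.assoc)
  also have "\<dots> \<le> c * (mx f x * ennreal (l ^ CARD('n)))"
    using l by (intro mult_left_mono mx_upper) auto
  finally show "(\<integral>\<^sup>+y\<in>?Q. c * f y \<partial>lebesgue) \<le> c * mx f x * ennreal (l ^ CARD('n))"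
    by (simp add: mult.assoc)
qed

text \<open>If the average over a cube exceeds \<open>t\<close>, it still does after the cube is
  enlarged slightly on all sides, because the volume depends continuously on the side. The interior
  of the enlarged cube then lies in the set, and it contains the original point even if that point
  was on the boundary.\<close>

lemma open_mx_greater: "open {x. t < mx g x}"
  for g :: "real^'n \<Rightarrow> ennreal"
proof (subst open_subopen, safe)
  fix x assume "t < mx g x"
  then obtain a l where l: "l > 0" "x \<in> cbox a (\<chi> i. a $ i + l)"
    and t: "t < (\<integral>\<^sup>+y\<in>cbox a (\<chi> i. a $ i + l). g y \<partial>lebesgue) / emeasure lebesgue (cbox a (\<chi> i. a $ i + l))"
    unfolding mx_def less_SUP_iff by (auto simp: cubes_def)
  define J where "J = (\<integral>\<^sup>+y\<in>cbox a (\<chi> i. a $ i + l). g y \<partial>lebesgue)"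
  have "\<not> J \<le> t * ennreal (l ^ CARD('n))"
    using t l emeasure_cube[of l a] by (subst ennreal_div_le_iff[symmetric]) (auto simp: J_def)
  then have tJ: "t * ennreal (l ^ CARD('n)) < J" by simp
  have "t < \<infinity>" using order_less_le_trans[OF t top_greatest] by simp
  then obtain s where s: "t = ennreal s" "s \<ge> 0" by (cases t) auto
  have "((\<lambda>e. ennreal (s * (l + 2 * e) ^ CARD('n))) \<longlongrightarrow> ennreal (s * (l + 2 * 0) ^ CARD('n))) (at_right 0)"
    by (intro tendsto_intros)
  moreover have "ennreal (s * (l + 2 * 0) ^ CARD('n)) < J"
    using tJ s l by (simp add: ennreal_mult)
  ultimately have "\<forall>\<^sub>F e in at_right 0. ennreal (s * (l + 2 * e) ^ CARD('n)) < J"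
    by (rule order_tendstoD(2))
  moreover have "\<forall>\<^sub>F e::real in at_right 0. e > 0"
    by (simp add: eventually_at_right_less)
  ultimately obtain e where e: "e > 0" "ennreal (s * (l + 2 * e) ^ CARD('n)) < J"
    by (metis (mono_tags, lifting) eventually_conj eventually_happens trivial_limit_at_right_real)
  define b where "b = (\<chi> i. a $ i - e)"
  let ?Q = "cbox b (\<chi> i. b $ i + (l + 2 * e))"
  have sub: "cbox a (\<chi> i. a $ i + l) \<subseteq> ?Q"
  proof
    fix y assume "y \<in> cbox a (\<chi> i. a $ i + l)"
    then have "a $ i \<le> y $ i \<and> y $ i \<le> a $ i + l" for i by (simp add: mem_box_cart)
    then have "a $ i - e \<le> y $ i \<and> y $ i \<le> a $ i + l + e" for i using e(1) by (smt (verit))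
    then show "y \<in> ?Q" by (simp add: mem_box_cart b_def algebra_simps)
  qed
  have "t < mx g y" if "y \<in> box b (\<chi> i. b $ i + (l + 2 * e))" for y
  proof -
    have "J \<le> (\<integral>\<^sup>+y\<in>?Q. g y \<partial>lebesgue)"
      unfolding J_def using sub by (intro nn_integral_mono) (auto split: split_indicator)
    also have "\<dots> \<le> mx g y * ennreal ((l + 2 * e) ^ CARD('n))"
      using that l e box_subset_cbox[of b] by (intro mx_upper) auto
    finally have "t * ennreal ((l + 2 * e) ^ CARD('n)) < mx g y * ennreal ((l + 2 * e) ^ CARD('n))"
      using e s l by (simp add: ennreal_mult)
    then show ?thesis by (metis linorder_not_less mult_right_mono zero_le)
  qed
  moreover have "x \<in> box b (\<chi> i. b $ i + (l + 2 * e))"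
  proof -
    have "a $ i \<le> x $ i \<and> x $ i \<le> a $ i + l" for i using l by (simp add: mem_box_cart)
    then have "a $ i - e < x $ i \<and> x $ i < a $ i + l + e" for i using e(1) by (smt (verit))
    then show ?thesis by (simp add: mem_box_cart b_def algebra_simps)
  qed
  ultimately show "\<exists>T. open T \<and> x \<in> T \<and> T \<subseteq> {x. t < mx g x}"
    by (intro exI[of _ "box b (\<chi> i. b $ i + (l + 2 * e))"]) auto
qed

lemma mx_measurable [measurable]:
  "mx g \<in> borel_measurable lebesgue"
  for g :: "real^'n \<Rightarrow> ennreal"
proof -
  have "mx g \<in> borel_measurable borel"
    by (rule borel_measurableI_greater) (simp add: open_mx_greater borel_open)
  then show ?thesis
    by (simp add: measurable_completion)
qed

section \<open>Dyadic stopping cubes\<close>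

text \<open>The lower corner of the \<open>j\<close>-th generation dyadic subcube of \<open>hcube a l\<close> containing \<open>x\<close>.\<close>

definition corner :: "real^'n \<Rightarrow> real \<Rightarrow> nat \<Rightarrow> real^'n \<Rightarrow> real^'n" where
  "corner a l j x = (\<chi> i. a $ i + l / 2 ^ j * of_int \<lfloor>(x $ i - a $ i) * 2 ^ j / l\<rfloor>)"

abbreviation cell :: "real^'n \<Rightarrow> real \<Rightarrow> nat \<Rightarrow> real^'n \<Rightarrow> (real^'n) set" where
  "cell a l j x \<equiv> hcube (corner a l j x) (l / 2 ^ j)"

text \<open>Cells of one generation are the fibres of the map to the integer parts of the rescaled
  coordinates. Lying in the same cell is therefore an equivalence relation, which yields
  \<open>corner_eq\<close> and the disjointness of distinct cells.\<close>

lemma mem_cell_iff: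
  assumes "l > 0"
  shows "y \<in> cell a l j x \<longleftrightarrow>
    (\<forall>i. \<lfloor>(y $ i - a $ i) * 2 ^ j / l\<rfloor> = \<lfloor>(x $ i - a $ i) * 2 ^ j / l\<rfloor>)"
proof -
  have "(a $ i + l / 2 ^ j * of_int k \<le> y $ i \<and> y $ i < a $ i + l / 2 ^ j * of_int k + l / 2 ^ j)
     \<longleftrightarrow> \<lfloor>(y $ i - a $ i) * 2 ^ j / l\<rfloor> = k" for i and k :: int
  proof -
    have "(a $ i + l / 2 ^ j * of_int k \<le> y $ i) \<longleftrightarrow> of_int k \<le> (y $ i - a $ i) * 2 ^ j / l"
      using assms by (simp add: field_simps)
    moreover have "(y $ i < a $ i + l / 2 ^ j * of_int k + l / 2 ^ j) \<longleftrightarrow>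
        (y $ i - a $ i) * 2 ^ j / l < of_int k + 1"
      using assms by (simp add: field_simps)
    ultimately show ?thesis by (simp add: floor_eq_iff)
  qed
  then show ?thesis by (simp add: hcube_def corner_def)
qed

lemma self_in_cell: "l > 0 \<Longrightarrow> x \<in> cell a l j x"
  by (simp add: mem_cell_iff)

lemma corner_eq: "l > 0 \<Longrightarrow> y \<in> cell a l j x \<Longrightarrow> corner a l j y = corner a l j x"
  unfolding mem_cell_iff by (simp add: corner_def)

lemma floor_half: "\<lfloor>t / 2\<rfloor> = \<lfloor>t\<rfloor> div 2" for t :: real
  by (metis floor_divide_real_eq_div of_int_numeral zero_le_numeral)

text \<open>The integer index of the parent is that of the child divided by two, rounded
  down.\<close>

lemma cell_Suc_subset:
  assumes "l > 0"
  shows "cell a l (Suc j) x \<subseteq> cell a l j x"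
proof
  fix y assume "y \<in> cell a l (Suc j) x"
  then have *: "\<lfloor>(y $ i - a $ i) * 2 ^ Suc j / l\<rfloor> = \<lfloor>(x $ i - a $ i) * 2 ^ Suc j / l\<rfloor>" for i
    using assms by (subst (asm) mem_cell_iff) auto
  have "\<lfloor>(z $ i - a $ i) * 2 ^ j / l\<rfloor> = \<lfloor>(z $ i - a $ i) * 2 ^ Suc j / l\<rfloor> div 2" for z i
    using floor_half[of "(z $ i - a $ i) * 2 ^ Suc j / l"] by simp
  with * show "y \<in> cell a l j x" using assms by (subst mem_cell_iff) auto
qed

lemma cell_antimono:
  assumes "l > 0" "j \<le> k"
  shows "cell a l k x \<subseteq> cell a l j x"
  using assms(2) by (induction rule: dec_induct) (use cell_Suc_subset[OF assms(1)] in blast)+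

lemma corner_0:
  assumes "l > 0" "x \<in> hcube a l"
  shows "corner a l 0 x = a"
proof -
  have "\<lfloor>(x $ i - a $ i) / l\<rfloor> = 0" for i
    using assms by (auto simp: hcube_def floor_eq_iff field_simps)
  then show ?thesis by (simp add: corner_def vec_eq_iff)
qed

lemma cell_subset: "l > 0 \<Longrightarrow> x \<in> hcube a l \<Longrightarrow> cell a l j x \<subseteq> hcube a l"
  using cell_antimono[of l 0 j a x] corner_0[of l x a] by simp

lemma countable_cells: "countable {(corner a l j x, l / 2 ^ j) | j x. True}"
  for a :: "real^'n"
proof -
  let ?f = "\<lambda>(j::nat, k::int^'n). (\<chi> i. a $ i + l / 2 ^ j * of_int (k $ i), l / 2 ^ j)"
  have "(corner a l j x, l / 2 ^ j) = ?f (j, \<chi> i. \<lfloor>(x $ i - a $ i) * 2 ^ j / l\<rfloor>)" for j x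
    by (simp add: corner_def)
  then have "{(corner a l j x, l / 2 ^ j) | j x. True} \<subseteq> range ?f" by blast
  then show ?thesis by (rule countable_subset) simp
qed

lemma cell_dist:
  fixes x :: "real^'n"
  assumes "l > 0" "y \<in> cell a l j x"
  shows "dist y x \<le> real CARD('n) * (l / 2 ^ j)"
proof -
  have "\<bar>(y - x) $ i\<bar> \<le> l / 2 ^ j" for i
    using assms(2) self_in_cell[OF assms(1), of x a j] unfolding hcube_def
    by (auto simp: abs_le_iff) (smt (verit))+
  then have "(\<Sum>i\<in>UNIV. \<bar>(y - x) $ i\<bar>) \<le> (\<Sum>i\<in>(UNIV::'n set). l / 2 ^ j)"
    by (intro sum_mono)
  with norm_le_l1_cart[of "y - x"] show ?thesis by (simp add: dist_norm)
qed

text \<open>A point stops at the first generation \<open>N x\<close> whose cell satisfies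
  \<open>P\<close>. A point \<open>y\<close> of the stopped cell of \<open>x\<close> shares all
  coarser cells with \<open>x\<close>, so it stops in the same cell; this makes the stopped cells
  disjoint. By minimality the parent of a stopped cell violates \<open>P\<close>, unless the initial
  cube itself stops.\<close>

lemma stopping_cells:
  fixes a :: "real^'n" and P :: "real^'n \<Rightarrow> real \<Rightarrow> bool"
  assumes l: "l > 0"
  obtains C where "countable C"
    and "disjoint_family_on (\<lambda>(b, s). hcube b s) C"
    and "(\<Union>(b, s)\<in>C. hcube b s) = {x \<in> hcube a l. \<exists>j. P (corner a l j x) (l / 2 ^ j)}"
    and "\<And>b s. (b, s) \<in> C \<Longrightarrow> s > 0 \<and> P b s"
    and "\<And>b s. (b, s) \<in> C \<Longrightarrow> (b, s) = (a, l) \<or>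
           (\<exists>b'. hcube b s \<subseteq> hcube b' (2 * s) \<and> hcube b' (2 * s) \<subseteq> hcube a l \<and> \<not> P b' (2 * s))"
proof -
  define S where "S = {x \<in> hcube a l. \<exists>j. P (corner a l j x) (l / 2 ^ j)}"
  define N where "N x = (LEAST j. P (corner a l j x) (l / 2 ^ j))" for x
  define C where "C = (\<lambda>x. (corner a l (N x) x, l / 2 ^ N x)) ` S"
  have PN: "P (corner a l (N x) x) (l / 2 ^ N x)" if "x \<in> S" for x
    using that LeastI_ex[of "\<lambda>j. P (corner a l j x) (l / 2 ^ j)"] by (auto simp: S_def N_def)
  have nP: "\<not> P (corner a l j x) (l / 2 ^ j)" if "j < N x" for j x
    using that not_less_Least[of j "\<lambda>j. P (corner a l j x) (l / 2 ^ j)"] by (auto simp: N_def)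
  have same: "N y = N x \<and> y \<in> S" if x: "x \<in> S" and y: "y \<in> cell a l (N x) x" for x y
  proof -
    have eq: "corner a l j y = corner a l j x" if "j \<le> N x" for j
      using y cell_antimono[OF l that, of a x] by (intro corner_eq[OF l]) auto
    have "y \<in> hcube a l" using cell_subset[OF l, of x a "N x"] x y by (auto simp: S_def)
    moreover have P: "P (corner a l (N x) y) (l / 2 ^ N x)" using PN[OF x] eq by simp
    ultimately have "y \<in> S" by (auto simp: S_def)
    moreover have "N y \<le> N x" unfolding N_def[of y] using P by (rule Least_le)
    moreover have "\<not> N y < N x" using nP[of "N y" x] PN[OF \<open>y \<in> S\<close>] eq[of "N y"] by auto
    ultimately show ?thesis by simp
  qed
  show thesis
  proof
    show "countable C"
      by (rule countable_subset[OF _ countable_cells[of a l]]) (auto simp: C_def)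
    show "(\<Union>(b, s)\<in>C. hcube b s) = {x \<in> hcube a l. \<exists>j. P (corner a l j x) (l / 2 ^ j)}"
    proof -
      have "(\<Union>(b, s)\<in>C. hcube b s) = (\<Union>x\<in>S. cell a l (N x) x)" by (auto simp: C_def)
      also have "\<dots> = S" using same self_in_cell[OF l] by blast
      finally show ?thesis by (simp add: S_def)
    qed
    show "disjoint_family_on (\<lambda>(b, s). hcube b s) C"
      unfolding disjoint_family_on_def
    proof (intro ballI impI)
      fix p q assume C: "p \<in> C" "q \<in> C" and ne: "p \<noteq> q"
      then obtain x x' where x: "x \<in> S" "p = (corner a l (N x) x, l / 2 ^ N x)"
        and x': "x' \<in> S" "q = (corner a l (N x') x', l / 2 ^ N x')"
        by (auto simp: C_def)
      show "(case p of (b, s) \<Rightarrow> hcube b s) \<inter> (case q of (b, s) \<Rightarrow> hcube b s) = {}"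
      proof (rule ccontr)
        assume "\<not> ?thesis"
        then obtain y where y: "y \<in> cell a l (N x) x" "y \<in> cell a l (N x') x'" using x x' by auto
        then have "N x = N x'" using same x x' by metis
        moreover from this y have "corner a l (N x) x = corner a l (N x') x'"
          using corner_eq[OF l] by metis
        ultimately show False using ne x x' by auto
      qed
    qed
    fix b s assume "(b, s) \<in> C"
    then obtain x where x: "x \<in> S" "b = corner a l (N x) x" "s = l / 2 ^ N x"
      by (auto simp: C_def)
    show "s > 0 \<and> P b s" using PN x l by auto
    show "(b, s) = (a, l) \<or>
           (\<exists>b'. hcube b s \<subseteq> hcube b' (2 * s) \<and> hcube b' (2 * s) \<subseteq> hcube a l \<and> \<not> P b' (2 * s))"
    proof (cases "N x")
      case 0
      then show ?thesis using x corner_0[OF l, of x a] by (auto simp: S_def)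
    next
      case (Suc j)
      then have s: "2 * s = l / 2 ^ j" using x by simp
      have "hcube b s \<subseteq> hcube (corner a l j x) (2 * s)"
        using cell_Suc_subset[OF l, of a j x] unfolding s unfolding x(2,3) Suc .
      moreover have "hcube (corner a l j x) (2 * s) \<subseteq> hcube a l"
        using cell_subset[OF l, of x a j] x(1) unfolding s S_def by blast
      moreover have "\<not> P (corner a l j x) (2 * s)" using nP[of j x] unfolding s Suc by simp
      ultimately show ?thesis by blast
    qed
  qed
qed

text \<open>Countable additivity of the measure with density \<open>f\<close>. The integral over
  \<open>count_space\<close> stands for a sum over an index set without enumeration.\<close>

lemma nn_integral_countable_disjoint_UN:
  assumes "countable I" "disjoint_family_on X I" "\<And>i. i \<in> I \<Longrightarrow> X i \<in> sets M"
    and "f \<in> borel_measurable M"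
  shows "(\<integral>\<^sup>+x\<in>(\<Union>i\<in>I. X i). f x \<partial>M) = (\<integral>\<^sup>+i. (\<integral>\<^sup>+x\<in>X i. f x \<partial>M) \<partial>count_space I)"
proof -
  have UN: "(\<Union>i\<in>I. X i) \<in> sets M" using assms by auto
  have "(\<integral>\<^sup>+x\<in>(\<Union>i\<in>I. X i). f x \<partial>M) = emeasure (density M f) (\<Union>i\<in>I. X i)"
    using assms(4) UN by (simp add: emeasure_density)
  also have "\<dots> = (\<integral>\<^sup>+i. emeasure (density M f) (X i) \<partial>count_space I)"
    using assms by (intro emeasure_UN_countable) auto
  also have "\<dots> = (\<integral>\<^sup>+i. (\<integral>\<^sup>+x\<in>X i. f x \<partial>M) \<partial>count_space I)"
    using assms by (intro nn_integral_cong) (simp add: emeasure_density)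
  finally show ?thesis .
qed

text \<open>A dyadic substitute for the Lebesgue density theorem: cover the set by the maximal cells
  inside an open superset of nearly the same measure.\<close>

lemma null_if_density_le:
  fixes a :: "real^'n"
  assumes l: "l > 0" and E: "E \<in> sets lebesgue" "E \<subseteq> hcube a l" and \<theta>: "0 \<le> \<theta>" "\<theta> < 1"
    and dens: "\<And>x j. x \<in> E \<Longrightarrow>
      emeasure lebesgue (cell a l j x \<inter> E) \<le> ennreal \<theta> * emeasure lebesgue (cell a l j x)"
  shows "emeasure lebesgue E = 0"
proof -
  have fin: "emeasure lebesgue E < \<infinity>"
    using emeasure_mono[OF E(2), of lebesgue] emeasure_hcube[OF l, of a] by (auto simp: order_le_less_trans)
  then have lm: "E \<in> lmeasurable" using E by (simp add: fmeasurable_def)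
  have key: "emeasure lebesgue E \<le> ennreal \<theta> * emeasure lebesgue U" if U: "open U" "E \<subseteq> U" for U
  proof -
    \<comment> \<open>The second condition keeps only cells that meet \<open>E\<close>, for which
      alone the density hypothesis is available.\<close>
    define P where "P b s \<longleftrightarrow> hcube b s \<subseteq> U \<and> (\<exists>j. \<exists>y\<in>E. (b, s) = (corner a l j y, l / 2 ^ j))" for b s
    obtain C where C: "countable C" "disjoint_family_on (\<lambda>(b, s). hcube b s) C"
      "(\<Union>(b, s)\<in>C. hcube b s) = {x \<in> hcube a l. \<exists>j. P (corner a l j x) (l / 2 ^ j)}"
      "\<And>b s. (b, s) \<in> C \<Longrightarrow> s > 0 \<and> P b s"
      by (rule stopping_cells[OF l, of a P]) blast
    have cov: "E \<subseteq> (\<Union>i\<in>C. case i of (b, s) \<Rightarrow> hcube b s)"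
    proof
      fix x assume x: "x \<in> E"
      then obtain e where e: "e > 0" "ball x e \<subseteq> U" using U by (meson openE subsetD)
      obtain j where j: "real CARD('n) * l / e < 2 ^ j"
        using real_arch_pow[of 2] by auto
      have "cell a l j x \<subseteq> ball x e"
      proof
        fix y assume "y \<in> cell a l j x"
        then have "dist y x \<le> real CARD('n) * (l / 2 ^ j)" by (rule cell_dist[OF l])
        also have "\<dots> < e" using j e by (simp add: field_simps)
        finally show "y \<in> ball x e" by (simp add: dist_commute)
      qed
      then show "x \<in> (\<Union>i\<in>C. case i of (b, s) \<Rightarrow> hcube b s)"
        unfolding C(3) P_def using x E(2) e by blast
    qed
    have meas: "(case i of (b, s) \<Rightarrow> hcube b s) \<in> sets lebesgue" for i :: "(real^'n) \<times> real"
      by (auto split: prod.split)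
    have "E = (\<Union>i\<in>C. (case i of (b, s) \<Rightarrow> hcube b s) \<inter> E)" using cov by blast
    then have "emeasure lebesgue E = emeasure lebesgue (\<Union>i\<in>C. (case i of (b, s) \<Rightarrow> hcube b s) \<inter> E)" by simp
    also have "\<dots> = (\<integral>\<^sup>+i. emeasure lebesgue ((case i of (b, s) \<Rightarrow> hcube b s) \<inter> E) \<partial>count_space C)"
    proof (intro emeasure_UN_countable C(1))
      show "disjoint_family_on (\<lambda>i. (case i of (b, s) \<Rightarrow> hcube b s) \<inter> E) C"
        using C(2) unfolding disjoint_family_on_def by blast
    qed (use meas E in auto)
    also have "\<dots> \<le> (\<integral>\<^sup>+i. ennreal \<theta> * emeasure lebesgue (case i of (b, s) \<Rightarrow> hcube b s) \<partial>count_space C)"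
    proof (rule nn_integral_mono)
      fix i assume "i \<in> space (count_space C)"
      moreover obtain b s where "i = (b, s)" by fastforce
      ultimately have i: "i = (b, s)" "(b, s) \<in> C" by auto
      then obtain j y where "y \<in> E" "b = corner a l j y" "s = l / 2 ^ j" using C(4) unfolding P_def by blast
      then show "emeasure lebesgue ((case i of (b, s) \<Rightarrow> hcube b s) \<inter> E)
          \<le> ennreal \<theta> * emeasure lebesgue (case i of (b, s) \<Rightarrow> hcube b s)"
        using dens[of y j] i(1) by simp
    qed
    also have "\<dots> = ennreal \<theta> * emeasure lebesgue (\<Union>i\<in>C. (case i of (b, s) \<Rightarrow> hcube b s))"
      using C(1,2) meas by (subst emeasure_UN_countable) (auto simp: nn_integral_cmult)
    also have "\<dots> \<le> ennreal \<theta> * emeasure lebesgue U"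
      using C(4) U unfolding P_def by (intro mult_left_mono emeasure_mono) auto
    finally show ?thesis .
  qed
  \<comment> \<open>Outer regularity provides open \<open>U\<close> with measure as close to that of
    \<open>E\<close> as desired, so \<open>key\<close> bounds the measure of \<open>E\<close> by
    \<open>\<theta>\<close> times itself. As the measure is finite and \<open>\<theta> < 1\<close>,
    it is 0.\<close>
  have "measure lebesgue E \<le> \<theta> * measure lebesgue E + e" if e: "e > 0" for e
  proof -
    obtain U where U: "open U" "E \<subseteq> U" "U - E \<in> lmeasurable" "emeasure lebesgue (U - E) < ennreal e"
      using sets_lebesgue_outer_open[OF E(1) e] by metis
    have Um: "U \<in> sets lebesgue" using U(1) by simp
    have "emeasure lebesgue U = emeasure lebesgue E + emeasure lebesgue (U - E)"
      using U(2) E(1) Um plus_emeasure[of E lebesgue "U - E"] by (simp add: Un_absorb1)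
    also have "\<dots> \<le> ennreal (measure lebesgue E) + ennreal e"
      using U(4) lm by (intro add_mono) (auto simp: emeasure_eq_measure2)
    finally have "emeasure lebesgue E \<le> ennreal \<theta> * (ennreal (measure lebesgue E) + ennreal e)"
      using key[OF U(1,2)] by (meson mult_left_mono order_trans zero_le)
    then have "ennreal (measure lebesgue E) \<le> ennreal (\<theta> * (measure lebesgue E + e))"
      using lm \<theta> e by (simp add: emeasure_eq_measure2 ennreal_mult)
    then have "measure lebesgue E \<le> \<theta> * (measure lebesgue E + e)"
      using \<theta> e by (subst (asm) ennreal_le_iff) auto
    also have "\<dots> \<le> \<theta> * measure lebesgue E + e"
      using \<theta> e by (simp add: algebra_simps)
    finally show ?thesis .
  qed
  then have "measure lebesgue E \<le> \<theta> * measure lebesgue E" by (rule field_le_epsilon)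
  then have "measure lebesgue E = 0"
    using \<theta> by (smt (verit) measure_nonneg mult_less_cancel_right2 mult_le_cancel_right1
        zero_less_measure_iff)
  then show ?thesis using lm by (simp add: emeasure_eq_measure2)
qed

section \<open>Banach function norms and the Lorentz-Luxemburg theorem\<close>

lemma sets_cball_lebesgue [measurable]: "cball (a::real^'n) r \<in> sets lebesgue"
  by simp

lemma emeasure_cball_finite: "emeasure lebesgue (cball (a::real^'n) r) < \<infinity>"
  using emeasure_bounded_finite[of "cball a r"] by simp

lemma integrable_indicator_cball: "integrable lebesgue (indicator (cball a r) :: real^'n \<Rightarrow> real)"
  by (intro integrable_real_indicator emeasure_cball_finite) auto

lemma bounded_supp_integrable:
  fixes q :: "real^'n \<Rightarrow> real"
  assumes [measurable]: "q \<in> borel_measurable lebesgue" and q: "\<And>x. \<bar>q x\<bar> \<le> M * indicator (cball 0 R) x"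
  shows "integrable lebesgue q"
proof (rule Bochner_Integration.integrable_bound[of _ "\<lambda>x. M * indicator (cball 0 R) x :: real"])
  show "integrable lebesgue (\<lambda>x::real^'n. M * indicator (cball 0 R) x :: real)"
    using integrable_indicator_cball by (intro integrable_mult_right)
  show "AE x in lebesgue. norm (q x) \<le> norm (M * indicator (cball 0 R) x :: real)"
    using q by (intro AE_I2) (metis abs_ge_self order_trans real_norm_def)
qed fact

context
  fixes \<rho> :: "(real^'n \<Rightarrow> ennreal) \<Rightarrow> ennreal"
  assumes bfn: "banach_function_norm \<rho>"
begin

section \<open>The axioms of a Banach function norm and their direct consequences\<close>

lemma bfn_zero_iff: "f \<in> borel_measurable lebesgue \<Longrightarrow> \<rho> f = 0 \<longleftrightarrow> (AE x in lebesgue. f x = 0)"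
  using bfn unfolding banach_function_norm_def by blast

lemma bfn_scale: "f \<in> borel_measurable lebesgue \<Longrightarrow> a \<ge> 0 \<Longrightarrow> \<rho> (\<lambda>x. ennreal a * f x) = ennreal a * \<rho> f"
  using bfn unfolding banach_function_norm_def by blast

lemma bfn_add: "f \<in> borel_measurable lebesgue \<Longrightarrow> g \<in> borel_measurable lebesgue \<Longrightarrow>
    \<rho> (\<lambda>x. f x + g x) \<le> \<rho> f + \<rho> g"
  using bfn unfolding banach_function_norm_def by blast

lemma bfn_mono: "f \<in> borel_measurable lebesgue \<Longrightarrow> g \<in> borel_measurable lebesgue \<Longrightarrow>
    AE x in lebesgue. g x \<le> f x \<Longrightarrow> \<rho> g \<le> \<rho> f"
  using bfn unfolding banach_function_norm_def by blast

lemma bfn_cong_AE: "f \<in> borel_measurable lebesgue \<Longrightarrow> g \<in> borel_measurable lebesgue \<Longrightarrow>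
    AE x in lebesgue. g x = f x \<Longrightarrow> \<rho> g = \<rho> f"
  by (intro antisym bfn_mono) (auto elim: eventually_mono)

lemma bfn_incseq:
  assumes "\<And>k::nat. F k \<in> borel_measurable lebesgue" "f \<in> borel_measurable lebesgue"
    and "AE x in lebesgue. incseq (\<lambda>k. F k x) \<and> (\<lambda>k. F k x) \<longlonglongrightarrow> f x"
  shows "(\<lambda>k. \<rho> (F k)) \<longlonglongrightarrow> \<rho> f"
  using bfn assms unfolding banach_function_norm_def by blast

lemma bfn_indicator_finite: "E \<in> sets lebesgue \<Longrightarrow> emeasure lebesgue E < \<infinity> \<Longrightarrow> \<rho> (indicator E) < \<infinity>"
  using bfn unfolding banach_function_norm_def by blast

lemma bfn_zero: "\<rho> (\<lambda>x. 0) = 0"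
  by (subst bfn_zero_iff) auto

text \<open>The Fatou property: the infima over tails increase to the lower limit, and each is
  dominated by one member of the sequence.\<close>

lemma bfn_liminf_le:
  fixes u :: "nat \<Rightarrow> real^'n \<Rightarrow> ennreal"
  assumes [measurable]: "\<And>n. u n \<in> borel_measurable lebesgue" and le: "\<And>n. \<rho> (u n) \<le> c"
  shows "\<rho> (\<lambda>x. liminf (\<lambda>n. u n x)) \<le> c"
proof -
  define v where "v k x = (INF n\<in>{k..}. u n x)" for k x
  have vm[measurable]: "v k \<in> borel_measurable lebesgue" for k
    unfolding v_def by measurable
  have inc: "incseq (\<lambda>k. v k x)" for x
    unfolding v_def by (intro incseq_SucI INF_superset_mono) auto
  then have lim: "(\<lambda>k. v k x) \<longlonglongrightarrow> liminf (\<lambda>n. u n x)" for x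
    using LIMSEQ_SUP[OF inc[of x]] by (simp add: liminf_SUP_INF v_def)
  have "(\<lambda>k. \<rho> (v k)) \<longlonglongrightarrow> \<rho> (\<lambda>x. liminf (\<lambda>n. u n x))"
    using inc lim by (intro bfn_incseq) auto
  moreover have "\<rho> (v k) \<le> c" for k
  proof -
    have "\<rho> (v k) \<le> \<rho> (u k)" by (intro bfn_mono) (auto simp: v_def intro: INF_lower)
    with le[of k] show ?thesis by simp
  qed
  ultimately show ?thesis by (intro LIMSEQ_le_const2) auto
qed

text \<open>The monotone convergence axiom carries finite subadditivity to the limit of the partial
  sums. It serves the Rubio de Francia series and, at the end, the a.e. convergence of fast
  converging approximations.\<close>

lemma bfn_suminf_le:
  fixes u :: "nat \<Rightarrow> real^'n \<Rightarrow> ennreal"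
  assumes [measurable]: "\<And>n. u n \<in> borel_measurable lebesgue"
  shows "\<rho> (\<lambda>x. \<Sum>n. u n x) \<le> (\<Sum>n. \<rho> (u n))"
proof -
  have fin: "\<rho> (\<lambda>x. \<Sum>n<k. u n x) \<le> (\<Sum>n<k. \<rho> (u n))" for k
  proof (induction k)
    case (Suc k)
    have "\<rho> (\<lambda>x. (\<Sum>n<k. u n x) + u k x) \<le> \<rho> (\<lambda>x. \<Sum>n<k. u n x) + \<rho> (u k)"
      by (intro bfn_add) auto
    also have "\<dots> \<le> (\<Sum>n<k. \<rho> (u n)) + \<rho> (u k)" using Suc by (intro add_right_mono)
    finally show ?case by simp
  qed (simp add: bfn_zero)
  have "(\<lambda>k. \<rho> (\<lambda>x. \<Sum>n<k. u n x)) \<longlonglongrightarrow> \<rho> (\<lambda>x. \<Sum>n. u n x)"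
    by (intro bfn_incseq AE_I2 conjI) (auto intro!: incseq_SucI summable_LIMSEQ)
  moreover have "\<rho> (\<lambda>x. \<Sum>n<k. u n x) \<le> (\<Sum>n. \<rho> (u n))" for k
    using fin[of k] sum_le_suminf[of "\<lambda>n. \<rho> (u n)" "{..<k}"] by auto
  ultimately show ?thesis by (intro LIMSEQ_le_const2) auto
qed

text \<open>Every multiple \<open>n\<close> of the indicator of the set where \<open>f\<close> is
  infinite lies below \<open>f\<close>; as \<open>n\<close> grows, finiteness of
  \<open>\<rho> f\<close> forces that indicator to have norm 0.\<close>

lemma bfn_AE_finite:
  assumes [measurable]: "f \<in> borel_measurable lebesgue" and fin: "\<rho> f < \<infinity>"
  shows "AE x in lebesgue. f x < \<infinity>"
proof -
  define E where "E = {x. f x = \<infinity>}"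
  have [measurable]: "E \<in> sets lebesgue"
  proof -
    have "{x \<in> space lebesgue. f x = \<infinity>} \<in> sets lebesgue" by measurable
    then show ?thesis by (simp add: E_def)
  qed
  have "ennreal (real n) * \<rho> (indicator E) \<le> \<rho> f" for n
  proof -
    have "ennreal (real n) * \<rho> (indicator E) = \<rho> (\<lambda>x. ennreal (real n) * indicator E x)"
      by (intro bfn_scale[symmetric]) auto
    also have "\<dots> \<le> \<rho> f" by (intro bfn_mono) (auto simp: E_def split: split_indicator)
    finally show ?thesis .
  qed
  then have le: "of_nat n * \<rho> (indicator E) \<le> \<rho> f" for n by (simp add: ennreal_of_nat_eq_real_of_nat)
  have "\<rho> (indicator E) = 0"
  proof (rule ccontr)
    assume ne: "\<rho> (indicator E) \<noteq> 0"
    have "(SUP n. of_nat n) * \<rho> (indicator E) \<le> \<rho> f"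
      unfolding SUP_mult_right_ennreal using le by (intro SUP_least)
    then show False using ne fin by (simp add: ennreal_SUP_of_nat_eq_top ennreal_top_mult)
  qed
  then have "AE x in lebesgue. indicator E x = (0::ennreal)" by (subst (asm) bfn_zero_iff) auto
  then show ?thesis by eventually_elim (auto simp: E_def less_top split: split_indicator_asm)
qed

text \<open>Normalise \<open>u\<close> to norm 1 and use the definition of the associate norm. If
  the norm of \<open>u\<close> is 0, then \<open>u\<close> vanishes a.e. and both sides are
  0.\<close>

lemma associate_holder:
  assumes [measurable]: "u \<in> borel_measurable lebesgue" "v \<in> borel_measurable lebesgue" and fin: "\<rho> u < \<infinity>"
  shows "(\<integral>\<^sup>+x. u x * v x \<partial>lebesgue) \<le> \<rho> u * associate_norm \<rho> v"
proof (cases "\<rho> u = 0")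
  case True
  then have "AE x in lebesgue. u x = 0" by (simp add: bfn_zero_iff)
  then have "(\<integral>\<^sup>+x. u x * v x \<partial>lebesgue) = (\<integral>\<^sup>+x. 0 \<partial>(lebesgue :: (real^'n) measure))"
    by (intro nn_integral_cong_AE) (auto elim: eventually_mono)
  then show ?thesis by simp
next
  case False
  then obtain r where r: "\<rho> u = ennreal r" "r > 0"
    using fin by (cases "\<rho> u") (auto simp: ennreal_eq_0_iff not_le)
  have "\<rho> (\<lambda>x. ennreal (1 / r) * u x) = ennreal (1 / r) * ennreal r"
    using r by (subst bfn_scale) auto
  also have "\<dots> = 1" using r by (simp add: ennreal_mult[symmetric])
  finally have "(\<integral>\<^sup>+x. (ennreal (1 / r) * u x) * v x \<partial>lebesgue) \<le> associate_norm \<rho> v"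
    unfolding associate_norm_def by (intro SUP_upper) auto
  then have "ennreal r * (\<integral>\<^sup>+x. (ennreal (1 / r) * u x) * v x \<partial>lebesgue) \<le> ennreal r * associate_norm \<rho> v"
    by (intro mult_left_mono) auto
  also have "ennreal r * (\<integral>\<^sup>+x. (ennreal (1 / r) * u x) * v x \<partial>lebesgue)
      = (\<integral>\<^sup>+x. ennreal r * ((ennreal (1 / r) * u x) * v x) \<partial>lebesgue)"
    by (intro nn_integral_cmult[symmetric]) auto
  also have "\<dots> = (\<integral>\<^sup>+x. u x * v x \<partial>lebesgue)"
    using r by (simp add: mult.assoc[symmetric] ennreal_mult[symmetric])
  finally show ?thesis using r by simp
qed

text \<open>\<open>G\<close> is \<open>H\<close> minus its \<open>L\<^sup>2\<close> projection onto the convex set \<open>V\<close> of admissible functions. A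
  minimising sequence can be chosen so close to the infimum that, by the parallelogram law, it
  converges almost everywhere.\<close>

lemma separating_function:
  fixes H :: "real^'n \<Rightarrow> real"
  assumes Hm[measurable]: "H \<in> borel_measurable lebesgue"
    and H: "\<And>x. 0 \<le> H x" "\<And>x. H x \<le> k * indicator (cball 0 R) x" and big: "\<not> \<rho> (\<lambda>x. ennreal (H x)) \<le> 1"
  obtains G c where "G \<in> borel_measurable lebesgue" "\<And>x. 0 \<le> G x" "\<And>x. G x \<le> H x" "0 \<le> c"
    and "c < (LINT x|lebesgue. G x * H x)"
    and "\<forall>u\<in>borel_measurable lebesgue. \<forall>N. (\<forall>x. 0 \<le> u x \<and> u x \<le> N * indicator (cball 0 R) x) \<longrightarrow>
      \<rho> (\<lambda>x. ennreal (u x)) \<le> 1 \<longrightarrow> (LINT x|lebesgue. G x * u x) \<le> c"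
proof -
  let ?B = "cball 0 R :: (real^'n) set"
  define V where "V N = {u \<in> borel_measurable lebesgue. (\<forall>x. 0 \<le> u x) \<and>
      (\<forall>x. u x \<le> N * indicator ?B x) \<and> \<rho> (\<lambda>x. ennreal (u x)) \<le> 1}" for N
  define J where "J u = (LINT x|lebesgue. (H x - u x)\<^sup>2)" for u
  have k0: "k * indicator ?B x \<ge> 0" for x using H order_trans by blast
  have int2: "integrable lebesgue (\<lambda>x. (p x - u x) * (r x - s x))"
    if "p \<in> borel_measurable lebesgue" "u \<in> borel_measurable lebesgue"
      "r \<in> borel_measurable lebesgue" "s \<in> borel_measurable lebesgue"
      "\<And>x. \<bar>p x - u x\<bar> \<le> M * indicator ?B x" "\<And>x. \<bar>r x - s x\<bar> \<le> M' * indicator ?B x"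
    for p u r s :: "real^'n \<Rightarrow> real" and M M'
  proof (rule bounded_supp_integrable[of _ "M * M'" R])
    show "\<bar>(p x - u x) * (r x - s x)\<bar> \<le> M * M' * indicator ?B x" for x
      using mult_mono[OF that(5,6), of x x] that(5)[of x] order_trans[OF abs_ge_zero that(5)[of x]]
      by (auto simp: abs_mult split: split_indicator_asm split_indicator)
  qed (use that in measurable)
  have convex: "(\<lambda>x. (1 - t) * u x + t * w x) \<in> V (max N N')"
    if u: "u \<in> V N" and w: "w \<in> V N'" and t: "0 \<le> t" "t \<le> 1" for u w t N N'
  proof -
    have [measurable]: "u \<in> borel_measurable lebesgue" "w \<in> borel_measurable lebesgue"
      using u w by (auto simp: V_def)
    have "\<rho> (\<lambda>x. ennreal ((1 - t) * u x + t * w x)) =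
        \<rho> (\<lambda>x. ennreal (1 - t) * ennreal (u x) + ennreal t * ennreal (w x))"
      using u w t by (simp add: V_def ennreal_plus ennreal_mult)
    also have "\<dots> \<le> \<rho> (\<lambda>x. ennreal (1 - t) * ennreal (u x)) + \<rho> (\<lambda>x. ennreal t * ennreal (w x))"
      by (intro bfn_add) auto
    also have "\<dots> = ennreal (1 - t) * \<rho> (\<lambda>x. ennreal (u x)) + ennreal t * \<rho> (\<lambda>x. ennreal (w x))"
      using t by (simp add: bfn_scale)
    also have "\<dots> \<le> ennreal (1 - t) * 1 + ennreal t * 1"
      using u w by (intro add_mono mult_left_mono) (auto simp: V_def)
    also have "\<dots> = 1" using t by (simp add: ennreal_plus[symmetric] del: ennreal_plus)
    finally have 1: "\<rho> (\<lambda>x. ennreal ((1 - t) * u x + t * w x)) \<le> 1" .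
    have "(1 - t) * u x + t * w x \<le> max N N' * indicator ?B x" for x
    proof -
      have "u x \<le> max N N' * indicator ?B x" "w x \<le> max N N' * indicator ?B x"
        using u w by (auto simp: V_def split: split_indicator_asm split_indicator) (smt (verit))+
      then have "(1 - t) * u x + t * w x
          \<le> (1 - t) * (max N N' * indicator ?B x) + t * (max N N' * indicator ?B x)"
        using t by (intro add_mono mult_left_mono) auto
      then show ?thesis by (simp add: algebra_simps)
    qed
    moreover have "0 \<le> (1 - t) * u x + t * w x" for x using u w t by (auto simp: V_def)
    ultimately show ?thesis using 1 by (simp add: V_def)
  qed
  have Vdiff: "\<bar>u x - w x\<bar> \<le> max N N' * indicator ?B x" if "u \<in> V N" "w \<in> V N'" for u w N N' x
    using that by (auto simp: V_def abs_le_iff split: split_indicator_asm split_indicator) (smt (verit))+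
  have Hdiff: "\<bar>H x - w x\<bar> \<le> max k N' * indicator ?B x" if "w \<in> V N'" for w N' x
    using that H[of x] by (auto simp: V_def abs_le_iff split: split_indicator_asm split_indicator)
        (smt (verit))+
  have Vm: "u \<in> borel_measurable lebesgue" if "u \<in> V N" for u N using that by (simp add: V_def)
  have Jint: "integrable lebesgue (\<lambda>x. (H x - u x)\<^sup>2)" if "u \<in> V N" for u N
    unfolding power2_eq_square
    by (rule int2[OF Hm Vm[OF that] Hm Vm[OF that] Hdiff[OF that] Hdiff[OF that]])
  have J0: "J u \<ge> 0" for u unfolding J_def by (intro integral_nonneg_AE) auto
  \<comment> \<open>Competitors are restricted to functions below \<open>H\<close>, which gives the
    bound \<open>k\<close> and later \<open>G \<ge> 0\<close>. Cutting any admissible function at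
    \<open>H\<close> keeps it admissible and does not increase its distance from \<open>H\<close>,
    so \<open>d\<close> is a lower bound over every \<open>V N\<close>.\<close>
  define U where "U = V k \<inter> {u. \<forall>x. u x \<le> H x}"
  have zero: "(\<lambda>x. 0) \<in> U" using H k0 by (auto simp: U_def V_def bfn_zero)
  define d where "d = Inf (J ` U)"
  have bdd: "bdd_below (J ` U)" using J0 by (auto intro!: bdd_belowI2[of _ 0])
  have dU: "d \<le> J u" if "u \<in> U" for u
    unfolding d_def using that bdd by (intro cInf_lower) auto
  have dV: "d \<le> J u" if u: "u \<in> V N" for u N
  proof -
    have [measurable]: "u \<in> borel_measurable lebesgue" using u by (rule Vm)
    have "\<rho> (\<lambda>x. ennreal (min (u x) (H x))) \<le> \<rho> (\<lambda>x. ennreal (u x))"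
      by (intro bfn_mono) (auto intro!: ennreal_leI)
    also have "\<dots> \<le> 1" using u by (simp add: V_def)
    finally have *: "(\<lambda>x. min (u x) (H x)) \<in> U"
      using u H by (auto simp: U_def V_def min_le_iff_disj)
    then have "d \<le> J (\<lambda>x. min (u x) (H x))" by (rule dU)
    also have "\<dots> \<le> J u" unfolding J_def
    proof (rule integral_mono[OF Jint Jint[OF u]])
      show "(\<lambda>x. min (u x) (H x)) \<in> V k" using * by (simp add: U_def)
      show "(H x - min (u x) (H x))\<^sup>2 \<le> (H x - u x)\<^sup>2" for x by (auto simp: min_def)
    qed
    finally show ?thesis .
  qed
  \<comment> \<open>With this rate successive terms have squared distance at most
    \<open>4 * (1 / 16) ^ n\<close>, enough for their integrated differences to be summable.\<close>
  have "\<exists>u\<in>U. J u < d + (1 / 16) ^ n" for n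
  proof -
    have "Inf (J ` U) < d + (1 / 16) ^ n" by (simp add: d_def)
    then show ?thesis using zero by (subst (asm) cInf_less_iff[OF _ bdd]) auto
  qed
  then obtain u where u: "\<And>n. u n \<in> U" "\<And>n. J (u n) < d + (1 / 16) ^ n" by metis
  have uV: "u n \<in> V k" for n using u by (simp add: U_def)
  have um[measurable]: "u n \<in> borel_measurable lebesgue" for n by (rule Vm[OF uV])
  have close: "(LINT x|lebesgue. (u n x - u (Suc n) x)\<^sup>2) \<le> 4 * (1 / 16) ^ n" for n
  proof -
    define m where "m x = (1 - 1/2) * u n x + 1/2 * u (Suc n) x" for x
    have mV: "m \<in> V (max k k)" unfolding m_def by (rule convex[OF uV uV]) auto
    have "(LINT x|lebesgue. (u n x - u (Suc n) x)\<^sup>2)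
        = (LINT x|lebesgue. (2 * (H x - u n x)\<^sup>2 + 2 * (H x - u (Suc n) x)\<^sup>2) - 4 * (H x - m x)\<^sup>2)"
      by (intro Bochner_Integration.integral_cong) (auto simp: m_def power2_eq_square algebra_simps)
    also have "\<dots> = (2 * J (u n) + 2 * J (u (Suc n))) - 4 * J m"
      unfolding J_def using Jint[OF uV] Jint[OF mV] by simp
    also have "\<dots> \<le> 2 * (d + (1 / 16) ^ n) + 2 * (d + (1 / 16) ^ Suc n) - 4 * d"
      using u(2)[of n] u(2)[of "Suc n"] dV[OF mV] by simp
    also have "\<dots> \<le> 4 * (1 / 16) ^ n" by simp
    finally show ?thesis .
  qed
  have "AE x in lebesgue. (\<Sum>n. ennreal \<bar>u n x - u (Suc n) x\<bar>) < \<infinity>"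
  proof -
    have l1: "(\<integral>\<^sup>+x. ennreal \<bar>u n x - u (Suc n) x\<bar> \<partial>lebesgue)
        \<le> ennreal (4 * (1/2) ^ n + (1/2) ^ n * measure lebesgue ?B)" for n
    proof -
      have int: "integrable lebesgue (\<lambda>x. \<bar>u n x - u (Suc n) x\<bar>)"
        by (rule bounded_supp_integrable[of _ "max k k" R]) (use Vdiff[OF uV uV] in auto)
      have sq: "integrable lebesgue (\<lambda>x. (u n x - u (Suc n) x)\<^sup>2)"
        unfolding power2_eq_square
        by (rule int2[OF um um um um Vdiff[OF uV uV] Vdiff[OF uV uV]])
      have "(LINT x|lebesgue. \<bar>u n x - u (Suc n) x\<bar>) \<le>
         (LINT x|lebesgue. 2 ^ n * (u n x - u (Suc n) x)\<^sup>2 + (1/2) ^ n * indicator ?B x)"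
      proof (rule integral_mono[OF int])
        show "integrable lebesgue (\<lambda>x. 2 ^ n * (u n x - u (Suc n) x)\<^sup>2 + (1/2) ^ n * indicator ?B x)"
          using sq by (intro Bochner_Integration.integrable_add integrable_mult_right
              integrable_indicator_cball)
        fix x
        \<comment> \<open>Squares control first powers through
          \<open>t \<le> 2 ^ n * t\<^sup>2 + (1/2) ^ n\<close>, which is
          \<open>s \<le> s\<^sup>2 + 1\<close> for \<open>s = 2 ^ n * t\<close>. Off the ball
          \<open>t\<close> vanishes, so the last term may carry the indicator.\<close>
        define t where "t = \<bar>u n x - u (Suc n) x\<bar>"
        have "0 \<le> (2 ^ n * t - 1/2)\<^sup>2 + 3/4" by simp
        then have "2 ^ n * t \<le> 2 ^ n * (2 ^ n * t\<^sup>2) + 1" by (simp add: power2_eq_square algebra_simps)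
        then have "2 ^ n * t \<le> 2 ^ n * (2 ^ n * t\<^sup>2 + (1/2)^n)" by (simp add: algebra_simps power_one_over)
        then have le: "t \<le> 2 ^ n * t\<^sup>2 + (1/2)^n" by simp
        show "\<bar>u n x - u (Suc n) x\<bar> \<le> 2 ^ n * (u n x - u (Suc n) x)\<^sup>2 + (1/2) ^ n * indicator ?B x"
          using le Vdiff[OF uV uV, of n x "Suc n"] unfolding t_def
          by (auto split: split_indicator split_indicator_asm)
      qed
      also have "\<dots> = 2 ^ n * (LINT x|lebesgue. (u n x - u (Suc n) x)\<^sup>2) + (1/2) ^ n * measure lebesgue ?B"
        using sq integrable_indicator_cball[of "0::real^'n" R] by simp
      also have "\<dots> \<le> 2 ^ n * (4 * (1 / 16) ^ n) + (1/2) ^ n * measure lebesgue ?B"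
        using close[of n] by (intro add_right_mono mult_left_mono) auto
      also have "(2::real) ^ n * (4 * (1 / 16) ^ n) = 4 * (1/8) ^ n"
        by (simp add: power_mult_distrib[symmetric] del: power_one_over)
      also have "(1/8) ^ n \<le> (1/2::real) ^ n" by (intro power_mono) auto
      finally have "(LINT x|lebesgue. \<bar>u n x - u (Suc n) x\<bar>)
          \<le> 4 * (1/2) ^ n + (1/2) ^ n * measure lebesgue ?B" by simp
      then show ?thesis using int by (subst nn_integral_eq_integral)
          (auto intro!: ennreal_leI simp del: ennreal_plus)
    qed
    have "(\<integral>\<^sup>+x. (\<Sum>n. ennreal \<bar>u n x - u (Suc n) x\<bar>) \<partial>lebesgue)
        = (\<Sum>n. \<integral>\<^sup>+x. ennreal \<bar>u n x - u (Suc n) x\<bar> \<partial>lebesgue)"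
      by (intro nn_integral_suminf) auto
    also have "\<dots> \<le> (\<Sum>n. ennreal (4 * (1/2) ^ n + (1/2) ^ n * measure lebesgue ?B))"
      by (intro suminf_le l1) auto
    also have "\<dots> = ennreal (\<Sum>n. 4 * (1/2) ^ n + (1/2) ^ n * measure lebesgue ?B)"
      by (intro suminf_ennreal2) (auto intro!: summable_add summable_mult summable_mult2 summable_geometric)
    finally have "(\<integral>\<^sup>+x. (\<Sum>n. ennreal \<bar>u n x - u (Suc n) x\<bar>) \<partial>lebesgue) \<noteq> \<infinity>" by (auto simp: top_unique)
    then have "AE x in lebesgue. (\<Sum>n. ennreal \<bar>u n x - u (Suc n) x\<bar>) \<noteq> \<infinity>"
      by (intro nn_integral_noteq_infinite) auto
    then show ?thesis by (simp add: less_top)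
  qed
  \<comment> \<open>Taking the lower limit gives a function defined everywhere, measurable, below
    \<open>H\<close>, and of norm at most 1 by the Fatou property; almost everywhere it is the
    limit.\<close>
  define u0 where "u0 x = enn2real (liminf (\<lambda>n. ennreal (u n x)))" for x
  have lim: "AE x in lebesgue. (\<lambda>n. u n x) \<longlonglongrightarrow> u0 x"
    using \<open>AE x in lebesgue. (\<Sum>n. ennreal \<bar>u n x - u (Suc n) x\<bar>) < \<infinity>\<close>
  proof eventually_elim
    case (elim x)
    then have "summable (\<lambda>n. \<bar>u n x - u (Suc n) x\<bar>)"
      by (intro summable_suminf_not_top) auto
    then have "summable (\<lambda>n. u n x - u (Suc n) x)" by (rule summable_rabs_cancel)
    then have "(\<lambda>n. u 0 x - (\<Sum>i<n. u i x - u (Suc i) x)) \<longlonglongrightarrow> u 0 x - (\<Sum>n. u n x - u (Suc n) x)"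
      by (intro tendsto_intros summable_LIMSEQ)
    moreover have "u 0 x - (\<Sum>i<n. u i x - u (Suc i) x) = u n x" for n
      by (induction n) auto
    ultimately obtain L where L: "(\<lambda>n. u n x) \<longlonglongrightarrow> L" by auto
    then have "(\<lambda>n. ennreal (u n x)) \<longlonglongrightarrow> ennreal L" by (rule tendsto_ennrealI)
    then have "liminf (\<lambda>n. ennreal (u n x)) = ennreal L" by (intro lim_imp_Liminf) auto
    moreover have "L \<ge> 0" using L uV by (intro LIMSEQ_le_const[OF L]) (auto simp: V_def)
    ultimately show ?case using L by (simp add: u0_def)
  qed
  have liH: "liminf (\<lambda>n. ennreal (u n x)) \<le> ennreal (H x)" for x
    using u(1) by (intro Liminf_le always_eventually) (auto simp: U_def intro!: ennreal_leI)
  have u0H: "0 \<le> u0 x" "u0 x \<le> H x" for x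
    using liH[of x] H(1)[of x] by (auto simp: u0_def intro: enn2real_leI)
  have u0m[measurable]: "u0 \<in> borel_measurable lebesgue" unfolding u0_def by measurable
  have "\<rho> (\<lambda>x. ennreal (u0 x)) = \<rho> (\<lambda>x. liminf (\<lambda>n. ennreal (u n x)))"
    unfolding u0_def by (intro arg_cong[where f=\<rho>] ext ennreal_enn2real)
        (rule order_le_less_trans[OF liH ennreal_less_top])
  also have "\<dots> \<le> 1" by (intro bfn_liminf_le) (use uV in \<open>auto simp: V_def\<close>)
  finally have \<rho>u0: "\<rho> (\<lambda>x. ennreal (u0 x)) \<le> 1" .
  then have u0V: "u0 \<in> V k" using u0H H(2) by (auto simp: V_def intro: order_trans)
  have "(\<lambda>n. J (u n)) \<longlonglongrightarrow> J u0"
    unfolding J_def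
  proof (rule integral_dominated_convergence[where w="\<lambda>x. k\<^sup>2 * indicator ?B x"])
    show "AE x in lebesgue. (\<lambda>n. (H x - u n x)\<^sup>2) \<longlonglongrightarrow> (H x - u0 x)\<^sup>2"
      using lim by eventually_elim (intro tendsto_intros)
    show "integrable lebesgue (\<lambda>x. k\<^sup>2 * indicator ?B x :: real)"
      by (rule bounded_supp_integrable[of _ "k\<^sup>2" R]) auto
    show "AE x in lebesgue. norm ((H x - u n x)\<^sup>2) \<le> k\<^sup>2 * indicator ?B x" for n
    proof (rule AE_I2)
      fix x show "norm ((H x - u n x)\<^sup>2) \<le> k\<^sup>2 * indicator ?B x"
        using Hdiff[OF uV, of x n] by
            (auto split: split_indicator split_indicator_asm intro: abs_le_square_iff[THEN iffD1])
    qed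
  qed auto
  moreover have "(\<lambda>n. d + (1 / 16) ^ n) \<longlonglongrightarrow> d + 0"
    by (intro tendsto_intros LIMSEQ_power_zero) auto
  ultimately have "J u0 \<le> d + 0"
    by (rule LIMSEQ_le) (use u(2) in \<open>auto intro: less_imp_le\<close>)
  then have min: "J u0 \<le> J w" if "w \<in> V N" for w N using dV[OF that] by simp
  define G where "G x = H x - u0 x" for x
  have [measurable]: "G \<in> borel_measurable lebesgue" unfolding G_def by measurable
  \<comment> \<open>The variational inequality of the projection: on the segment from
    \<open>u0\<close> to \<open>w\<close> the squared distance to \<open>H\<close> cannot decrease.
    Dividing by \<open>t\<close> and letting \<open>t\<close> tend to 0 leaves the first-order
    term.\<close>
  have var: "(LINT x|lebesgue. G x * (w x - u0 x)) \<le> 0" if w: "w \<in> V N" for w N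
  proof -
    have [measurable]: "w \<in> borel_measurable lebesgue" using w by (rule Vm)
    define a where "a = (LINT x|lebesgue. G x * (w x - u0 x))"
    define b where "b = (LINT x|lebesgue. (w x - u0 x)\<^sup>2)"
    have i1: "integrable lebesgue (\<lambda>x. G x * (w x - u0 x))"
      unfolding G_def by (rule int2[OF Hm u0m Vm[OF w] u0m Hdiff[OF u0V] Vdiff[OF w u0V]])
    have i2: "integrable lebesgue (\<lambda>x. (w x - u0 x)\<^sup>2)"
      unfolding power2_eq_square
      by (rule int2[OF Vm[OF w] u0m Vm[OF w] u0m Vdiff[OF w u0V] Vdiff[OF w u0V]])
    have le: "2 * a \<le> t * b" if t: "0 < t" "t \<le> 1" for t
    proof -
      have "J u0 \<le> J (\<lambda>x. (1 - t) * u0 x + t * w x)"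
        using t by (intro min[OF convex[OF u0V w]]) auto
      also have "\<dots> = (LINT x|lebesgue. (H x - u0 x)\<^sup>2 - 2 * t * (G x * (w x - u0 x)) + t\<^sup>2 *
          (w x - u0 x)\<^sup>2)"
        unfolding J_def G_def by (intro Bochner_Integration.integral_cong)
            (auto simp: power2_eq_square algebra_simps)
      also have "\<dots> = J u0 - 2 * t * a + t\<^sup>2 * b"
        unfolding J_def a_def b_def using Jint[OF u0V] i1 i2 by simp
      finally have "t * (2 * a) \<le> t * (t * b)" by (simp add: power2_eq_square algebra_simps)
      then show ?thesis using t by simp
    qed
    have "((\<lambda>t. t * b) \<longlongrightarrow> 0 * b) (at_right 0)" by (intro tendsto_intros)
    moreover have "\<forall>\<^sub>F t::real in at_right 0. 2 * a \<le> t * b"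
      using le by (auto simp: eventually_at_right_field intro!: exI[of _ 1])
    ultimately have "2 * a \<le> 0 * b"
      by (intro tendsto_lowerbound[of "\<lambda>t. t * b"]) auto
    then show ?thesis by (simp add: a_def)
  qed
  \<comment> \<open>The functional given by \<open>G\<close> has its largest admissible value at the
    projection. At \<open>H\<close> it is larger by the integral of \<open>(G x)\<^sup>2\<close>,
    which is positive, since otherwise \<open>H\<close> would equal \<open>u0\<close> a.e. and have
    norm at most 1.\<close>
  define c where "c = (LINT x|lebesgue. G x * u0 x)"
  have iG: "integrable lebesgue (\<lambda>x. G x * w x)" if "w \<in> V N" for w N
  proof -
    have z: "(\<lambda>x. 0) \<in> V 0" by (simp add: V_def bfn_zero)
    show ?thesis
      using int2[OF Hm u0m Vm[OF that] Vm[OF z] Hdiff[OF u0V] Vdiff[OF that z]] by (simp add: G_def)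
  qed
  have iGG: "integrable lebesgue (\<lambda>x. (G x)\<^sup>2)"
    unfolding G_def by (rule Jint[OF u0V])
  have pos: "(LINT x|lebesgue. (G x)\<^sup>2) > 0"
  proof (rule ccontr)
    assume "\<not> ?thesis"
    moreover have "(LINT x|lebesgue. (G x)\<^sup>2) \<ge> 0" by simp
    ultimately have "AE x in lebesgue. (G x)\<^sup>2 = 0"
      using integral_nonneg_eq_0_iff_AE[OF iGG] by auto
    then have "AE x in lebesgue. ennreal (H x) \<le> ennreal (u0 x)"
      by eventually_elim (auto simp: G_def)
    then have "\<rho> (\<lambda>x. ennreal (H x)) \<le> \<rho> (\<lambda>x. ennreal (u0 x))" by (intro bfn_mono) auto
    with \<rho>u0 big show False by (meson order_trans)
  qed
  show thesis
  proof
    show "0 \<le> G x" "G x \<le> H x" for x using u0H[of x] by (auto simp: G_def)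
    show "0 \<le> c" unfolding c_def using u0H by (intro integral_nonneg_AE AE_I2) (auto simp: G_def)
    have "(LINT x|lebesgue. G x * H x) = (LINT x|lebesgue. (G x)\<^sup>2 + G x * u0 x)"
      by (intro Bochner_Integration.integral_cong) (auto simp: G_def power2_eq_square algebra_simps)
    also have "\<dots> = (LINT x|lebesgue. (G x)\<^sup>2) + c" unfolding c_def using iGG iG[OF u0V] by simp
    finally show "c < (LINT x|lebesgue. G x * H x)" using pos by simp
  next
    show "\<forall>u\<in>borel_measurable lebesgue. \<forall>N. (\<forall>x. 0 \<le> u x \<and> u x \<le> N * indicator ?B x) \<longrightarrow>
      \<rho> (\<lambda>x. ennreal (u x)) \<le> 1 \<longrightarrow> (LINT x|lebesgue. G x * u x) \<le> c"
    proof (intro ballI allI impI)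
      fix w N assume "w \<in> borel_measurable lebesgue" "\<forall>x. 0 \<le> w x \<and> w x \<le> N * indicator ?B x"
        "\<rho> (\<lambda>x. ennreal (w x)) \<le> 1"
      then have w: "w \<in> V N" by (simp add: V_def)
      have "(LINT x|lebesgue. G x * (w x - u0 x)) = (LINT x|lebesgue. G x * w x) - c"
        unfolding c_def right_diff_distrib by (intro Bochner_Integration.integral_diff iG[OF w] iG[OF u0V])
      with var[OF w] show "(LINT x|lebesgue. G x * w x) \<le> c" by simp
    qed
  qed simp
qed

text \<open>The half of \<open>X'' = X\<close> that needs separation. If the norm of
  \<open>h\<close> exceeded 1, so would that of some truncation in height and support, by monotone
  convergence. A functional separating this truncation from the unit ball, suitably scaled, has
  associate norm at most 1 and integrates against \<open>h\<close> to more than 1.\<close>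

lemma lorentz_luxemburg_1:
  assumes [measurable]: "h \<in> borel_measurable lebesgue"
    and le: "\<And>g :: real^'n \<Rightarrow> real. g \<in> borel_measurable lebesgue \<Longrightarrow> (\<And>x. 0 \<le> g x) \<Longrightarrow>
      associate_norm \<rho> (\<lambda>x. ennreal (g x)) \<le> 1 \<Longrightarrow> (\<integral>\<^sup>+x. h x * ennreal (g x) \<partial>lebesgue) \<le> 1"
  shows "\<rho> h \<le> 1"
proof (rule ccontr)
  assume big: "\<not> \<rho> h \<le> 1"
  define F where "F k x = min (h x) (of_nat k) * indicator (cball 0 (real k)) x" for k :: nat and x
  have Fm[measurable]: "F k \<in> borel_measurable lebesgue" for k unfolding F_def by measurable
  have inc: "incseq (\<lambda>k. F k x)" for x
    unfolding F_def by (intro incseq_SucI mult_mono min.mono) (auto split: split_indicator)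
  have F_lim: "(\<lambda>k. F k x) \<longlonglongrightarrow> h x" for x
  proof -
    have "(\<lambda>k. min (h x) (of_nat k)) \<longlonglongrightarrow> min (h x) top"
      by (intro tendsto_min tendsto_const of_nat_tendsto_top_ennreal)
    moreover have "\<forall>\<^sub>F k in sequentially. min (h x) (of_nat k) = F k x"
      using eventually_ge_at_top[of "nat \<lceil>norm x\<rceil>"]
      by eventually_elim (auto simp: F_def split: split_indicator)
    ultimately show ?thesis by (simp add: Lim_transform_eventually)
  qed
  have "(\<lambda>k. \<rho> (F k)) \<longlonglongrightarrow> \<rho> h" by (intro bfn_incseq AE_I2) (auto simp: inc F_lim)
  then obtain k where k: "\<not> \<rho> (F k) \<le> 1"
    using big LIMSEQ_le_const2[of "\<lambda>k. \<rho> (F k)" "\<rho> h" 1] by blast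
  let ?B = "cball 0 (real k) :: (real^'n) set"
  define H where "H x = enn2real (F k x)" for x
  have [measurable]: "H \<in> borel_measurable lebesgue" unfolding H_def by measurable
  have Fk: "F k x \<le> ennreal (real k * indicator ?B x)" for x
    by (auto simp: F_def ennreal_of_nat_eq_real_of_nat split: split_indicator)
  then have HF: "ennreal (H x) = F k x" for x
    unfolding H_def by (intro ennreal_enn2real) (rule order_le_less_trans[OF Fk ennreal_less_top])
  have H: "0 \<le> H x" "H x \<le> real k * indicator ?B x" for x
    using Fk[of x] by (auto simp: H_def intro!: enn2real_leI)
  have "\<not> \<rho> (\<lambda>x. ennreal (H x)) \<le> 1" using k HF by simp
  note big = this
  have Hm: "H \<in> borel_measurable lebesgue" by measurable
  obtain G c where G[measurable]: "G \<in> borel_measurable lebesgue" and G0: "\<And>x. 0 \<le> G x" "\<And>x. G x \<le> H x"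
    and c: "0 \<le> c" "c < (LINT x|lebesgue. G x * H x)"
    and sep: "\<forall>u\<in>borel_measurable lebesgue. \<forall>N. (\<forall>x. 0 \<le> u x \<and> u x \<le> N * indicator ?B x) \<longrightarrow>
      \<rho> (\<lambda>x. ennreal (u x)) \<le> 1 \<longrightarrow> (LINT x|lebesgue. G x * u x) \<le> c"
    by (rule separating_function[OF Hm H big]) (rule that)
  define d where "d = (LINT x|lebesgue. G x * H x)"
  \<comment> \<open>Any value strictly between \<open>c\<close> and \<open>d\<close> normalises
    \<open>G\<close>. Division by \<open>c\<close> itself is impossible when
    \<open>c = 0\<close>.\<close>
  define e where "e = (c + d) / 2"
  have e: "c < e" "e < d" "e > 0" using c by (auto simp: e_def d_def)
  have GB: "G x \<le> real k * indicator ?B x" for x using G0(2)[of x] H(2)[of x] by simp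
  have intG: "(\<integral>\<^sup>+x. ennreal (G x * u x) \<partial>lebesgue) = ennreal (LINT x|lebesgue. G x * u x)"
    if [measurable]: "u \<in> borel_measurable lebesgue"
        and u: "\<And>x. 0 \<le> u x" "\<And>x. u x \<le> N * indicator ?B x" for u N
  proof (rule nn_integral_eq_integral)
    show "integrable lebesgue (\<lambda>x. G x * u x)"
    proof (rule bounded_supp_integrable[of _ "real k * N" "real k"])
      fix x show "\<bar>G x * u x\<bar> \<le> real k * N * indicator (cball 0 (real k)) x"
        using mult_mono[OF GB[of x] u(2)[of x]] u(1)[of x] G0(1)[of x]
        by (auto simp: abs_mult split: split_indicator_asm split_indicator)
    qed auto
  qed (use u G0 in auto)
  \<comment> \<open>Separation is known only for bounded functions supported in the ball. Since
    \<open>G\<close> vanishes outside the ball, the cut-offs of \<open>f\<close> exhaust the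
    integral and monotone convergence gives the whole unit ball.\<close>
  have G_le: "(\<integral>\<^sup>+x. f x * ennreal (G x) \<partial>lebesgue) \<le> ennreal c"
    if f[measurable]: "f \<in> borel_measurable lebesgue" "\<rho> f \<le> 1" for f
  proof -
    define u where "u n x = min (f x) (of_nat n) * indicator ?B x" for n :: nat and x
    have [measurable]: "u n \<in> borel_measurable lebesgue" for n unfolding u_def by measurable
    have un: "u n x \<le> ennreal (real n * indicator ?B x)" for n x
      by (auto simp: u_def ennreal_of_nat_eq_real_of_nat split: split_indicator)
    then have fin: "ennreal (enn2real (u n x)) = u n x" for n x
      by (intro ennreal_enn2real) (rule order_le_less_trans[OF un ennreal_less_top])
    have ub: "enn2real (u n x) \<le> real n * indicator ?B x" for n x
      using un by (intro enn2real_leI) auto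
    have "\<rho> (\<lambda>x. ennreal (enn2real (u n x))) \<le> \<rho> f" for n
      unfolding fin by (intro bfn_mono) (auto simp: u_def min_le_iff_disj split: split_indicator)
    then have le: "(LINT x|lebesgue. G x * enn2real (u n x)) \<le> c" for n
      using f(2) ub by (intro sep[rule_format, of _ "real n"]) (auto intro: order_trans)
    have lec: "(\<integral>\<^sup>+x. u n x * ennreal (G x) \<partial>lebesgue) \<le> ennreal c" for n
    proof -
      have "(\<integral>\<^sup>+x. u n x * ennreal (G x) \<partial>lebesgue) = (\<integral>\<^sup>+x. ennreal (G x * enn2real (u n x)) \<partial>lebesgue)"
        using G0 fin[of n] by (intro nn_integral_cong) (simp add: ennreal_mult mult.commute)
      also have "\<dots> = ennreal (LINT x|lebesgue. G x * enn2real (u n x))"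
        using ub by (intro intG[of _ "real n"]) auto
      also have "\<dots> \<le> ennreal c" using le by (intro ennreal_leI)
      finally show ?thesis .
    qed
    have lim: "(\<lambda>n. u n x * ennreal (G x)) \<longlonglongrightarrow> f x * ennreal (G x)" for x
    proof (cases "x \<in> ?B")
      case True
      have "(\<lambda>n. min (f x) (of_nat n)) \<longlonglongrightarrow> min (f x) top"
        by (intro tendsto_min tendsto_const of_nat_tendsto_top_ennreal)
      then have "(\<lambda>n. ennreal (G x) * u n x) \<longlonglongrightarrow> ennreal (G x) * f x"
        using True by (intro ennreal_tendsto_cmult) (auto simp: u_def)
      then show ?thesis by (simp add: mult.commute)
    next
      case False
      then have "G x = 0" using GB[of x] G0(1)[of x] by simp
      then show ?thesis by simp
    qed
    have inc: "incseq (\<lambda>n x. u n x * ennreal (G x))"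
      unfolding u_def by (intro incseq_SucI le_funI mult_right_mono min.mono) auto
    have "(\<integral>\<^sup>+x. f x * ennreal (G x) \<partial>lebesgue) = (\<integral>\<^sup>+x. (SUP n. u n x * ennreal (G x)) \<partial>lebesgue)"
    proof (intro nn_integral_cong)
      fix x
      have "incseq (\<lambda>n. u n x * ennreal (G x))" using inc by (auto simp: incseq_def le_fun_def)
      then show "f x * ennreal (G x) = (SUP n. u n x * ennreal (G x))"
        using LIMSEQ_SUP LIMSEQ_unique[OF lim] by blast
    qed
    also have "\<dots> = (SUP n. \<integral>\<^sup>+x. u n x * ennreal (G x) \<partial>lebesgue)"
      using inc by (intro nn_integral_monotone_convergence_SUP) auto
    also have "\<dots> \<le> ennreal c" using lec by (intro SUP_least)
    finally show ?thesis .
  qed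
  define g where "g x = G x / e" for x
  have [measurable]: "g \<in> borel_measurable lebesgue" unfolding g_def by measurable
  have "associate_norm \<rho> (\<lambda>x. ennreal (g x)) \<le> 1"
    unfolding associate_norm_def
  proof (rule SUP_least, clarify)
    fix f :: "real^'n \<Rightarrow> ennreal" assume f[measurable]: "f \<in> borel_measurable lebesgue" "\<rho> f \<le> 1"
    have "(\<integral>\<^sup>+x. f x * ennreal (g x) \<partial>lebesgue) = (\<integral>\<^sup>+x. ennreal (1 / e) * (f x * ennreal (G x)) \<partial>lebesgue)"
      using e G0 by (intro nn_integral_cong) (simp add: g_def ennreal_mult[symmetric] mult.left_commute)
    also have "\<dots> = ennreal (1 / e) * (\<integral>\<^sup>+x. f x * ennreal (G x) \<partial>lebesgue)"
      by (intro nn_integral_cmult) measurable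
    also have "\<dots> \<le> ennreal (1 / e) * ennreal c" using G_le[OF f] by (intro mult_left_mono) auto
    also have "\<dots> \<le> 1" using e c by (simp add: ennreal_mult[symmetric])
    finally show "(\<integral>\<^sup>+x. f x * ennreal (g x) \<partial>lebesgue) \<le> 1" .
  qed
  then have "(\<integral>\<^sup>+x. h x * ennreal (g x) \<partial>lebesgue) \<le> 1"
    using G0 e by (intro le) (auto simp: g_def)
  moreover have "(\<integral>\<^sup>+x. h x * ennreal (g x) \<partial>lebesgue)
      \<ge> (\<integral>\<^sup>+x. ennreal (1 / e) * ennreal (G x * H x) \<partial>lebesgue)"
  proof (rule nn_integral_mono)
    fix x
    have "ennreal (1 / e) * ennreal (G x * H x) = F k x * ennreal (g x)"
      unfolding HF[symmetric] using e G0[of x] H[of x]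
        by (simp add: g_def ennreal_mult[symmetric] mult.commute)
    also have "\<dots> \<le> h x * ennreal (g x)"
      by (intro mult_right_mono) (auto simp: F_def min_le_iff_disj split: split_indicator)
    finally show "ennreal (1 / e) * ennreal (G x * H x) \<le> h x * ennreal (g x)" .
  qed
  moreover have "(\<integral>\<^sup>+x. ennreal (1 / e) * ennreal (G x * H x) \<partial>lebesgue) = ennreal (1 / e) * ennreal d"
    using intG[of H, OF _ H] by (subst nn_integral_cmult) (auto simp: d_def)
  moreover have "ennreal (1 / e) * ennreal d > 1"
  proof -
    have "ennreal 1 < ennreal (d / e)" using e by (intro ennreal_lessI) auto
    then show ?thesis using e by (simp add: ennreal_mult[symmetric])
  qed
  ultimately show False by simp
qed

text \<open>Rescaling of the unit case. Dividing by \<open>K + e\<close> keeps the divisor positive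
  when \<open>K = 0\<close>.\<close>

lemma lorentz_luxemburg:
  assumes [measurable]: "h \<in> borel_measurable lebesgue" and K: "K \<ge> 0"
    and le: "\<And>g :: real^'n \<Rightarrow> real. g \<in> borel_measurable lebesgue \<Longrightarrow> (\<And>x. 0 \<le> g x) \<Longrightarrow>
      associate_norm \<rho> (\<lambda>x. ennreal (g x)) \<le> 1 \<Longrightarrow> (\<integral>\<^sup>+x. h x * ennreal (g x) \<partial>lebesgue) \<le> ennreal K"
  shows "\<rho> h \<le> ennreal K"
proof (rule ennreal_le_epsilon)
  fix e :: real assume e: "e > 0"
  define L where "L = K + e"
  have L: "L > 0" "K \<le> L" using K e by (auto simp: L_def)
  have "\<rho> (\<lambda>x. ennreal (1 / L) * h x) \<le> 1"
  proof (rule lorentz_luxemburg_1)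
    fix g :: "real^'n \<Rightarrow> real"
    assume g[measurable]: "g \<in> borel_measurable lebesgue" "\<And>x. 0
        \<le> g x" "associate_norm \<rho> (\<lambda>x. ennreal (g x)) \<le> 1"
    have "(\<integral>\<^sup>+x. ennreal (1 / L) * h x * ennreal (g x) \<partial>lebesgue)
        = ennreal (1 / L) * (\<integral>\<^sup>+x. h x * ennreal (g x) \<partial>lebesgue)"
      unfolding mult.assoc by (intro nn_integral_cmult) measurable
    also have "\<dots> \<le> ennreal (1 / L) * ennreal K" using le[OF g] by (intro mult_left_mono) auto
    also have "\<dots> \<le> 1" using L K by (simp add: ennreal_mult[symmetric])
    finally show "(\<integral>\<^sup>+x. ennreal (1 / L) * h x * ennreal (g x) \<partial>lebesgue) \<le> 1" .
  qed measurable
  then have "ennreal (1 / L) * \<rho> h \<le> 1" using L by (subst (asm) bfn_scale) auto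
  then have "ennreal L * (ennreal (1 / L) * \<rho> h) \<le> ennreal L * 1" by (intro mult_left_mono) auto
  then have "\<rho> h \<le> ennreal L" using L by (simp add: mult.assoc[symmetric] ennreal_mult[symmetric])
  then show "\<rho> h \<le> ennreal K + ennreal e" using K e by (simp add: L_def)
qed

end

section \<open>Muckenhoupt weights and the reverse Hoelder inequality\<close>

text \<open>The Muckenhoupt condition \<open>M v \<le> A v\<close> over half-open cubes. It is
  required at every point instead of almost every point, so that the plain infimum of
  \<open>v\<close> over a cube can replace the essential one.\<close>

definition A1_weight :: "real \<Rightarrow> (real^'n \<Rightarrow> real) \<Rightarrow> bool" where
  "A1_weight A v \<longleftrightarrow> v \<in> borel_measurable lebesgue \<and> (\<forall>x. 0 \<le> v x) \<and>
     (\<forall>a l x. l > 0 \<longrightarrow> x \<in> hcube a l \<longrightarrow>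
        (\<integral>\<^sup>+y\<in>hcube a l. ennreal (v y) \<partial>lebesgue) \<le> ennreal (A * v x) * ennreal (l ^ CARD('n)))"

lemma A1_weightD:
  fixes v :: "real^'n \<Rightarrow> real"
  assumes "A1_weight A v"
  shows "v \<in> borel_measurable lebesgue" "0 \<le> v x"
    "l > 0 \<Longrightarrow> x \<in> hcube a l \<Longrightarrow>
      (\<integral>\<^sup>+y\<in>hcube a l. ennreal (v y) \<partial>lebesgue) \<le> ennreal (A * v x) * ennreal (l ^ CARD('n))"
  using assms by (auto simp: A1_weight_def)

lemma nn_integral_const_hcube:
  fixes a :: "real^'n"
  assumes "l > 0"
  shows "(\<integral>\<^sup>+x\<in>hcube a l. c \<partial>lebesgue) = c * ennreal (l ^ CARD('n))"
  unfolding emeasure_hcube[OF assms, of a, symmetric]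
  by (rule nn_integral_cmult_indicator) measurable

text \<open>With \<open>C\<close> a bound for \<open>M\<close> on \<open>X\<close>, the series
  \<open>w\<close> of the iterates of \<open>M\<close> on \<open>\<bar>f\<bar>\<close>, weighted by
  \<open>(1 / (2 * C)) ^ k\<close>, has norm at most \<open>\<Sum>k. (1/2) ^ k = 2\<close> times
  that of \<open>f\<close>. Applying \<open>M\<close> shifts the series by one term, whence
  \<open>M w \<le> 2 * C * w\<close>; the zeroth term is \<open>\<bar>f\<bar>\<close>.\<close>

lemma rubio_de_francia:
  fixes \<rho> :: "(real^'n \<Rightarrow> ennreal) \<Rightarrow> ennreal"
  assumes bfn: "banach_function_norm \<rho>" and bdd: "bounded_on_bfs \<rho> hl_maximal"
  obtains A where "A \<ge> 1"
    and "\<And>f N. f \<in> bfs \<rho> \<Longrightarrow> AE x in lebesgue. cmod (f x) \<le> N \<Longrightarrow>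
      \<exists>v. A1_weight A v \<and> (AE x in lebesgue. cmod (f x) \<le> v x) \<and> (\<forall>x. v x \<le> max N 0) \<and>
        \<rho> (\<lambda>x. ennreal (v x)) \<le> 2 * bfs_norm \<rho> f"
proof -
  obtain C0 where C0: "C0 > 0" "\<And>f. f \<in> bfs \<rho> \<Longrightarrow> \<rho> (hl_maximal f) \<le> ennreal C0 * bfs_norm \<rho> f"
    using bdd by (auto simp: bounded_on_bfs_def)
  \<comment> \<open>The lower bound 1 gives \<open>A = 2 * C \<ge> 1\<close> and lets a constant
    level satisfy the weight condition.\<close>
  define C where "C = max C0 1"
  have C: "C \<ge> 1" "C0 \<le> C" by (auto simp: C_def)
  \<comment> \<open>The hypothesis speaks of complex functions. An \<open>ennreal\<close>-valued
    \<open>g\<close> of finite norm is finite a.e., so it agrees a.e. with the modulus of one, and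
    averages do not see the difference.\<close>
  have mxb: "\<rho> (mx g) \<le> ennreal C * \<rho> g"
    if [measurable]: "g \<in> borel_measurable lebesgue" and fin: "\<rho> g < \<infinity>" for g
  proof -
    define f where "f x = complex_of_real (enn2real (g x))" for x
    have [measurable]: "f \<in> borel_measurable lebesgue" unfolding f_def by measurable
    have eq: "AE x in lebesgue. ennreal (cmod (f x)) = g x"
      using bfn_AE_finite[OF bfn _ fin] by (auto simp: f_def elim: eventually_mono)
    have nf: "bfs_norm \<rho> f = \<rho> g"
      unfolding bfs_norm_def using eq by (intro bfn_cong_AE[OF bfn]) auto
    then have "f \<in> bfs \<rho>" using fin by (simp add: bfs_def)
    then have "\<rho> (hl_maximal f) \<le> ennreal C0 * \<rho> g" using C0(2) nf by metis
    also have "hl_maximal f = mx g"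
      unfolding hl_maximal_eq_mx by (rule mx_cong_AE[OF eq])
    also have "ennreal C0 * \<rho> g \<le> ennreal C * \<rho> g" using C by (intro mult_right_mono ennreal_leI) auto
    finally show ?thesis .
  qed
  show thesis
  proof
    show "2 * C \<ge> 1" using C by simp
    fix f :: "real^'n \<Rightarrow> complex" and N :: real
    assume f: "f \<in> bfs \<rho>" and fN: "AE x in lebesgue. cmod (f x) \<le> N"
    define g where "g k = (mx ^^ k) (\<lambda>x. ennreal (cmod (f x)))" for k
    have fm[measurable]: "f \<in> borel_measurable lebesgue" and ffin: "bfs_norm \<rho> f < \<infinity>" using f
      by (auto simp: bfs_def)
    have gS: "g (Suc k) = mx (g k)" for k by (simp add: g_def)
    have gm[measurable]: "g k \<in> borel_measurable lebesgue" for k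
      by (cases k) (simp add: g_def, simp add: gS)
    have \<rho>g: "\<rho> (g k) \<le> ennreal (C ^ k) * bfs_norm \<rho> f" for k
    proof (induction k)
      case 0 then show ?case by (simp add: g_def bfs_norm_def)
    next
      case (Suc k)
      have "\<rho> (g k) < \<infinity>" using Suc ffin by (auto simp: order_le_less_trans ennreal_mult_less_top)
      then have "\<rho> (g (Suc k)) \<le> ennreal C * \<rho> (g k)" unfolding gS by (intro mxb) auto
      also have "\<dots> \<le> ennreal C * (ennreal (C ^ k) * bfs_norm \<rho> f)" using Suc by (intro mult_left_mono) auto
      finally show ?case using C by (simp add: ennreal_mult mult.assoc)
    qed
    define w where "w x = (\<Sum>k. ennreal ((1 / (2 * C)) ^ k) * g k x)" for x
    have wm[measurable]: "w \<in> borel_measurable lebesgue" unfolding w_def by measurable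
    have "\<rho> w \<le> (\<Sum>k. \<rho> (\<lambda>x. ennreal ((1 / (2 * C)) ^ k) * g k x))"
      unfolding w_def by (intro bfn_suminf_le[OF bfn]) measurable
    also have "\<dots> \<le> (\<Sum>k. ennreal ((1 / 2) ^ k) * bfs_norm \<rho> f)"
    proof (intro suminf_le)
      fix k
      have "\<rho> (\<lambda>x. ennreal ((1 / (2 * C)) ^ k) * g k x) = ennreal ((1 / (2 * C)) ^ k) * \<rho> (g k)"
        using C by (intro bfn_scale[OF bfn]) auto
      also have "\<dots> \<le> ennreal ((1 / (2 * C)) ^ k) * (ennreal (C ^ k) * bfs_norm \<rho> f)"
        by (intro mult_left_mono \<rho>g) auto
      also have "\<dots> = ennreal ((1 / (2 * C)) ^ k * C ^ k) * bfs_norm \<rho> f"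
        using C by (subst ennreal_mult) (auto simp: mult.assoc)
      also have "(1 / (2 * C)) ^ k * C ^ k = (1 / 2) ^ k"
        using C by (simp add: power_mult_distrib[symmetric] del: power_one_over)
      finally show "\<rho> (\<lambda>x. ennreal ((1 / (2 * C)) ^ k) * g k x) \<le> ennreal ((1 / 2) ^ k) * bfs_norm \<rho> f" .
    qed auto
    also have "\<dots> = (\<Sum>k. ennreal ((1 / 2) ^ k)) * bfs_norm \<rho> f" by simp
    also have "(\<Sum>k. ennreal ((1 / 2) ^ k)) = ennreal (\<Sum>k. (1 / 2) ^ k)"
      by (intro suminf_ennreal2) (auto intro: summable_geometric)
    also have "(\<Sum>k. (1 / 2 :: real) ^ k) = 2" by (subst suminf_geometric) auto
    finally have \<rho>w: "\<rho> w \<le> 2 * bfs_norm \<rho> f" by simp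
    have mxw: "mx w x \<le> ennreal (2 * C) * w x" for x
    proof -
      have "mx w x \<le> (\<Sum>k. mx (\<lambda>x. ennreal ((1 / (2 * C)) ^ k) * g k x) x)"
        unfolding w_def by (intro mx_suminf_le) measurable
      also have "\<dots> \<le> (\<Sum>k. ennreal ((1 / (2 * C)) ^ k) * g (Suc k) x)"
        unfolding gS by (intro suminf_le mx_cmult_le) auto
      also have "\<dots> = (\<Sum>k. ennreal (2 * C) * (ennreal ((1 / (2 * C)) ^ Suc k) * g (Suc k) x))"
      proof (intro suminf_cong)
        fix k
        have "ennreal (2 * C) * ennreal ((1 / (2 * C)) ^ Suc k) = ennreal ((1 / (2 * C)) ^ k)"
          using C by (subst ennreal_mult[symmetric]) auto
        then show "ennreal ((1 / (2 * C)) ^ k) * g (Suc k) x =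
            ennreal (2 * C) * (ennreal ((1 / (2 * C)) ^ Suc k) * g (Suc k) x)"
          by (simp only: mult.assoc[symmetric])
      qed
      also have "\<dots> = ennreal (2 * C) * (\<Sum>k. ennreal ((1 / (2 * C)) ^ Suc k) * g (Suc k) x)"
        by simp
      also have "(\<Sum>k. ennreal ((1 / (2 * C)) ^ Suc k) * g (Suc k) x) \<le> w x" (is "?S \<le> _")
        unfolding w_def
      proof (rule suminf_le_const)
        fix n
        have "(\<Sum>k<n. ennreal ((1 / (2 * C)) ^ Suc k) * g (Suc k) x)
            \<le> (\<Sum>k<Suc n. ennreal ((1 / (2 * C)) ^ k) * g k x)"
          unfolding sum.lessThan_Suc_shift by simp
        also have "\<dots> \<le> (\<Sum>k. ennreal ((1 / (2 * C)) ^ k) * g k x)"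
          by (intro sum_le_suminf) auto
        finally show "(\<Sum>k<n. ennreal ((1 / (2 * C)) ^ Suc k) * g (Suc k) x)
            \<le> (\<Sum>k. ennreal ((1 / (2 * C)) ^ k) * g k x)" .
      qed auto
      finally show ?thesis by (simp add: mult_left_mono)
    qed
    have gw: "g 0 x \<le> w x" for x
      unfolding w_def using sum_le_suminf[of "\<lambda>k. ennreal ((1 / (2 * C)) ^ k) * g k x" "{0}"] by simp
    \<comment> \<open>Truncation of \<open>w\<close> at this level keeps the weight condition: where
      \<open>w\<close> reaches the level, the level bounds every average of \<open>v\<close>, and
      elsewhere the estimate for \<open>w\<close> applies. The bounded weight is what later makes
      the absorbed term finite.\<close>
    define M where "M = max N 0"
    have M: "M \<ge> 0" by (simp add: M_def)
    define v where "v x = enn2real (min (w x) (ennreal M))" for x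
    have [measurable]: "v \<in> borel_measurable lebesgue" unfolding v_def by measurable
    have ev: "ennreal (v x) = min (w x) (ennreal M)" for x
      unfolding v_def by (intro ennreal_enn2real) (simp add: min_less_iff_disj)
    have "A1_weight (2 * C) v"
      unfolding A1_weight_def
    proof (intro conjI allI impI)
      fix a :: "real^'n" and l x assume l: "l > (0::real)" and x: "x \<in> hcube a l"
      show "(\<integral>\<^sup>+y\<in>hcube a l. ennreal (v y) \<partial>lebesgue) \<le> ennreal (2 * C * v x) * ennreal (l ^ CARD('n))"
      proof (cases "w x \<ge> ennreal M")
        case True
        have "(\<integral>\<^sup>+y\<in>hcube a l. ennreal (v y) \<partial>lebesgue) \<le> (\<integral>\<^sup>+y\<in>hcube a l. ennreal M \<partial>lebesgue)"
          by (intro nn_integral_mono mult_right_mono) (auto simp: ev)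
        also have "\<dots> = ennreal M * ennreal (l ^ CARD('n))"
          using l by (rule nn_integral_const_hcube)
        also have "v x = M" using True M by (simp add: v_def min_absorb2)
        then have "ennreal M * ennreal (l ^ CARD('n)) \<le> ennreal (2 * C * v x) * ennreal (l ^ CARD('n))"
          using C M mult_right_mono[of 1 "2 * C" M] by (intro mult_right_mono ennreal_leI) auto
        finally show ?thesis .
      next
        case False
        have "(\<integral>\<^sup>+y\<in>hcube a l. ennreal (v y) \<partial>lebesgue) \<le> (\<integral>\<^sup>+y\<in>hcube a l. w y \<partial>lebesgue)"
          by (intro nn_integral_mono mult_right_mono) (auto simp: ev)
        also have "\<dots> \<le> mx w x * ennreal (l ^ CARD('n))" using l x by (rule mx_upper_hcube)
        also have "\<dots> \<le> ennreal (2 * C) * w x * ennreal (l ^ CARD('n))" by (intro mult_right_mono mxw) auto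
        also have "w x = ennreal (v x)" using False ev[of x] by (simp add: min_absorb1)
        finally show ?thesis using C by (simp add: ennreal_mult v_def)
      qed
    qed (auto simp: v_def)
    moreover have "AE x in lebesgue. cmod (f x) \<le> v x"
      using fN
    proof eventually_elim
      case (elim x)
      then have "ennreal (cmod (f x)) \<le> ennreal (v x)"
        unfolding ev using gw[of x] by (auto simp: g_def M_def intro!: ennreal_leI)
      then show ?case by (simp add: v_def)
    qed
    moreover have "v x \<le> M" for x
      using M by (auto simp: v_def intro!: enn2real_leI)
    moreover have "\<rho> (\<lambda>x. ennreal (v x)) \<le> \<rho> w"
      by (intro bfn_mono[OF bfn]) (auto simp: ev)
    ultimately show "\<exists>v. A1_weight (2 * C) v \<and> (AE x in lebesgue. cmod (f x) \<le> v x) \<and> (\<forall>x. v x \<le> max N 0) \<and>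
        \<rho> (\<lambda>x. ennreal (v x)) \<le> 2 * bfs_norm \<rho> f"
      using \<rho>w by (intro exI[of _ v]) (auto simp: M_def intro: order_trans)
  qed
qed

section \<open>Discrete layer-cake sums over powers of two\<close>

lemma powr_power_commute: "(2 powr \<epsilon>) ^ k = (2 ^ k) powr \<epsilon>" for \<epsilon> :: real
  by (induction k) (simp_all add: powr_mult)

text \<open>The increments of the powers of \<open>2 powr \<epsilon>\<close> telescope over the
  levels below \<open>u\<close>, and the summand 1 takes care of \<open>u \<le> 1\<close>.
  Boundedness of \<open>u\<close> allows finitely many levels.\<close>

lemma layer_sum_lower:
  fixes u \<epsilon> :: real
  assumes "0 \<le> u" "u \<le> 2 ^ M" "\<epsilon> > 0"
  shows "u powr \<epsilon> \<le> 1 + (\<Sum>k<M. ((2 powr \<epsilon>) ^ Suc k - (2 powr \<epsilon>) ^ k) * of_bool (u > 2 ^ k))"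
  using assms(2)
proof (induction M)
  case 0
  then show ?case using powr_mono2[of \<epsilon> u 1] assms by simp
next
  case (Suc M)
  show ?case
  proof (cases "u > 2 ^ M")
    case True
    have "of_bool (u > 2 ^ k) = (1::real)" if "k < Suc M" for k
      using order_le_less_trans[OF power_increasing[of k M "2::real"] True] that by simp
    then have "(\<Sum>k<Suc M. ((2 powr \<epsilon>) ^ Suc k - (2 powr \<epsilon>) ^ k) * of_bool (u > 2 ^ k)) =
        (\<Sum>k<Suc M. (2 powr \<epsilon>) ^ Suc k - (2 powr \<epsilon>) ^ k)"
      by (intro sum.cong) auto
    also have "\<dots> = (2 powr \<epsilon>) ^ Suc M - 1" by (subst sum_lessThan_telescope) simp
    finally have "1 + (\<Sum>k<Suc M. ((2 powr \<epsilon>) ^ Suc k - (2 powr \<epsilon>) ^ k) * of_bool (u > 2 ^ k))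
        = (2 ^ Suc M) powr \<epsilon>"
      unfolding powr_power_commute[symmetric] by linarith
    then show ?thesis using powr_mono2[of \<epsilon> u "2 ^ Suc M"] Suc.prems assms by simp
  next
    case False
    then show ?thesis using Suc.IH by simp
  qed
qed

text \<open>The terms present form a geometric sum of ratio \<open>2 powr p \<ge> 2\<close>, hence
  at most twice its last term, and the last level lies below \<open>u\<close>.\<close>

lemma layer_sum_upper:
  fixes u p :: real
  assumes "0 \<le> u" "p \<ge> 1"
  shows "(\<Sum>k<M. (2 powr p) ^ k * of_bool (u > 2 ^ k)) \<le> 2 * u powr p"
proof (induction M)
  case (Suc M)
  show ?case
  proof (cases "u > 2 ^ M")
    case True
    have p2: "2 powr p \<ge> 2" using powr_mono[of 1 p 2] assms by simp
    have geo: "(\<Sum>k<Suc m. (2 powr p) ^ k) \<le> 2 * (2 powr p) ^ m" for m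
    proof (induction m)
      case (Suc m)
      have "2 * (2 powr p) ^ m \<le> (2 powr p) ^ Suc m"
        using mult_right_mono[OF p2, of "(2 powr p) ^ m"] by simp
      then show ?case using Suc by (simp only: sum.lessThan_Suc[of _ "Suc m"])
    qed simp
    have "(\<Sum>k<Suc M. (2 powr p) ^ k * of_bool (u > 2 ^ k)) \<le> (\<Sum>k<Suc M. (2 powr p) ^ k)"
      by (intro sum_mono) auto
    also have "\<dots> \<le> 2 * (2 powr p) ^ M" by (rule geo)
    also have "(2 powr p) ^ M = (2 ^ M) powr p"
      by (rule powr_power_commute)
    also have "(2 ^ M) powr p \<le> u powr p" using True assms by (intro powr_mono2) auto
    finally show ?thesis by simp
  next
    case False
    then show ?thesis using Suc.IH by simp
  qed
qed (use assms in simp)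

text \<open>On a maximal cell where \<open>v\<close> has average above \<open>t\<close>, the average is at most \<open>2\<^sup>n t\<close>, while the
  \<open>A1\<close> condition forces \<open>A v > t\<close> everywhere.\<close>

lemma A1_level_set:
  fixes v :: "real^'n \<Rightarrow> real"
  assumes v: "A1_weight A v" and A: "A > 0" and l: "l > 0" and t: "t > 0"
    and Q: "(\<integral>\<^sup>+x\<in>hcube a l. ennreal (v x) \<partial>lebesgue) \<le> ennreal t * ennreal (l ^ CARD('n))"
  shows "(\<integral>\<^sup>+x\<in>hcube a l. ennreal (v x) * of_bool (v x > t) \<partial>lebesgue)
    \<le> ennreal (2 ^ CARD('n) * t) * (\<integral>\<^sup>+x\<in>hcube a l. of_bool (A * v x > t) \<partial>lebesgue)"
proof -
  note [measurable] = A1_weightD(1)[OF v]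
  have v0: "0 \<le> v x" for x by (rule A1_weightD(2)[OF v])
  define P where "P b s \<longleftrightarrow> (\<integral>\<^sup>+x\<in>hcube b s. ennreal (v x) \<partial>lebesgue) > ennreal t * ennreal (s ^ CARD('n))"
    for b :: "real^'n" and s
  obtain C where C: "countable C" "disjoint_family_on (\<lambda>(b, s). hcube b s) C"
    "(\<Union>(b, s)\<in>C. hcube b s) = {x \<in> hcube a l. \<exists>j. P (corner a l j x) (l / 2 ^ j)}"
    and CP: "\<And>b s. (b, s) \<in> C \<Longrightarrow> s > 0 \<and> P b s"
    and par: "\<And>b s. (b, s) \<in> C \<Longrightarrow> (b, s) = (a, l) \<or>
           (\<exists>b'. hcube b s \<subseteq> hcube b' (2 * s) \<and> hcube b' (2 * s) \<subseteq> hcube a l \<and> \<not> P b' (2 * s))"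
    by (rule stopping_cells[OF l, of a P]) blast
  define X where "X = (\<lambda>i :: (real^'n) \<times> real. case i of (b, s) \<Rightarrow> hcube b s)"
  have Xm[measurable]: "X i \<in> sets lebesgue" for i by (auto simp: X_def split: prod.split)
  define \<Omega> where "\<Omega> = (\<Union>i\<in>C. X i)"
  have \<Omega>m[measurable]: "\<Omega> \<in> sets lebesgue" unfolding \<Omega>_def using C(1) by auto
  have \<Omega>eq: "\<Omega> = {x \<in> hcube a l. \<exists>j. P (corner a l j x) (l / 2 ^ j)}" using C(3) by (simp add: \<Omega>_def X_def)
  have dis: "disjoint_family_on X C" using C(2) by (simp add: X_def)
  have C_int: "(\<integral>\<^sup>+x\<in>X i. ennreal (v x) \<partial>lebesgue) \<le> ennreal (2 ^ CARD('n) * t) * emeasure lebesgue (X i)"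
    and C_low: "X i \<subseteq> {x \<in> hcube a l. A * v x > t}" if iC: "i \<in> C" for i
  proof -
    obtain b s where i: "i = (b, s)" by fastforce
    have s: "s > 0" "P b s" using CP[of b s] iC i by auto
    \<comment> \<open>The initial cube has average at most \<open>t\<close> and does not stop. So
      every selected cell has a parent of average at most \<open>t\<close>, whose volume is
      \<open>2 ^ CARD('n)\<close> times that of the cell.\<close>
    have ne: "(b, s) \<noteq> (a, l)" using s(2) Q by (auto simp: P_def)
    then obtain b' where b': "hcube b s \<subseteq> hcube b' (2 * s)" "\<not> P b' (2 * s)"
      using par[of b s] iC ne unfolding i by blast
    have "(\<integral>\<^sup>+x\<in>X i. ennreal (v x) \<partial>lebesgue) \<le> (\<integral>\<^sup>+x\<in>hcube b' (2 * s). ennreal (v x) \<partial>lebesgue)"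
      using b' i by (intro nn_integral_mono) (auto simp: X_def split: split_indicator)
    also have "\<dots> \<le> ennreal t * ennreal ((2 * s) ^ CARD('n))" using b'(2) by (simp add: P_def not_less)
    also have "\<dots> = ennreal (2 ^ CARD('n) * t) * emeasure lebesgue (X i)"
    proof -
      have e: "emeasure lebesgue (X i) = ennreal (s ^ CARD('n))" using s(1)
        by (simp only: X_def i prod.case emeasure_hcube)
      show ?thesis unfolding e using s t
        by (simp add: ennreal_mult[symmetric] power_mult_distrib algebra_simps)
    qed
    finally show "(\<integral>\<^sup>+x\<in>X i. ennreal (v x) \<partial>lebesgue)
        \<le> ennreal (2 ^ CARD('n) * t) * emeasure lebesgue (X i)" .
    show "X i \<subseteq> {x \<in> hcube a l. A * v x > t}"
    proof
      fix x assume x: "x \<in> X i"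
      then have xb: "x \<in> hcube b s" by (simp add: X_def i)
      have "x \<in> \<Omega>" using x iC by (auto simp: \<Omega>_def)
      then have xQ: "x \<in> hcube a l" by (simp add: \<Omega>eq)
      have "ennreal t * ennreal (s ^ CARD('n)) < ennreal (A * v x) * ennreal (s ^ CARD('n))"
        using s(2) A1_weightD(3)[OF v s(1) xb] unfolding P_def by (rule order_less_le_trans)
      then have "\<not> ennreal (A * v x) \<le> ennreal t"
        using mult_right_mono[of "ennreal (A * v x)" "ennreal t" "ennreal (s ^ CARD('n))"]
          by (meson leD zero_le)
      then show "x \<in> {x \<in> hcube a l. A * v x > t}" using xQ t v0[of x] A by (auto simp: ennreal_le_iff)
    qed
  qed
  have null: "AE x in lebesgue. x \<in> hcube a l \<and> v x > t \<longrightarrow> x \<in> \<Omega>"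
  proof -
    \<comment> \<open>Off \<open>\<Omega>\<close> all cells have average at most \<open>t\<close>.
      In such a cell the part where \<open>v\<close> exceeds
      \<open>t * (1 + 1 / real (Suc k))\<close> therefore occupies at most the fraction
      \<open>1 / (1 + 1 / real (Suc k)) < 1\<close>, and the density lemma makes \<open>E k\<close>
      null. The sets \<open>E k\<close> exhaust the points off \<open>\<Omega>\<close> where
      \<open>v > t\<close>.\<close>
    define E where "E k = {x \<in> hcube a l - \<Omega>. v x > t * (1 + 1 / real (Suc k))}" for k
    have Em[measurable]: "E k \<in> sets lebesgue" for k
    proof -
      have "{x \<in> space lebesgue. v x > t * (1 + 1 / real (Suc k))} \<in> sets lebesgue" by measurable
      then have "(hcube a l - \<Omega>) \<inter> {x. v x > t * (1 + 1 / real (Suc k))} \<in> sets lebesgue" by auto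
      then show ?thesis by (simp add: E_def Int_def)
    qed
    have "emeasure lebesgue (E k) = 0" for k
    proof (rule null_if_density_le[OF l Em[of k], where a=a and \<theta>="1 / (1 + 1 / real (Suc k))"])
      let ?\<theta> = "1 / (1 + 1 / real (Suc k))"
      show "?\<theta> < 1" "0 \<le> ?\<theta>" by (auto simp: field_simps)
      show "E k \<subseteq> hcube a l" by (auto simp: E_def)
      fix x j assume x: "x \<in> E k"
      let ?c = "cell a l j x"
      have "\<not> P (corner a l j x) (l / 2 ^ j)" using x by (auto simp: E_def \<Omega>eq)
      then have le: "(\<integral>\<^sup>+y\<in>?c. ennreal (v y) \<partial>lebesgue) \<le> ennreal t * emeasure lebesgue ?c"
        using emeasure_hcube[of "l / 2 ^ j" "corner a l j x"] l unfolding P_def not_less by simp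
      have "ennreal (t * (1 + 1 / real (Suc k))) * emeasure lebesgue (?c \<inter> E k) =
          (\<integral>\<^sup>+y\<in>?c \<inter> E k. ennreal (t * (1 + 1 / real (Suc k))) \<partial>lebesgue)"
        by (subst nn_integral_cmult_indicator) auto
      also have "\<dots> \<le> (\<integral>\<^sup>+y\<in>?c. ennreal (v y) \<partial>lebesgue)"
        by (intro nn_integral_mono) (auto simp: E_def split: split_indicator intro!: ennreal_leI)
      finally have "ennreal (t * (1 + 1 / real (Suc k))) * emeasure lebesgue (?c \<inter> E k)
          \<le> ennreal t * emeasure lebesgue ?c"
        using le by simp
      then have "ennreal (?\<theta> / t) * (ennreal (t * (1 + 1 / real (Suc k))) * emeasure lebesgue (?c \<inter> E k))
          \<le> ennreal (?\<theta> / t) * (ennreal t * emeasure lebesgue ?c)"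
        by (intro mult_left_mono) auto
      moreover have "ennreal (?\<theta> / t) * ennreal (t * (1 + 1 / real (Suc k))) = 1"
      proof -
        have "1 / d / t * (t * d) = 1" if "d > 0" for d using t that by simp
        from this[of "1 + 1 / real (Suc k)"]
        have "?\<theta> / t * (t * (1 + 1 / real (Suc k))) = 1" by (simp add: add_pos_nonneg)
        moreover have "?\<theta> / t \<ge> 0" using t by simp
        ultimately show ?thesis by (metis ennreal_1 ennreal_mult')
      qed
      moreover have "ennreal (?\<theta> / t) * ennreal t = ennreal ?\<theta>"
        using t by (subst ennreal_mult[symmetric]) auto
      ultimately show "emeasure lebesgue (?c \<inter> E k) \<le> ennreal ?\<theta> * emeasure lebesgue ?c"
        by (simp only: mult.assoc[symmetric] mult_1_left)
    qed
    then have "AE x in lebesgue. \<forall>k. x \<notin> E k"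
      unfolding AE_all_countable by (intro allI AE_not_in null_setsI) auto
    then show ?thesis
    proof eventually_elim
      case (elim x)
      show ?case
      proof (intro impI, rule ccontr)
        assume x: "x \<in> hcube a l \<and> t < v x" and "x \<notin> \<Omega>"
        have "v x / t - 1 > 0" using x t by (simp add: field_simps)
        then obtain k where "inverse (real (Suc k)) < v x / t - 1" using reals_Archimedean by blast
        then have "t * (1 + 1 / real (Suc k)) < v x" using t by (simp add: field_simps)
        then have "x \<in> E k" using x \<open>x \<notin> \<Omega>\<close> by (simp add: E_def)
        with elim show False by blast
      qed
    qed
  qed
  have "(\<integral>\<^sup>+x\<in>hcube a l. ennreal (v x) * of_bool (v x > t) \<partial>lebesgue) \<le> (\<integral>\<^sup>+x\<in>\<Omega>. ennreal (v x) \<partial>lebesgue)"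
    using null by (intro nn_integral_mono_AE) (auto elim!: eventually_mono split: split_indicator)
  also have "\<dots> = (\<integral>\<^sup>+i. (\<integral>\<^sup>+x\<in>X i. ennreal (v x) \<partial>lebesgue) \<partial>count_space C)"
    unfolding \<Omega>_def by (intro nn_integral_countable_disjoint_UN C(1) dis) auto
  also have "\<dots> \<le> (\<integral>\<^sup>+i. ennreal (2 ^ CARD('n) * t) * emeasure lebesgue (X i) \<partial>count_space C)"
    by (intro nn_integral_mono C_int) simp
  also have "\<dots> = ennreal (2 ^ CARD('n) * t) * emeasure lebesgue \<Omega>"
    unfolding \<Omega>_def using C(1) dis by (subst emeasure_UN_countable) (auto simp: nn_integral_cmult)
  also have "emeasure lebesgue \<Omega> = (\<integral>\<^sup>+x. indicator \<Omega> x \<partial>lebesgue)" by simp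
  also have "\<dots> \<le> (\<integral>\<^sup>+x\<in>hcube a l. of_bool (A * v x > t) \<partial>lebesgue)"
    using C_low by (intro nn_integral_mono) (auto simp: \<Omega>_def split: split_indicator)
  finally show ?thesis by (simp add: mult_left_mono)
qed

text \<open>Summing the level set estimate over \<open>t = 2\<^sup>k s\<close> bounds the left hand side \<open>I\<close> by
  \<open>s powr (1 + \<epsilon>) * l\<^sup>n + I / 2\<close>; it is finite because \<open>v\<close> is bounded.\<close>

lemma reverse_holder:
  fixes v :: "real^'n \<Rightarrow> real"
  assumes v: "A1_weight A v" and A: "A \<ge> 1" and N: "\<And>x. v x \<le> N"
    and \<epsilon>: "0 < \<epsilon>" "\<epsilon> \<le> 1" and small: "(2 powr \<epsilon> - 1) * 2 ^ (CARD('n) + 1) * A ^ 2 \<le> 1 / 2"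
    and l: "l > 0" and s: "s \<ge> 0"
    and S: "(\<integral>\<^sup>+x\<in>hcube a l. ennreal (v x) \<partial>lebesgue) = ennreal s * ennreal (l ^ CARD('n))"
  shows "(\<integral>\<^sup>+x\<in>hcube a l. ennreal (v x powr (1 + \<epsilon>)) \<partial>lebesgue)
      \<le> ennreal (2 * s powr (1 + \<epsilon>) * l ^ CARD('n))"
proof (cases "s = 0")
  case True
  note [measurable] = A1_weightD(1)[OF v]
  have "(\<integral>\<^sup>+x\<in>hcube a l. ennreal (v x) \<partial>lebesgue) = 0" using S True by simp
  then have "AE x in lebesgue. ennreal (v x) * indicator (hcube a l) x = 0"
    by (subst (asm) nn_integral_0_iff_AE) auto
  then have "AE x in lebesgue. ennreal (v x powr (1 + \<epsilon>)) * indicator (hcube a l) x = 0"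
    using A1_weightD(2)[OF v] by (auto elim!: eventually_mono split: split_indicator simp:
        ennreal_eq_0_iff order_antisym)
  then have "(\<integral>\<^sup>+x\<in>hcube a l. ennreal (v x powr (1 + \<epsilon>)) \<partial>lebesgue) = 0"
    by (subst nn_integral_0_iff_AE) auto
  then show ?thesis by simp
next
  case False
  then have s: "s > 0" using s by simp
  note [measurable] = A1_weightD(1)[OF v]
  have v0: "0 \<le> v x" for x by (rule A1_weightD(2)[OF v])
  define q where "q = 2 powr \<epsilon>"
  have q: "q > 1" using \<epsilon> by (simp add: q_def)
  \<comment> \<open>The bound on \<open>v\<close> limits the number of levels
    \<open>2 ^ k * s\<close>; these levels make sense because \<open>s = 0\<close> has been treated
    apart.\<close>
  obtain M where M: "N / s \<le> 2 ^ M"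
    by (metis less_imp_le one_less_numeral_iff real_arch_pow semiring_norm(76))
  define I where "I = (\<integral>\<^sup>+x\<in>hcube a l. ennreal (v x powr (1 + \<epsilon>)) \<partial>lebesgue)"
  define c where "c k = s powr \<epsilon> * (q ^ Suc k - q ^ k)" for k
  have c0: "c k \<ge> 0" for k using q by (simp add: c_def mult_right_mono)
  have pw: "ennreal (v x powr (1 + \<epsilon>)) \<le> ennreal (s powr \<epsilon>) * ennreal (v x)
      + (\<Sum>k<M. ennreal (c k) * (ennreal (v x) * of_bool (v x > 2 ^ k * s)))" for x
  proof -
    have "v x / s \<le> 2 ^ M" using M N[of x] s by (meson divide_right_mono less_imp_le order_trans)
    then have "(v x / s) powr \<epsilon> \<le> 1 + (\<Sum>k<M. (q ^ Suc k - q ^ k) * of_bool (v x / s > 2 ^ k))"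
      unfolding q_def using v0[of x] s \<epsilon> by (intro layer_sum_lower) auto
    then have "s powr \<epsilon> * v x * (v x / s) powr \<epsilon>
        \<le> s powr \<epsilon> * v x * (1 + (\<Sum>k<M. (q ^ Suc k - q ^ k) * of_bool (v x / s > 2 ^ k)))"
      using v0[of x] by (intro mult_left_mono) auto
    also have "s powr \<epsilon> * v x * (v x / s) powr \<epsilon> = v x powr (1 + \<epsilon>)"
      using v0[of x] s by (simp add: powr_divide powr_add)
    also have "s powr \<epsilon> * v x * (1 + (\<Sum>k<M. (q ^ Suc k - q ^ k) * of_bool (v x / s > 2 ^ k)))
       = s powr \<epsilon> * v x + (\<Sum>k<M. c k * (v x * of_bool (v x > 2 ^ k * s)))"
      unfolding distrib_left sum_distrib_left
      by (intro arg_cong2[where f="(+)"] sum.cong) (use s in \<open>auto simp: c_def pos_less_divide_eq\<close>)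
    finally have "ennreal (v x powr (1 + \<epsilon>))
        \<le> ennreal (s powr \<epsilon> * v x + (\<Sum>k<M. c k * (v x * of_bool (v x > 2 ^ k * s))))"
      by (rule ennreal_leI)
    also have "\<dots> = ennreal (s powr \<epsilon>) * ennreal (v x)
      + (\<Sum>k<M. ennreal (c k * (v x * of_bool (v x > 2 ^ k * s))))"
      using v0[of x] c0
      by (subst ennreal_plus, simp, simp add: sum_nonneg, subst sum_ennreal[symmetric])
          (auto simp: ennreal_mult)
    also have "(\<Sum>k<M. ennreal (c k * (v x * of_bool (v x > 2 ^ k * s)))) =
       (\<Sum>k<M. ennreal (c k) * (ennreal (v x) * of_bool (v x > 2 ^ k * s)))"
      using v0[of x] c0 by (intro sum.cong) (auto simp: ennreal_mult)
    finally show ?thesis .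
  qed
  have "I \<le> (\<integral>\<^sup>+x. ennreal (s powr \<epsilon>) * (ennreal (v x) * indicator (hcube a l) x)
      + (\<Sum>k<M. ennreal (c k) * (ennreal (v x) * of_bool (v x > 2 ^ k * s) * indicator
          (hcube a l) x)) \<partial>lebesgue)"
    unfolding I_def using pw by (intro nn_integral_mono) (auto split: split_indicator)
  also have "\<dots> = ennreal (s powr \<epsilon>) * (\<integral>\<^sup>+x\<in>hcube a l. ennreal (v x) \<partial>lebesgue)
      + (\<Sum>k<M. ennreal (c k) * (\<integral>\<^sup>+x\<in>hcube a l. ennreal (v x) * of_bool (v x > 2 ^ k * s) \<partial>lebesgue))"
    by (subst nn_integral_add) (auto simp: nn_integral_cmult nn_integral_sum)
  also have "\<dots> \<le> ennreal (s powr \<epsilon>) * (ennreal s * ennreal (l ^ CARD('n)))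
      + (\<Sum>k<M. ennreal (c k) * (ennreal (2 ^ CARD('n) * (2 ^ k * s)) *
          (\<integral>\<^sup>+x\<in>hcube a l. of_bool (A * v x > 2 ^ k * s) \<partial>lebesgue)))"
  proof (intro add_mono sum_mono mult_left_mono)
    fix k
    have "(\<integral>\<^sup>+x\<in>hcube a l. ennreal (v x) \<partial>lebesgue) \<le> ennreal (2 ^ k * s) * ennreal (l ^ CARD('n))"
      unfolding S using s mult_right_mono[of 1 "2 ^ k" s] by (intro mult_right_mono ennreal_leI) auto
    then show "(\<integral>\<^sup>+x\<in>hcube a l. ennreal (v x) * of_bool (v x > 2 ^ k * s) \<partial>lebesgue)
      \<le> ennreal (2 ^ CARD('n) * (2 ^ k * s)) * (\<integral>\<^sup>+x\<in>hcube a l. of_bool (A * v x > 2 ^ k * s) \<partial>lebesgue)"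
      using A s l by (intro A1_level_set[OF v]) auto
  qed (auto simp: S)
  also have "(\<Sum>k<M. ennreal (c k) *
      (ennreal (2 ^ CARD('n) * (2 ^ k * s)) * (\<integral>\<^sup>+x\<in>hcube a l. of_bool (A * v x > 2 ^ k * s) \<partial>lebesgue)))
      = (\<integral>\<^sup>+x\<in>hcube a l. (\<Sum>k<M. ennreal (c k * (2 ^ CARD('n) * (2 ^ k * s))) * of_bool
          (A * v x > 2 ^ k * s)) \<partial>lebesgue)"
    unfolding sum_distrib_right mult.assoc
    by (subst nn_integral_sum) (use s c0 in \<open>auto simp: nn_integral_cmult ennreal_mult mult.assoc\<close>)
  also have "\<dots> \<le> (\<integral>\<^sup>+x\<in>hcube a l. ennreal (1/2) * ennreal (v x powr (1 + \<epsilon>)) \<partial>lebesgue)"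
  proof (intro nn_integral_mono mult_right_mono)
    fix x
    have "(\<Sum>k<M. ennreal (c k * (2 ^ CARD('n) * (2 ^ k * s))) * of_bool (A * v x > 2 ^ k * s)) =
        (\<Sum>k<M. ennreal (c k * (2 ^ CARD('n) * (2 ^ k * s)) * of_bool (A * v x > 2 ^ k * s)))"
      by (intro sum.cong) auto
    also have "\<dots> = ennreal (\<Sum>k<M. c k * (2 ^ CARD('n) * (2 ^ k * s)) * of_bool (A * v x > 2 ^ k * s))"
      using s c0 by (intro sum_ennreal) auto
    finally have sum_eq: "(\<Sum>k<M. ennreal (c k * (2 ^ CARD('n) * (2 ^ k * s))) * of_bool (A * v x
        > 2 ^ k * s)) =
        ennreal (\<Sum>k<M. c k * (2 ^ CARD('n) * (2 ^ k * s)) * of_bool (A * v x > 2 ^ k * s))" .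
    \<comment> \<open>The weight \<open>c k\<close> contributes
      \<open>(2 powr \<epsilon>) ^ k\<close> and the level contributes \<open>2 ^ k\<close>;
      together they form the geometric sequence of \<open>layer_sum_upper\<close> with exponent
      \<open>1 + \<epsilon>\<close>, at \<open>u = A * v x / s\<close>. The factor
      \<open>q - 1\<close> survives, and the smallness assumption pays for the constants with
      it.\<close>
    have "(\<Sum>k<M. c k * (2 ^ CARD('n) * (2 ^ k * s)) * of_bool (A * v x > 2 ^ k * s)) =
       (q - 1) * 2 ^ CARD('n) * s powr (1 + \<epsilon>) *
           (\<Sum>k<M. (2 powr (1 + \<epsilon>)) ^ k * of_bool (A * v x / s > 2 ^ k))"
      unfolding sum_distrib_left
      using s by (intro sum.cong) (auto simp: c_def q_def powr_add power_mult_distrib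
          pos_less_divide_eq algebra_simps)
    also have "\<dots> \<le> (q - 1) * 2 ^ CARD('n) * s powr (1 + \<epsilon>) * (2 * (A * v x / s) powr (1 + \<epsilon>))"
      using q v0[of x] A s \<epsilon> by (intro mult_left_mono layer_sum_upper) auto
    also have "\<dots> = (q - 1) * 2 ^ (CARD('n) + 1) * A powr (1 + \<epsilon>) * v x powr (1 + \<epsilon>)"
      using v0[of x] A s by (simp add: powr_divide powr_mult)
    also have "\<dots> \<le> (q - 1) * 2 ^ (CARD('n) + 1) * A ^ 2 * v x powr (1 + \<epsilon>)"
    proof -
      have "A powr (1 + \<epsilon>) \<le> A powr 2" using A \<epsilon> by (intro powr_mono) auto
      then have "A powr (1 + \<epsilon>) \<le> A ^ 2" using A by simp
      then show ?thesis using q by (intro mult_right_mono mult_left_mono) auto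
    qed
    also have "\<dots> \<le> 1/2 * v x powr (1 + \<epsilon>)"
      using small by (intro mult_right_mono) (auto simp: q_def)
    finally have le: "(\<Sum>k<M. c k * (2 ^ CARD('n) * (2 ^ k * s)) * of_bool (A * v x > 2 ^ k * s))
        \<le> 1/2 * v x powr (1 + \<epsilon>)" .
    show "(\<Sum>k<M. ennreal (c k * (2 ^ CARD('n) * (2 ^ k * s))) * of_bool (A * v x > 2 ^ k * s))
        \<le> ennreal (1/2) * ennreal (v x powr (1 + \<epsilon>))"
      unfolding sum_eq using ennreal_leI[OF le] by (subst ennreal_mult[symmetric]) auto
  qed auto
  also have "\<dots> = ennreal (1/2) * I"
    unfolding I_def mult.assoc by (intro nn_integral_cmult) auto
  finally have I: "I \<le> ennreal (s powr \<epsilon>) * (ennreal s * ennreal (l ^ CARD('n))) + ennreal (1/2) * I"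
    by (auto intro: add_left_mono)
  have "I \<le> (\<integral>\<^sup>+x\<in>hcube a l. ennreal (N powr (1 + \<epsilon>)) \<partial>lebesgue)"
    unfolding I_def using v0 N \<epsilon> by (intro nn_integral_mono mult_right_mono ennreal_leI powr_mono2) auto
  also have "\<dots> = ennreal (N powr (1 + \<epsilon>)) * ennreal (l ^ CARD('n))"
    using l by (rule nn_integral_const_hcube)
  finally have "I < \<infinity>" by (auto simp: order_le_less_trans ennreal_mult_less_top)
  then obtain J where J: "I = ennreal J" "J \<ge> 0" by (cases I) auto
  have "ennreal J \<le> ennreal (s powr (1 + \<epsilon>) * l ^ CARD('n) + 1/2 * J)"
  proof -
    have "ennreal (s powr (1 + \<epsilon>) * l ^ CARD('n) + 1/2 * J) =
        ennreal (s powr \<epsilon>) * (ennreal s * ennreal (l ^ CARD('n))) + ennreal (1/2) * ennreal J"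
    proof -
      have "ennreal (1/2 * J) = ennreal (1/2) * ennreal J" using J(2) by (intro ennreal_mult) auto
      moreover have "ennreal (s powr (1 + \<epsilon>) * l ^ CARD('n))
          = ennreal (s powr \<epsilon>) * (ennreal s * ennreal (l ^ CARD('n)))"
        using s l by (simp add: ennreal_mult powr_add mult_ac)
      ultimately show ?thesis using s l J(2) by (subst ennreal_plus) auto
    qed
    then show ?thesis using I unfolding J(1) by simp
  qed
  then have "J \<le> s powr (1 + \<epsilon>) * l ^ CARD('n) + 1/2 * J"
    using l J by (subst (asm) ennreal_le_iff) auto
  then show ?thesis using J by (simp add: I_def[symmetric] ennreal_leI)
qed

section \<open>Summation of local oscillations\<close>

text \<open>The union of the \<open>k\<close>-th generation descendants of the cube \<open>p\<close> under repeated stopping.\<close>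

primrec generation :: "('p \<Rightarrow> 'p set) \<Rightarrow> ('p \<Rightarrow> 'a set) \<Rightarrow> nat \<Rightarrow> 'p \<Rightarrow> 'a set" where
  "generation ch X 0 p = X p"
| "generation ch X (Suc k) p = (\<Union>q\<in>ch p. generation ch X k q)"

abbreviation hc :: "(real^'n) \<times> real \<Rightarrow> (real^'n) set" where
  "hc p \<equiv> hcube (fst p) (snd p)"

lemma ennreal_mult_right_cancel_le:
  assumes "c > 0" "x * ennreal c \<le> y * ennreal c"
  shows "x \<le> y"
proof -
  have "x * ennreal c * ennreal (1 / c) \<le> y * ennreal c * ennreal (1 / c)"
    using assms(2) by (rule mult_right_mono) simp
  moreover have "ennreal c * ennreal (1 / c) = 1" using assms(1) by (simp add: ennreal_mult[symmetric])
  ultimately show ?thesis by (simp only: mult.assoc mult_1_right)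
qed

lemma emeasure_hc:
  fixes p :: "(real^'n) \<times> real"
  shows "snd p > 0 \<Longrightarrow> emeasure lebesgue (hc p) = ennreal (snd p ^ CARD('n))"
  by (rule emeasure_hcube)

text \<open>One step of the local mean oscillation decomposition. Cells are stopped once the
  exceptional set \<open>E p\<close> fills more than the fraction \<open>\<theta>\<close> of them.
  Their total measure is at most that of \<open>E p\<close> divided by \<open>\<theta>\<close>,
  hence half of the cube. Off the stopped cells \<open>E p\<close> has density at most
  \<open>\<theta> < 1\<close> in every cell, so it is null there.\<close>

lemma oscillation_children:
  fixes F :: "real^'n \<Rightarrow> real" and c \<alpha> :: "(real^'n) \<times> real \<Rightarrow> real"
  assumes [measurable]: "F \<in> borel_measurable lebesgue"
    and osc: "\<And>p. snd p > 0 \<Longrightarrow> emeasure lebesgue {x \<in> hc p. \<bar>F x - c p\<bar> > \<alpha> p}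
      \<le> ennreal (1 / (4 * 2 ^ CARD('n))) * emeasure lebesgue (hc p)"
    and p: "snd p > 0"
  shows "\<exists>C. countable C \<and> disjoint_family_on hc C
      \<and> (\<forall>q\<in>C. snd q > 0 \<and> hc q \<subseteq> hc p \<and> \<bar>c q - c p\<bar> \<le> \<alpha> p + \<alpha> q) \<and>
    emeasure lebesgue (\<Union>q\<in>C. hc q) \<le> ennreal (1 / 2) * emeasure lebesgue (hc p) \<and>
    (AE x in lebesgue. x \<in> hc p - (\<Union>q\<in>C. hc q) \<longrightarrow> \<bar>F x - c p\<bar> \<le> \<alpha> p)"
proof -
  define E where "E q = {x \<in> hc q. \<bar>F x - c q\<bar> > \<alpha> q}" for q
  have Em[measurable]: "E q \<in> sets lebesgue" for q
  proof -
    have "{x \<in> space lebesgue. \<bar>F x - c q\<bar> > \<alpha> q} \<in> sets lebesgue" by measurable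
    then have "hc q \<inter> {x. \<bar>F x - c q\<bar> > \<alpha> q} \<in> sets lebesgue" by auto
    then show ?thesis by (simp add: E_def Int_def)
  qed
  \<comment> \<open>Twice the fraction allowed for exceptional sets, which yields the factor one
    half for the children; and \<open>2 ^ CARD('n) * \<theta> = 1 / 2\<close>, so that passing from
    a parent to a stopped cell leaves density at most one half.\<close>
  define \<theta> :: real where "\<theta> = 1 / (2 * 2 ^ CARD('n))"
  have "1 \<le> (2::real) ^ CARD('n)" by simp
  then have "1 < 2 * (2::real) ^ CARD('n)" by linarith
  then have \<theta>: "0 < \<theta>" "\<theta> < 1" by (auto simp: \<theta>_def)
  have E4: "emeasure lebesgue (E q) \<le> ennreal (\<theta> / 2) * emeasure lebesgue (hc q)" if "snd q > 0" for q
    using osc[OF that] by (simp add: E_def \<theta>_def)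
  define P where "P b s \<longleftrightarrow> emeasure lebesgue (hcube b s \<inter> E p) > ennreal \<theta> * emeasure lebesgue (hcube b s)"
    for b s
  obtain C where C: "countable C" "disjoint_family_on (\<lambda>(b, s). hcube b s) C"
    "(\<Union>(b, s)\<in>C. hcube b s) = {x \<in> hc p. \<exists>j. P (corner (fst p) (snd p) j x) (snd p / 2 ^ j)}"
    and CP: "\<And>b s. (b, s) \<in> C \<Longrightarrow> s > 0 \<and> P b s"
    and par: "\<And>b s. (b, s) \<in> C \<Longrightarrow> (b, s) = (fst p, snd p) \<or>
           (\<exists>b'. hcube b s \<subseteq> hcube b' (2 * s) \<and> hcube b' (2 * s) \<subseteq> hc p \<and> \<not> P b' (2 * s))"
    by (rule stopping_cells[OF p, of "fst p" P]) blast
  have hcX: "hc = (\<lambda>(b, s). hcube b s)" by (auto simp: fun_eq_iff)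
  have dis: "disjoint_family_on hc C" using C(2) by (simp only: hcX)
  define U where "U = (\<Union>q\<in>C. hc q)"
  have Um[measurable]: "U \<in> sets lebesgue" unfolding U_def using C(1) by (intro sets.countable_UN') auto
  have Ueq: "U = {x \<in> hc p. \<exists>j. P (corner (fst p) (snd p) j x) (snd p / 2 ^ j)}"
    using C(3) unfolding U_def hcX by simp
  have notP: "\<not> P (fst p) (snd p)"
  proof -
    have "emeasure lebesgue (hc p \<inter> E p) \<le> emeasure lebesgue (E p)" by (intro emeasure_mono) auto
    also have "\<dots> \<le> ennreal (\<theta> / 2) * emeasure lebesgue (hc p)" by (rule E4[OF p])
    also have "\<dots> \<le> ennreal \<theta> * emeasure lebesgue (hc p)" using \<theta> by (intro mult_right_mono ennreal_leI) auto
    finally show ?thesis by (simp add: P_def not_less)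
  qed
  have q: "snd q > 0 \<and> hc q \<subseteq> hc p \<and> \<bar>c q - c p\<bar> \<le> \<alpha> p + \<alpha> q" if qC: "q \<in> C" for q
  proof -
    obtain b s where qq: "q = (b, s)" by fastforce
    have s: "s > 0" "P b s" using CP[of b s] qC qq by auto
    have sub: "hc q \<subseteq> hc p" using qC Ueq U_def by blast
    have "(b, s) \<noteq> (fst p, snd p)" using s(2) notP by auto
    then obtain b' where b': "hcube b s \<subseteq> hcube b' (2 * s)" "\<not> P b' (2 * s)"
      using par[of b s] qC unfolding qq by blast
    have e1: "emeasure lebesgue (hc q \<inter> E p) \<le> ennreal (1 / 2) * emeasure lebesgue (hc q)"
    proof -
      have "emeasure lebesgue (hc q \<inter> E p) \<le> emeasure lebesgue (hcube b' (2 * s) \<inter> E p)"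
        using b'(1) qq by (intro emeasure_mono) auto
      also have "\<dots> \<le> ennreal \<theta> * emeasure lebesgue (hcube b' (2 * s))" using b'(2)
        by (simp add: P_def not_less)
      also have "emeasure lebesgue (hcube b' (2 * s)) = ennreal ((2 * s) ^ CARD('n))"
        using s by (intro emeasure_hcube) simp
      also have "ennreal \<theta> * ennreal ((2 * s) ^ CARD('n)) = ennreal (1 / 2) * ennreal (s ^ CARD('n))"
      proof -
        have "\<theta> * (2 * s) ^ CARD('n) = 1 / 2 * s ^ CARD('n)" by (simp add: \<theta>_def power_mult_distrib)
        then show ?thesis using s \<theta> by (metis ennreal_mult' less_imp_le half_gt_zero zero_less_one)
      qed
      also have "ennreal (s ^ CARD('n)) = emeasure lebesgue (hc q)" using s qq by (subst emeasure_hc) auto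
      finally show ?thesis .
    qed
    have e2: "emeasure lebesgue (E q) \<le> ennreal (1 / 4) * emeasure lebesgue (hc q)"
    proof -
      have "emeasure lebesgue (E q) \<le> ennreal (\<theta> / 2) * emeasure lebesgue (hc q)"
        using E4[of q] s qq by simp
      also have "\<dots> \<le> ennreal (1 / 4) * emeasure lebesgue (hc q)"
        by (intro mult_right_mono ennreal_leI) (auto simp: \<theta>_def field_simps)
      finally show ?thesis .
    qed
    \<comment> \<open>The two exceptional sets fill at most 1/2 and 1/4 of the child. At a common
      good point \<open>F\<close> is close to both constants, which compares \<open>c q\<close> with
      \<open>c p\<close>.\<close>
    have "\<exists>x. x \<in> hc q \<and> x \<notin> E p \<and> x \<notin> E q"
    proof (rule ccontr)
      assume "\<not> ?thesis"
      then have "hc q \<subseteq> (hc q \<inter> E p) \<union> E q" by auto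
      then have "emeasure lebesgue (hc q) \<le> emeasure lebesgue ((hc q \<inter> E p) \<union> E q)"
        by (intro emeasure_mono) auto
      also have "\<dots> \<le> emeasure lebesgue (hc q \<inter> E p) + emeasure lebesgue (E q)"
        by (intro emeasure_subadditive) auto
      also have "\<dots> \<le> ennreal (1 / 2) * emeasure lebesgue (hc q) + ennreal (1 / 4) * emeasure
          lebesgue (hc q)"
        by (intro add_mono e1 e2)
      also have "\<dots> = ennreal (3 / 4 * s ^ CARD('n))"
      proof -
        have "emeasure lebesgue (hc q) = ennreal (s ^ CARD('n))" using s qq by (subst emeasure_hc) auto
        then show ?thesis unfolding distrib_right[symmetric]
          by (subst ennreal_plus[symmetric]) (auto simp: ennreal_mult'[symmetric] simp del: ennreal_plus)
      qed
      finally have "ennreal (s ^ CARD('n)) \<le> ennreal (3 / 4 * s ^ CARD('n))"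
        using s qq by (subst (asm) emeasure_hc) auto
      then show False using s by (subst (asm) ennreal_le_iff) auto
    qed
    then obtain x where x: "x \<in> hc q" "x \<notin> E p" "x \<notin> E q" by blast
    then have "\<bar>F x - c p\<bar> \<le> \<alpha> p" "\<bar>F x - c q\<bar> \<le> \<alpha> q" using sub by (auto simp: E_def)
    then show ?thesis using s qq sub by auto
  qed
  have half: "emeasure lebesgue U \<le> ennreal (1 / 2) * emeasure lebesgue (hc p)"
  proof -
    have "ennreal \<theta> * emeasure lebesgue U = (\<integral>\<^sup>+q. ennreal \<theta> * emeasure lebesgue (hc q) \<partial>count_space C)"
      unfolding U_def using C(1) dis by (subst emeasure_UN_countable) (auto simp: nn_integral_cmult)
    also have "\<dots> \<le> (\<integral>\<^sup>+q. emeasure lebesgue (hc q \<inter> E p) \<partial>count_space C)"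
    proof (rule nn_integral_mono)
      fix q assume "q \<in> space (count_space C)"
      then have "P (fst q) (snd q)" using CP[of "fst q" "snd q"] by simp
      then show "ennreal \<theta> * emeasure lebesgue (hc q) \<le> emeasure lebesgue (hc q \<inter> E p)"
        by (simp add: P_def less_imp_le)
    qed
    also have "\<dots> = emeasure lebesgue (\<Union>q\<in>C. hc q \<inter> E p)"
    proof (intro emeasure_UN_countable[symmetric] C(1))
      show "disjoint_family_on (\<lambda>q. hc q \<inter> E p) C" using dis unfolding disjoint_family_on_def by blast
    qed auto
    also have "\<dots> \<le> emeasure lebesgue (E p)" by (intro emeasure_mono) auto
    also have "\<dots> \<le> ennreal (\<theta> / 2) * emeasure lebesgue (hc p)" by (rule E4[OF p])
    finally have "ennreal (1 / \<theta>) * (ennreal \<theta> * emeasure lebesgue U)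
        \<le> ennreal (1 / \<theta>) * (ennreal (\<theta> / 2) * emeasure lebesgue (hc p))"
      by (intro mult_left_mono) auto
    moreover have "ennreal (1 / \<theta>) * ennreal \<theta> = 1" "ennreal (1 / \<theta>) * ennreal (\<theta> / 2) = ennreal (1 / 2)"
      using \<theta> by (subst ennreal_mult[symmetric]; simp)+
    ultimately show ?thesis by (simp only: mult.assoc[symmetric] mult_1_left)
  qed
  have "AE x in lebesgue. x \<in> hc p - U \<longrightarrow> \<bar>F x - c p\<bar> \<le> \<alpha> p"
  proof -
    have m: "E p - U \<in> sets lebesgue" by measurable
    have "emeasure lebesgue (E p - U) = 0"
    proof (rule null_if_density_le[OF p m, where a="fst p" and \<theta>=\<theta>])
      fix x j assume x: "x \<in> E p - U"
      let ?c = "cell (fst p) (snd p) j x"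
      have "\<not> P (corner (fst p) (snd p) j x) (snd p / 2 ^ j)" using x by (auto simp: E_def Ueq)
      then have "emeasure lebesgue (?c \<inter> E p) \<le> ennreal \<theta> * emeasure lebesgue ?c"
        by (simp add: P_def not_less)
      then show "emeasure lebesgue (?c \<inter> (E p - U)) \<le> ennreal \<theta> * emeasure lebesgue ?c"
        by (rule order_trans[rotated]) (intro emeasure_mono, auto)
    qed (use \<theta> in \<open>auto simp: E_def\<close>)
    then have "AE x in lebesgue. x \<notin> E p - U" using m by (intro AE_not_in null_setsI)
    then show ?thesis by eventually_elim (auto simp: E_def)
  qed
  moreover have "\<forall>q\<in>C. snd q > 0 \<and> hc q \<subseteq> hc p \<and> \<bar>c q - c p\<bar> \<le> \<alpha> p + \<alpha> q" using q by blast
  ultimately show ?thesis using C(1) dis half unfolding U_def by (intro exI[of _ C] conjI)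
qed

text \<open>\<open>H\<close> abstracts a multiple of \<open>v * M g\<close>: its values on a cube
  dominate \<open>\<alpha>\<close> times the average of \<open>g\<close>. Changing constants from
  parent to child along the stopping tree costs terms \<open>\<alpha> q * \<integral> g\<close>, and
  each is charged to the part of a cube not covered by its children. These parts are disjoint, so
  the total is a multiple of \<open>\<integral> H\<close>, however many generations occur.\<close>

lemma oscillation_iteration:
  fixes F :: "real^'n \<Rightarrow> real" and c \<alpha> :: "(real^'n) \<times> real \<Rightarrow> real" and g H :: "real^'n \<Rightarrow> ennreal"
  assumes Fm[measurable]: "F \<in> borel_measurable lebesgue" and [measurable]: "g \<in> borel_measurable lebesgue"
    "H \<in> borel_measurable lebesgue"
    and \<alpha>: "\<And>p. \<alpha> p \<ge> 0"
    and osc: "\<And>p. snd p > 0 \<Longrightarrow> emeasure lebesgue {x \<in> hc p. \<bar>F x - c p\<bar> > \<alpha> p}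
      \<le> ennreal (1 / (4 * 2 ^ CARD('n))) * emeasure lebesgue (hc p)"
    and H: "\<And>p x. snd p > 0 \<Longrightarrow> x \<in> hc p \<Longrightarrow>
      ennreal (\<alpha> p) * (\<integral>\<^sup>+y\<in>hc p. g y \<partial>lebesgue) \<le> H x * emeasure lebesgue (hc p)"
    and p: "snd p > 0"
  shows "(\<integral>\<^sup>+x\<in>hc p. ennreal \<bar>F x - c p\<bar> * g x \<partial>lebesgue) \<le> 4 * (\<integral>\<^sup>+x\<in>hc p. H x \<partial>lebesgue)"
proof -
  define good where "good p C \<longleftrightarrow> countable C \<and> disjoint_family_on hc C \<and>
    (\<forall>q\<in>C. snd q > 0 \<and> hc q \<subseteq> hc p \<and> \<bar>c q - c p\<bar> \<le> \<alpha> p + \<alpha> q) \<and>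
    emeasure lebesgue (\<Union>q\<in>C. hc q) \<le> ennreal (1 / 2) * emeasure lebesgue (hc p) \<and>
    (AE x in lebesgue. x \<in> hc p - (\<Union>q\<in>C. hc q) \<longrightarrow> \<bar>F x - c p\<bar> \<le> \<alpha> p)" for p C
  have "\<exists>C. good p C" if "snd p > 0" for p
    unfolding good_def by (rule oscillation_children[OF Fm osc that])
  then obtain ch where ch: "\<And>p. snd p > 0 \<Longrightarrow> good p (ch p)" by metis
  have ch1: "countable (ch p)" "disjoint_family_on hc (ch p)" and ch2: "q \<in> ch p \<Longrightarrow> snd q > 0 \<and> hc q \<subseteq> hc p"
    and ch3: "q \<in> ch p \<Longrightarrow> \<bar>c q - c p\<bar> \<le> \<alpha> p + \<alpha> q"
    and ch4: "emeasure lebesgue (\<Union>q\<in>ch p. hc q) \<le> ennreal (1 / 2) * emeasure lebesgue (hc p)"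
    and ch5: "AE x in lebesgue. x \<in> hc p - (\<Union>q\<in>ch p. hc q) \<longrightarrow> \<bar>F x - c p\<bar> \<le> \<alpha> p"
    if "snd p > 0" for p q
    using ch[OF that] unfolding good_def by blast+
  define \<Omega> where "\<Omega> = generation ch (hc :: (real^'n) \<times> real \<Rightarrow> (real^'n) set)"
  have \<Omega>_simps: "\<Omega> 0 p = hc p" "\<Omega> (Suc k) p = (\<Union>q\<in>ch p. \<Omega> k q)" for k p by (simp_all add: \<Omega>_def)
  have \<Omega>m: "\<Omega> k p \<in> sets lebesgue \<and> \<Omega> k p \<subseteq> hc p" if "snd p > 0" for k p
    using that
  proof (induction k arbitrary: p)
    case (Suc k)
    have "\<Omega> k q \<in> sets lebesgue \<and> \<Omega> k q \<subseteq> hc p" if "q \<in> ch p" for q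
      using Suc.IH[of q] ch2[OF Suc.prems that] by auto
    then show ?case unfolding \<Omega>_simps using ch1[OF Suc.prems] by (intro conjI sets.countable_UN') auto
  qed (simp add: \<Omega>_simps)
  have \<Omega>_dec: "\<Omega> (Suc k) p \<subseteq> \<Omega> k p" if "snd p > 0" for k p
    using that
  proof (induction k arbitrary: p)
    case 0 then show ?case using ch2[of p] unfolding \<Omega>_simps by blast
  next
    case (Suc k)
    then have "\<Omega> (Suc k) q \<subseteq> \<Omega> k q" if "q \<in> ch p" for q using ch2[OF Suc.prems that] by auto
    then show ?case unfolding \<Omega>_simps(2)[of "Suc k" p] \<Omega>_simps(2)[of k p] by blast
  qed
  have \<Omega>_small: "emeasure lebesgue (\<Omega> k p) \<le> ennreal ((1 / 2) ^ k) * emeasure lebesgue (hc p)"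
      if "snd p > 0" for k p
    using that
  proof (induction k arbitrary: p)
    case 0 then show ?case by (simp add: \<Omega>_simps)
  next
    case (Suc k)
    have dis: "disjoint_family_on (\<Omega> k) (ch p)"
      using ch1(2)[OF Suc.prems] \<Omega>m ch2[OF Suc.prems] unfolding disjoint_family_on_def by blast
    have "emeasure lebesgue (\<Omega> (Suc k) p) = (\<integral>\<^sup>+q. emeasure lebesgue (\<Omega> k q) \<partial>count_space (ch p))"
      unfolding \<Omega>_simps using ch1[OF Suc.prems] ch2[OF Suc.prems] \<Omega>m dis
      by (intro emeasure_UN_countable) auto
    also have "\<dots> \<le> (\<integral>\<^sup>+q. ennreal ((1 / 2) ^ k) * emeasure lebesgue (hc q) \<partial>count_space (ch p))"
      using Suc.IH ch2[OF Suc.prems] by (intro nn_integral_mono) (metis space_count_space)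
    also have "\<dots> = ennreal ((1 / 2) ^ k) * emeasure lebesgue (\<Union>q\<in>ch p. hc q)"
      using ch1[OF Suc.prems] by (subst emeasure_UN_countable) (auto simp: nn_integral_cmult)
    also have "\<dots> \<le> ennreal ((1 / 2) ^ k) * (ennreal (1 / 2) * emeasure lebesgue (hc p))"
      by (intro mult_left_mono ch4[OF Suc.prems]) auto
    also have "\<dots> = ennreal ((1 / 2) ^ Suc k) * emeasure lebesgue (hc p)"
      unfolding mult.assoc[symmetric] by (subst ennreal_mult[symmetric]) (auto simp: mult.commute)
    finally show ?case .
  qed
  let ?D = "\<lambda>p x. ennreal \<bar>F x - c p\<bar> * g x"
  \<comment> \<open>The summand \<open>\<alpha> p * \<integral> g\<close> pays for the change of constants \<open>\<bar>c q - c p\<bar> \<le> \<alpha> p + \<alpha> q\<close> when \<open>q\<close> is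
    a child of \<open>p\<close>, and is itself at most \<open>2 * \<integral> H\<close> over the part of \<open>hc p\<close> without the children.\<close>
  have step: "(\<integral>\<^sup>+x\<in>hc p - \<Omega> k p. ?D p x \<partial>lebesgue) + ennreal (\<alpha> p) * (\<integral>\<^sup>+x\<in>hc p. g x \<partial>lebesgue)
      \<le> 4 * (\<integral>\<^sup>+x\<in>hc p. H x \<partial>lebesgue)" if "snd p > 0" for k p
    using that
  proof (induction k arbitrary: p)
    case (0 p)
    let ?K = "ennreal (\<alpha> p) * (\<integral>\<^sup>+x\<in>hc p. g x \<partial>lebesgue)"
    let ?L = "ennreal (snd p ^ CARD('n))"
    have L: "snd p ^ CARD('n) > 0" using 0 by simp
    have "?K * ?L = (\<integral>\<^sup>+x\<in>hc p. ?K \<partial>lebesgue)" using 0 by (rule nn_integral_const_hcube[symmetric])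
    also have "\<dots> \<le> (\<integral>\<^sup>+x\<in>hc p. H x * ?L \<partial>lebesgue)"
      using H[OF 0] unfolding emeasure_hc[OF 0] by (intro nn_integral_mono) (auto split: split_indicator)
    also have "\<dots> = (\<integral>\<^sup>+x\<in>hc p. H x \<partial>lebesgue) * ?L"
      by (subst nn_integral_multc[symmetric]) (auto simp: mult_ac)
    finally have "?K \<le> (\<integral>\<^sup>+x\<in>hc p. H x \<partial>lebesgue)"
      by (rule ennreal_mult_right_cancel_le[OF L])
    also have "\<dots> \<le> 4 * (\<integral>\<^sup>+x\<in>hc p. H x \<partial>lebesgue)"
      using mult_right_mono[of 1 4 "\<integral>\<^sup>+x\<in>hc p. H x \<partial>lebesgue"] by simp
    finally show ?case by (simp add: \<Omega>_simps)
  next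
    case (Suc k p)
    note p = Suc.prems
    define U where "U = (\<Union>q\<in>ch p. hc q)"
    have Um[measurable]: "U \<in> sets lebesgue" unfolding U_def using ch1[OF p]
      by (intro sets.countable_UN') auto
    have Usub: "U \<subseteq> hc p" unfolding U_def using ch2[OF p] by blast
    define W where "W = (\<Union>q\<in>ch p. hc q - \<Omega> k q)"
    have Wm1: "hc q - \<Omega> k q \<in> sets lebesgue" if "q \<in> ch p" for q using \<Omega>m[of q k] ch2[OF p that]
      by (intro sets.Diff) auto
    have Wm[measurable]: "W \<in> sets lebesgue" unfolding W_def using ch1[OF p] Wm1
      by (intro sets.countable_UN') auto
    have Wdis: "disjoint_family_on (\<lambda>q. hc q - \<Omega> k q) (ch p)"
      using ch1(2)[OF p] unfolding disjoint_family_on_def by blast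
    let ?K = "ennreal (\<alpha> p) * (\<integral>\<^sup>+x\<in>hc p. g x \<partial>lebesgue)"
    let ?L = "ennreal (snd p ^ CARD('n))"
    have L: "snd p ^ CARD('n) > 0" using p by simp
    have split: "(\<integral>\<^sup>+x\<in>hc p. h x \<partial>lebesgue) = (\<integral>\<^sup>+x\<in>hc p - U. h x \<partial>lebesgue) + (\<integral>\<^sup>+x\<in>U. h x \<partial>lebesgue)"
      if [measurable]: "h \<in> borel_measurable lebesgue" for h
      using Usub by (subst nn_integral_add[symmetric])
          (auto intro!: nn_integral_cong split: split_indicator)
    have sumU: "(\<integral>\<^sup>+x\<in>U. h x \<partial>lebesgue) = (\<integral>\<^sup>+q. (\<integral>\<^sup>+x\<in>hc q. h x \<partial>lebesgue) \<partial>count_space (ch p))"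
      if "h \<in> borel_measurable lebesgue" for h
      unfolding U_def using ch1[OF p] that by (intro nn_integral_countable_disjoint_UN) auto
    have "(\<integral>\<^sup>+x\<in>hc p - \<Omega> (Suc k) p. ?D p x \<partial>lebesgue) \<le>
        (\<integral>\<^sup>+x. ?D p x * indicator (hc p - U) x + ?D p x * indicator W x \<partial>lebesgue)"
      by (intro nn_integral_mono) (auto simp: \<Omega>_simps U_def W_def split: split_indicator)
    also have "\<dots> = (\<integral>\<^sup>+x\<in>hc p - U. ?D p x \<partial>lebesgue) + (\<integral>\<^sup>+x\<in>W. ?D p x \<partial>lebesgue)"
      by (intro nn_integral_add) measurable
    also have "(\<integral>\<^sup>+x\<in>hc p - U. ?D p x \<partial>lebesgue)
        \<le> (\<integral>\<^sup>+x. ennreal (\<alpha> p) * (g x * indicator (hc p - U) x) \<partial>lebesgue)"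
      using ch5[OF p] unfolding U_def[symmetric]
      by (intro nn_integral_mono_AE)
          (auto elim!: eventually_mono split: split_indicator intro!: mult_right_mono ennreal_leI)
    also have "\<dots> = ennreal (\<alpha> p) * (\<integral>\<^sup>+x\<in>hc p - U. g x \<partial>lebesgue)"
      by (intro nn_integral_cmult) measurable
    also have "(\<integral>\<^sup>+x\<in>W. ?D p x \<partial>lebesgue)
        = (\<integral>\<^sup>+q. (\<integral>\<^sup>+x\<in>hc q - \<Omega> k q. ?D p x \<partial>lebesgue) \<partial>count_space (ch p))"
      unfolding W_def using ch1[OF p] Wdis Wm1 by (intro nn_integral_countable_disjoint_UN) auto
    also have "\<dots> \<le> (\<integral>\<^sup>+q. 4 * (\<integral>\<^sup>+x\<in>hc q. H x \<partial>lebesgue) + ennreal (\<alpha> p) *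
        (\<integral>\<^sup>+x\<in>hc q. g x \<partial>lebesgue) \<partial>count_space (ch p))"
    proof (rule nn_integral_mono)
      fix q assume "q \<in> space (count_space (ch p))"
      then have q: "q \<in> ch p" by simp
      note qp = ch2[OF p q]
      have [measurable]: "hc q - \<Omega> k q \<in> sets lebesgue" by (rule Wm1[OF q])
      have "(\<integral>\<^sup>+x\<in>hc q - \<Omega> k q. ?D p x \<partial>lebesgue) \<le>
          (\<integral>\<^sup>+x. ?D q x * indicator (hc q - \<Omega> k q) x + (ennreal (\<alpha> q) + ennreal (\<alpha> p)) *
              (g x * indicator (hc q) x) \<partial>lebesgue)"
      proof (rule nn_integral_mono)
        fix x
        have "\<bar>F x - c p\<bar> \<le> \<bar>F x - c q\<bar> + (\<alpha> q + \<alpha> p)" using ch3[OF p q] by linarith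
        then have "ennreal \<bar>F x - c p\<bar> \<le> ennreal (\<bar>F x - c q\<bar> + (\<alpha> q + \<alpha> p))" by (rule ennreal_leI)
        also have "\<dots> = ennreal \<bar>F x - c q\<bar> + (ennreal (\<alpha> q) + ennreal (\<alpha> p))" using \<alpha>
          by (simp add: ennreal_plus)
        finally have "?D p x \<le> (ennreal \<bar>F x - c q\<bar> + (ennreal (\<alpha> q) + ennreal (\<alpha> p))) * g x"
          by (intro mult_right_mono) auto
        then show "?D p x * indicator (hc q - \<Omega> k q) x \<le>
           ?D q x * indicator (hc q - \<Omega> k q) x + (ennreal (\<alpha> q) + ennreal (\<alpha> p)) *
               (g x * indicator (hc q) x)"
          by (auto simp: distrib_right split: split_indicator)
      qed
      also have "\<dots> = (\<integral>\<^sup>+x\<in>hc q - \<Omega> k q. ?D q x \<partial>lebesgue) + (ennreal (\<alpha> q) + ennreal (\<alpha> p)) *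
          (\<integral>\<^sup>+x\<in>hc q. g x \<partial>lebesgue)"
        by (subst nn_integral_add) (auto simp: nn_integral_cmult)
      also have "\<dots> = ((\<integral>\<^sup>+x\<in>hc q - \<Omega> k q. ?D q x \<partial>lebesgue) + ennreal (\<alpha> q) * (\<integral>\<^sup>+x\<in>hc q. g x \<partial>lebesgue))
          + ennreal (\<alpha> p) * (\<integral>\<^sup>+x\<in>hc q. g x \<partial>lebesgue)"
        by (simp add: distrib_right add.assoc)
      also have "\<dots> \<le> 4 * (\<integral>\<^sup>+x\<in>hc q. H x \<partial>lebesgue) + ennreal (\<alpha> p) * (\<integral>\<^sup>+x\<in>hc q. g x \<partial>lebesgue)"
        using Suc.IH[of q] qp by (intro add_right_mono) auto
      finally show "(\<integral>\<^sup>+x\<in>hc q - \<Omega> k q. ?D p x \<partial>lebesgue) \<le>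
        4 * (\<integral>\<^sup>+x\<in>hc q. H x \<partial>lebesgue) + ennreal (\<alpha> p) * (\<integral>\<^sup>+x\<in>hc q. g x \<partial>lebesgue)" .
    qed
    also have "\<dots> = 4 * (\<integral>\<^sup>+x\<in>U. H x \<partial>lebesgue) + ennreal (\<alpha> p) * (\<integral>\<^sup>+x\<in>U. g x \<partial>lebesgue)"
      by (subst nn_integral_add) (auto simp: nn_integral_cmult sumU)
    finally have "(\<integral>\<^sup>+x\<in>hc p - \<Omega> (Suc k) p. ?D p x \<partial>lebesgue)
        \<le> ennreal (\<alpha> p) * (\<integral>\<^sup>+x\<in>hc p - U. g x \<partial>lebesgue) +
       (4 * (\<integral>\<^sup>+x\<in>U. H x \<partial>lebesgue) + ennreal (\<alpha> p) * (\<integral>\<^sup>+x\<in>U. g x \<partial>lebesgue))"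
      by (simp add: add_mono)
    also have "\<dots> = ?K + 4 * (\<integral>\<^sup>+x\<in>U. H x \<partial>lebesgue)"
      by (subst split[of g]) (auto simp: distrib_left add_ac)
    finally have main: "(\<integral>\<^sup>+x\<in>hc p - \<Omega> (Suc k) p. ?D p x \<partial>lebesgue) \<le> ?K + 4 * (\<integral>\<^sup>+x\<in>U. H x \<partial>lebesgue)" .
    \<comment> \<open>The children cover at most half of the cube, so integrating the pointwise
      hypothesis on \<open>H\<close> over the remaining half loses only a factor 2.\<close>
    have K: "?K \<le> 2 * (\<integral>\<^sup>+x\<in>hc p - U. H x \<partial>lebesgue)"
    proof -
      have "?L = emeasure lebesgue (hc p)" by (rule emeasure_hc[OF p, symmetric])
      also have "\<dots> = emeasure lebesgue (hc p - U) + emeasure lebesgue U"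
      proof -
        have "(hc p - U) \<union> U = hc p" "(hc p - U) \<inter> U = {}" using Usub by auto
        then show ?thesis using plus_emeasure[of "hc p - U" lebesgue U] by (metis Um sets.Diff sets_hcube)
      qed
      also have "\<dots> \<le> emeasure lebesgue (hc p - U) + ennreal (1 / 2) * ?L"
        using ch4[OF p] unfolding emeasure_hc[OF p] U_def[symmetric] by (intro add_left_mono)
      finally have "?L \<le> emeasure lebesgue (hc p - U) + ennreal (1 / 2) * ?L" .
      moreover have "?L = ennreal (1 / 2) * ?L + ennreal (1 / 2) * ?L"
        unfolding distrib_right[symmetric] by (subst ennreal_plus[symmetric]) (auto simp del: ennreal_plus)
      ultimately have "ennreal (1 / 2) * ?L + ennreal (1 / 2) * ?L
          \<le> ennreal (1 / 2) * ?L + emeasure lebesgue (hc p - U)"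
        by (simp only: add.commute)
      then have half: "ennreal (1 / 2) * ?L \<le> emeasure lebesgue (hc p - U)"
        unfolding ennreal_add_left_cancel_le by (auto simp: ennreal_mult_eq_top_iff)
      have "?K * (ennreal (1 / 2) * ?L) \<le> ?K * emeasure lebesgue (hc p - U)"
        using half by (rule mult_left_mono) simp
      also have "\<dots> = (\<integral>\<^sup>+x\<in>hc p - U. ?K \<partial>lebesgue)" by (subst nn_integral_cmult_indicator) auto
      also have "\<dots> \<le> (\<integral>\<^sup>+x\<in>hc p - U. H x * ?L \<partial>lebesgue)"
        using H[OF p] unfolding emeasure_hc[OF p] by (intro nn_integral_mono) (auto split: split_indicator)
      also have "\<dots> = (\<integral>\<^sup>+x\<in>hc p - U. H x \<partial>lebesgue) * ?L"
        by (subst nn_integral_multc[symmetric]) (auto simp: mult_ac)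
      finally have "(?K * ennreal (1 / 2)) * ?L \<le> (\<integral>\<^sup>+x\<in>hc p - U. H x \<partial>lebesgue) * ?L"
        by (simp add: mult.assoc)
      then have "?K * ennreal (1 / 2) \<le> (\<integral>\<^sup>+x\<in>hc p - U. H x \<partial>lebesgue)"
        by (rule ennreal_mult_right_cancel_le[OF L])
      then have "(?K * ennreal (1 / 2)) * 2 \<le> (\<integral>\<^sup>+x\<in>hc p - U. H x \<partial>lebesgue) * 2"
        by (rule mult_right_mono) simp
      moreover have "(y * ennreal (1 / 2)) * 2 = y" for y :: ennreal
        using ennreal_mult[of "1/2" 2] by (simp add: mult.assoc)
      ultimately show ?thesis by (simp only: mult.commute[of _ 2])
    qed
    \<comment> \<open>This fixes the constant 4: \<open>?K\<close> occurs once from the estimate and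
      once as the reserve carried by the induction, and each copy costs
      \<open>2 * \<integral> H\<close> off the children.\<close>
    have "(\<integral>\<^sup>+x\<in>hc p - \<Omega> (Suc k) p. ?D p x \<partial>lebesgue) + ?K \<le> (?K + 4 * (\<integral>\<^sup>+x\<in>U. H x \<partial>lebesgue)) + ?K"
      using main by (rule add_right_mono)
    also have "\<dots> \<le> (2 * (\<integral>\<^sup>+x\<in>hc p - U. H x \<partial>lebesgue) + 4 * (\<integral>\<^sup>+x\<in>U. H x \<partial>lebesgue)) + 2 *
        (\<integral>\<^sup>+x\<in>hc p - U. H x \<partial>lebesgue)"
      by (intro add_mono K order_refl)
    also have "\<dots> = 4 * (\<integral>\<^sup>+x\<in>hc p. H x \<partial>lebesgue)"
    proof -
      have "2 * a + 4 * b + 2 * a = 4 * (a + b)" for a b :: ennreal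
        by (simp add: distrib_left add_ac flip: distrib_right)
      then show ?thesis by (subst split[of H]) auto
    qed
    finally show ?case .
  qed
  \<comment> \<open>Points that belong to a descendant in every generation. The generations shrink
    geometrically in measure, so this set is null and monotone convergence recovers the whole
    cube.\<close>
  define N where "N = (\<Inter>k. \<Omega> k p)"
  have Nm[measurable]: "N \<in> sets lebesgue" unfolding N_def using \<Omega>m[OF p] by auto
  have [measurable]: "\<Omega> k p \<in> sets lebesgue" for k using \<Omega>m[OF p] by auto
  have "emeasure lebesgue N \<le> ennreal ((1 / 2) ^ k * snd p ^ CARD('n))" for k
  proof -
    have "emeasure lebesgue N \<le> emeasure lebesgue (\<Omega> k p)" by (intro emeasure_mono) (auto simp: N_def)
    also have "\<dots> \<le> ennreal ((1 / 2) ^ k) * emeasure lebesgue (hc p)" by (rule \<Omega>_small[OF p])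
    finally show ?thesis unfolding emeasure_hc[OF p] using p by (subst ennreal_mult) auto
  qed
  moreover have "(\<lambda>k. ennreal ((1 / 2) ^ k * snd p ^ CARD('n))) \<longlonglongrightarrow> ennreal (0 * snd p ^ CARD('n))"
    by (intro tendsto_ennrealI tendsto_intros LIMSEQ_power_zero) auto
  ultimately have "emeasure lebesgue N \<le> ennreal (0 * snd p ^ CARD('n))"
    by (intro LIMSEQ_le_const[of "\<lambda>k. ennreal ((1 / 2) ^ k * snd p ^ CARD('n))"]) auto
  then have N0: "AE x in lebesgue. x \<notin> N" by (intro AE_not_in null_setsI) auto
  have "(\<integral>\<^sup>+x\<in>hc p. ?D p x \<partial>lebesgue) = (\<integral>\<^sup>+x. (SUP k. ?D p x * indicator (hc p - \<Omega> k p) x) \<partial>lebesgue)"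
    using N0
  proof (intro nn_integral_cong_AE, eventually_elim)
    case (elim x)
    then obtain k where k: "x \<notin> \<Omega> k p" by (auto simp: N_def)
    have "(SUP k. ?D p x * indicator (hc p - \<Omega> k p) x) = ?D p x * indicator (hc p) x"
    proof (rule antisym)
      show "(SUP k. ?D p x * indicator (hc p - \<Omega> k p) x) \<le> ?D p x * indicator (hc p) x"
        by (intro SUP_least) (auto split: split_indicator)
      show "?D p x * indicator (hc p) x \<le> (SUP k. ?D p x * indicator (hc p - \<Omega> k p) x)"
        using k by (intro SUP_upper2[of k]) (auto split: split_indicator)
    qed
    then show ?case by simp
  qed
  also have "\<dots> = (SUP k. \<integral>\<^sup>+x\<in>hc p - \<Omega> k p. ?D p x \<partial>lebesgue)"
  proof (rule nn_integral_monotone_convergence_SUP)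
    show "incseq (\<lambda>k x. ?D p x * indicator (hc p - \<Omega> k p) x)"
      using \<Omega>_dec[OF p] by (intro incseq_SucI le_funI) (auto split: split_indicator)
  qed measurable
  also have "\<dots> \<le> 4 * (\<integral>\<^sup>+x\<in>hc p. H x \<partial>lebesgue)"
  proof (rule SUP_least)
    fix k
    have "(\<integral>\<^sup>+x\<in>hc p - \<Omega> k p. ?D p x \<partial>lebesgue) \<le>
      (\<integral>\<^sup>+x\<in>hc p - \<Omega> k p. ?D p x \<partial>lebesgue) + ennreal (\<alpha> p) * (\<integral>\<^sup>+x\<in>hc p. g x \<partial>lebesgue)" by simp
    also have "\<dots> \<le> 4 * (\<integral>\<^sup>+x\<in>hc p. H x \<partial>lebesgue)" by (rule step[OF p])
    finally show "(\<integral>\<^sup>+x\<in>hc p - \<Omega> k p. ?D p x \<partial>lebesgue) \<le> 4 * (\<integral>\<^sup>+x\<in>hc p. H x \<partial>lebesgue)" .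
  qed
  finally show ?thesis .
qed

section \<open>Kernel estimates\<close>

text \<open>The complement of the support is a union of uncountably many open sets. A countable
  subfamily has the same union by Lindelof, and countably many null sets may be discarded
  together.\<close>

lemma AE_outside_ess_supp: "AE x in lebesgue. x \<notin> ess_supp f \<longrightarrow> f x = 0"
proof -
  let ?\<F> = "{U. open U \<and> (AE x in lebesgue. x \<in> U \<longrightarrow> f x = 0)}"
  obtain \<G> where G: "\<G> \<subseteq> ?\<F>" "countable \<G>" "\<Union>\<G> = \<Union>?\<F>"
    by (rule Lindelof[of ?\<F>]) auto
  have "AE x in lebesgue. \<forall>U\<in>\<G>. x \<in> U \<longrightarrow> f x = 0"
    using G(1) by (subst AE_ball_countable[OF G(2)]) blast
  then show ?thesis
  proof eventually_elim
    case (elim x)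
    have "x \<notin> ess_supp f \<longleftrightarrow> x \<in> \<Union>\<G>" unfolding G(3) ess_supp_def by blast
    with elim show ?case by auto
  qed
qed

lemma ess_supp_subset:
  assumes "closed S" "AE x in lebesgue. x \<notin> S \<longrightarrow> f x = 0"
  shows "ess_supp f \<subseteq> S"
  unfolding ess_supp_def using assms open_Compl[OF assms(1)] by auto

text \<open>Domination by a multiple of the indicator of a ball is easier to propagate than
  compactness of the essential support; the closure properties of \<open>Linf0\<close> go through
  this form.\<close>

lemma Linf0_iff:
  "f \<in> Linf0 \<longleftrightarrow> f \<in> borel_measurable lebesgue \<and>
    (\<exists>M R. M \<ge> 0 \<and> (AE x in lebesgue. cmod (f x) \<le> M * indicator (cball 0 R) x))"
  for f :: "real^'n \<Rightarrow> complex"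
proof (intro iffI conjI)
  assume f: "f \<in> Linf0"
  then obtain B where B: "AE x in lebesgue. cmod (f x) \<le> B" and K: "compact (ess_supp f)"
    by (auto simp: Linf0_def)
  obtain R where R: "ess_supp f \<subseteq> cball 0 R"
    using compact_imp_bounded[OF K] unfolding bounded_iff by (auto simp: subset_eq)
  have "AE x in lebesgue. cmod (f x) \<le> max B 0 * indicator (cball 0 R) x"
    using B AE_outside_ess_supp[of f] by eventually_elim (use R in \<open>auto split: split_indicator\<close>)
  then show "\<exists>M R. M \<ge> 0 \<and> (AE x in lebesgue. cmod (f x) \<le> M * indicator (cball 0 R) x)"
    by (intro exI[of _ "max B 0"] exI[of _ R]) auto
next
  assume f: "f \<in> borel_measurable lebesgue \<and>
    (\<exists>M R. M \<ge> 0 \<and> (AE x in lebesgue. cmod (f x) \<le> M * indicator (cball 0 R) x))"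
  then obtain M R where M: "M \<ge> 0" and ae: "AE x in lebesgue. cmod (f x)
      \<le> M * indicator (cball 0 R) x" by auto
  have "AE x in lebesgue. x \<notin> cball 0 R \<longrightarrow> f x = 0" using ae by (auto elim!: eventually_mono)
  then have "ess_supp f \<subseteq> cball 0 R" by (intro ess_supp_subset) auto
  moreover have "closed (ess_supp f)" unfolding ess_supp_def by (intro closed_Compl open_Union) auto
  ultimately have "compact (ess_supp f)" by (meson compact_cball compact_eq_bounded_closed bounded_subset)
  moreover have "AE x in lebesgue. cmod (f x) \<le> M"
    using ae by eventually_elim (use M in \<open>auto split: split_indicator_asm\<close>)
  ultimately show "f \<in> Linf0" using f by (auto simp: Linf0_def)
qed (auto simp: Linf0_def)

section \<open>Closure properties of bounded functions with compact support\<close>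

lemma Linf0_measurable: "f \<in> Linf0 \<Longrightarrow> f \<in> borel_measurable lebesgue"
  by (simp add: Linf0_def)

lemma Linf0_dominated:
  assumes "f \<in> Linf0" "h \<in> borel_measurable lebesgue" "AE x in lebesgue. cmod (h x) \<le> C * cmod (f x)"
  shows "h \<in> Linf0"
proof -
  obtain M R where M: "M \<ge> 0" "AE x in lebesgue. cmod (f x) \<le> M * indicator (cball 0 R) x"
    using assms(1) unfolding Linf0_iff by auto
  have "AE x in lebesgue. cmod (h x) \<le> (max C 0 * M) * indicator (cball 0 R) x"
    using assms(3) M(2)
  proof eventually_elim
    case (elim x)
    have "cmod (h x) \<le> max C 0 * cmod (f x)" using elim(1) by (smt (verit) mult_right_mono norm_ge_zero)
    also have "\<dots> \<le> max C 0 * (M * indicator (cball 0 R) x)" using elim(2) by (intro mult_left_mono) auto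
    finally show ?case by (simp add: mult.assoc)
  qed
  then show ?thesis unfolding Linf0_iff using assms(2) M(1)
    by (intro conjI exI[of _ "max C 0 * M"] exI[of _ R]) auto
qed

lemma Linf0_add:
  assumes f: "f \<in> Linf0" and g: "g \<in> Linf0"
  shows "(\<lambda>x. f x + g x) \<in> Linf0"
proof -
  obtain M R where M: "M \<ge> 0" "AE x in lebesgue. cmod (f x) \<le> M * indicator (cball 0 R) x"
    using f unfolding Linf0_iff by auto
  obtain M' R' where M': "M' \<ge> 0" "AE x in lebesgue. cmod (g x) \<le> M' * indicator (cball 0 R') x"
    using g unfolding Linf0_iff by auto
  have "AE x in lebesgue. cmod (f x + g x) \<le> (M + M') * indicator (cball 0 (max R R')) x"
    using M(2) M'(2)
  proof eventually_elim
    case (elim x)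
    have "cmod (f x + g x) \<le> cmod (f x) + cmod (g x)" by (rule norm_triangle_ineq)
    also have "\<dots> \<le> (M + M') * indicator (cball 0 (max R R')) x"
      using elim M(1) M'(1) by (auto split: split_indicator split_indicator_asm)
    finally show ?case .
  qed
  then show ?thesis unfolding Linf0_iff using Linf0_measurable[OF f] Linf0_measurable[OF g] M(1) M'(1)
    by (intro conjI borel_measurable_add exI[of _ "M + M'"] exI[of _ "max R R'"]) auto
qed

lemma Linf0_cmult: "f \<in> Linf0 \<Longrightarrow> (\<lambda>x. c * f x) \<in> Linf0"
  by (rule Linf0_dominated[of f _ "cmod c"])
    (auto simp: norm_mult intro: Linf0_measurable borel_measurable_times)

lemma Linf0_diff: "f \<in> Linf0 \<Longrightarrow> g \<in> Linf0 \<Longrightarrow> (\<lambda>x. f x - g x) \<in> Linf0"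
  using Linf0_add[OF _ Linf0_cmult[of g "- 1"], of f] by simp

lemma Linf0_indicator:
  assumes "f \<in> Linf0" "S \<in> sets lebesgue"
  shows "(\<lambda>x. f x * indicator S x) \<in> Linf0"
  by (rule Linf0_dominated[OF assms(1), of _ 1])
    (use assms in \<open>auto split: split_indicator intro!: borel_measurable_times
        borel_measurable_indicator dest: Linf0_measurable\<close>)

lemma modulation_measurable:
  assumes "f \<in> borel_measurable lebesgue" "\<phi> \<in> borel_measurable lebesgue"
  shows "modulation \<phi> f \<in> borel_measurable lebesgue"
  unfolding modulation_def
  by (intro borel_measurable_times assms(1) measurable_compose[OF assms(2), of
      "\<lambda>t. exp (- \<i> * complex_of_real t)"]
    borel_measurable_continuous_onI continuous_intros)

lemma cmod_modulation: "cmod (modulation \<phi> f x) = cmod (f x)"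
  by (simp add: modulation_def norm_mult)

lemma Linf0_modulation:
  assumes "f \<in> Linf0" "\<phi> \<in> borel_measurable lebesgue"
  shows "modulation \<phi> f \<in> Linf0"
  by (rule Linf0_dominated[OF assms(1), of _ 1])
    (use modulation_measurable[OF Linf0_measurable[OF assms(1)] assms(2)] in \<open>auto simp: cmod_modulation\<close>)

lemma Linf0_powr_finite:
  fixes f :: "real^'n \<Rightarrow> complex"
  assumes f: "f \<in> Linf0" and r: "r > 0"
  shows "(\<integral>\<^sup>+x. ennreal (cmod (f x) powr r) \<partial>lebesgue) < \<infinity>"
proof -
  obtain M R where M: "M \<ge> 0" "AE x in lebesgue. cmod (f x) \<le> M * indicator (cball 0 R) x"
    using f unfolding Linf0_iff by auto
  have "(\<integral>\<^sup>+x. ennreal (cmod (f x) powr r) \<partial>lebesgue)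
      \<le> (\<integral>\<^sup>+x. ennreal (M powr r) * indicator (cball (0::real^'n) R) x \<partial>lebesgue)"
  proof (rule nn_integral_mono_AE)
    show "AE x in lebesgue. ennreal (cmod (f x) powr r) \<le> ennreal (M powr r) * indicator (cball 0 R) x"
      using M(2) by eventually_elim
        (use r in \<open>auto split: split_indicator split_indicator_asm intro!: ennreal_leI powr_mono2\<close>)
  qed
  also have "\<dots> = ennreal (M powr r) * emeasure lebesgue (cball 0 R :: (real^'n) set)"
    by (rule nn_integral_cmult_indicator) auto
  also have "\<dots> < \<infinity>" using emeasure_cball_finite[of "0::real^'n" R] by (simp add: ennreal_mult_less_top)
  finally show ?thesis .
qed

lemma Linf0_Lp: "f \<in> Linf0 \<Longrightarrow> r > 0 \<Longrightarrow> f \<in> Lp r"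
  using Linf0_powr_finite[of f r] Linf0_measurable by (auto simp: Lp_def)

lemma Linf0_bfs:
  fixes f :: "real^'n \<Rightarrow> complex"
  assumes \<rho>: "banach_function_norm \<rho>" and f: "f \<in> Linf0"
  shows "f \<in> bfs \<rho>"
proof -
  obtain M R where M: "M \<ge> 0" "AE x in lebesgue. cmod (f x) \<le> M * indicator (cball 0 R) x"
    using f unfolding Linf0_iff by auto
  have [measurable]: "f \<in> borel_measurable lebesgue" using f by (rule Linf0_measurable)
  have "bfs_norm \<rho> f \<le> \<rho> (\<lambda>x. ennreal M * indicator (cball 0 R) x)"
    unfolding bfs_norm_def
  proof (rule bfn_mono[OF \<rho>])
    show "AE x in lebesgue. ennreal (cmod (f x)) \<le> ennreal M * indicator (cball 0 R) x"
      using M(2) by eventually_elim (auto split: split_indicator intro!: ennreal_leI)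
  qed measurable
  also have "\<dots> = ennreal M * \<rho> (indicator (cball 0 R))"
    using M by (intro bfn_scale[OF \<rho>]) auto
  also have "\<dots> < \<infinity>"
    using bfn_indicator_finite[OF \<rho>, of "cball 0 R"] emeasure_cball_finite
      by (auto simp: ennreal_mult_less_top)
  finally show ?thesis by (simp add: bfs_def)
qed

text \<open>The smoothness condition in the second variable tends to 0 as \<open>y'\<close>
  approaches \<open>y\<close>. Continuity off the pole is the source of measurability of
  \<open>K x\<close>.\<close>

lemma CZ_kernel_continuous:
  assumes "CZ_kernel K"
  shows "continuous_on (- {x}) (K x)"
proof -
  obtain c0 \<tau> where \<tau>: "\<tau> > 0" and K: "\<And>x y y'. norm (x - y) > 2 * norm (y - y') \<Longrightarrow>
           cmod (K x y - K x y') + cmod (K y x - K y' x)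
             \<le> c0 * norm (y - y') powr \<tau> * norm (x - y) powr (- real CARD('a) - \<tau>)"
    using assms by (auto simp: CZ_kernel_def)
  have "isCont (K x) y" if y: "y \<noteq> x" for y
    unfolding continuous_at
  proof (rule LIM_zero_cancel, rule Lim_null_comparison)
    have "((\<lambda>y'. norm (y - y') powr \<tau>) \<longlongrightarrow> norm (y - y) powr \<tau>) (at y)"
      using \<tau> by (intro tendsto_powr2 tendsto_intros) auto
    then have "((\<lambda>y'. c0 * norm (y - y') powr \<tau> * norm (x - y) powr (- real CARD('a) - \<tau>))
      \<longlongrightarrow> c0 * norm (y - y) powr \<tau> * norm (x - y) powr (- real CARD('a) - \<tau>)) (at y)"
      by (intro tendsto_mult tendsto_const)
    then show "((\<lambda>y'. c0 * norm (y - y') powr \<tau> * norm (x - y) powr (- real CARD('a) - \<tau>)) \<longlongrightarrow> 0) (at y)"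
      using \<tau> by simp
    have "((\<lambda>y'. 2 * norm (y - y')) \<longlongrightarrow> 2 * norm (y - y)) (at y)" by (intro tendsto_intros)
    then have "\<forall>\<^sub>F y' in at y. 2 * norm (y - y') < norm (x - y)"
      using y by (intro order_tendstoD) auto
    then show "\<forall>\<^sub>F y' in at y. norm (K x y' - K x y)
        \<le> c0 * norm (y - y') powr \<tau> * norm (x - y) powr (- real CARD('a) - \<tau>)"
    proof eventually_elim
      case (elim y')
      have "norm (K x y' - K x y) = cmod (K x y - K x y')" by (rule norm_minus_commute)
      also have "\<dots> \<le> cmod (K x y - K x y') + cmod (K y x - K y' x)" by simp
      also have "\<dots> \<le> c0 * norm (y - y') powr \<tau> * norm (x - y) powr (- real CARD('a) - \<tau>)" using elim
        by (intro K) simp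
      finally show ?case .
    qed
  qed
  then show ?thesis by (intro continuous_at_imp_continuous_on) auto
qed

text \<open>Since \<open>h\<close> vanishes within distance \<open>d\<close> of \<open>x\<close>,
  the size condition bounds the kernel by \<open>c0 * d powr (- real CARD('n))\<close> wherever
  \<open>h\<close> is nonzero. The kernel is masked at the pole to make the product
  measurable.\<close>

lemma CZ_kernel_integrable:
  fixes h :: "real^'n \<Rightarrow> complex"
  assumes K: "CZ_kernel K" and h: "h \<in> Linf0" and d: "d > 0" and far: "\<And>y. norm (x - y) \<le> d \<Longrightarrow> h y = 0"
  shows "integrable lebesgue (\<lambda>y. K x y * h y)"
    and "\<And>c0. (\<And>y. y \<noteq> x \<Longrightarrow> cmod (K x y) \<le> c0 * norm (x - y) powr (- real CARD('n))) \<Longrightarrow> c0 \<ge> 0 \<Longrightarrow>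
      (\<integral>\<^sup>+y. ennreal (cmod (K x y * h y)) \<partial>lebesgue)
        \<le> ennreal (c0 * d powr (- real CARD('n))) * (\<integral>\<^sup>+y. ennreal (cmod (h y)) \<partial>lebesgue)"
proof -
  have hm[measurable]: "h \<in> borel_measurable lebesgue" using h by (rule Linf0_measurable)
  have "(\<lambda>y. indicator (- {x}) y *\<^sub>R K x y) \<in> borel_measurable borel"
    using CZ_kernel_continuous[OF K, of x] by (intro borel_measurable_continuous_on_indicator) auto
  then have Km[measurable]: "(\<lambda>y. indicator (- {x}) y *\<^sub>R K x y) \<in> borel_measurable lebesgue"
    by (intro measurable_completion) simp
  have eq: "(\<lambda>y. K x y * h y) = (\<lambda>y. (indicator (- {x}) y *\<^sub>R K x y) * h y)"
  proof
    fix y show "K x y * h y = (indicator (- {x}) y *\<^sub>R K x y) * h y"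
      using far[of y] d by (cases "y = x") auto
  qed
  have m: "(\<lambda>y. K x y * h y) \<in> borel_measurable lebesgue" unfolding eq by measurable
  show bound: "(\<integral>\<^sup>+y. ennreal (cmod (K x y * h y)) \<partial>lebesgue)
        \<le> ennreal (c0 * d powr (- real CARD('n))) * (\<integral>\<^sup>+y. ennreal (cmod (h y)) \<partial>lebesgue)"
    if c0: "\<And>y. y \<noteq> x \<Longrightarrow> cmod (K x y) \<le> c0 * norm (x - y) powr (- real CARD('n))" "c0 \<ge> 0" for c0
  proof -
    have "cmod (K x y * h y) \<le> c0 * d powr (- real CARD('n)) * cmod (h y)" for y
    proof (cases "norm (x - y) \<le> d")
      case True then show ?thesis using far[of y] by simp
    next
      case False
      then have "y \<noteq> x" using d by auto
      then have "cmod (K x y) \<le> c0 * norm (x - y) powr (- real CARD('n))" by (rule c0)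
      also have "\<dots> \<le> c0 * d powr (- real CARD('n))" using False d c0(2)
        by (intro mult_left_mono powr_mono2') auto
      finally show ?thesis by (simp add: norm_mult mult_right_mono)
    qed
    then have "(\<integral>\<^sup>+y. ennreal (cmod (K x y * h y)) \<partial>lebesgue)
        \<le> (\<integral>\<^sup>+y. ennreal (c0 * d powr (- real CARD('n))) * ennreal (cmod (h y)) \<partial>lebesgue)"
      using c0(2) by (intro nn_integral_mono) (auto simp: ennreal_mult[symmetric] intro!: ennreal_leI)
    also have "\<dots> = ennreal (c0 * d powr (- real CARD('n))) * (\<integral>\<^sup>+y. ennreal (cmod (h y)) \<partial>lebesgue)"
      by (rule nn_integral_cmult) measurable
    finally show ?thesis .
  qed
  obtain c0 where c0: "c0 > 0" "\<And>y. y \<noteq> x \<Longrightarrow> cmod (K x y) \<le> c0 * norm (x - y) powr (- real CARD('n))"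
    using K unfolding CZ_kernel_def by metis
  have "(\<integral>\<^sup>+y. ennreal (cmod (h y)) \<partial>lebesgue) < \<infinity>" using Linf0_powr_finite[OF h, of 1] by simp
  then have "(\<integral>\<^sup>+y. ennreal (cmod (K x y * h y)) \<partial>lebesgue) < \<infinity>"
    using bound[OF c0(2)] c0(1) by (auto simp: ennreal_mult_less_top intro: order_le_less_trans)
  then show "integrable lebesgue (\<lambda>y. K x y * h y)"
    using m by (intro integrableI_bounded) auto
qed

lemma dyadic_scale:
  fixes s :: real
  assumes "s > 1"
  obtains k :: nat where "2 ^ k < s" "s \<le> 2 ^ Suc k"
proof -
  obtain N where N: "s \<le> 2 ^ N" by (metis less_imp_le one_less_numeral_iff real_arch_pow semiring_norm(76))
  define m where "m = (LEAST m. s \<le> 2 ^ m)"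
  have m: "s \<le> 2 ^ m" unfolding m_def using N by (rule LeastI)
  then obtain k where k: "m = Suc k" using assms by (cases m) auto
  have "\<not> s \<le> 2 ^ k" using not_less_Least[of k "\<lambda>m. s \<le> 2 ^ m"] k by (auto simp: m_def)
  then show thesis using that[of k] m k by simp
qed

text \<open>The far part is split into the dyadic annuli \<open>2 ^ Suc k * \<delta> < norm (y - z) \<le> 2 ^ Suc (Suc k) * \<delta>\<close>.\<close>

lemma kernel_smoothness_integral:
  fixes K :: "real^'n \<Rightarrow> real^'n \<Rightarrow> complex"
  assumes \<tau>: "\<tau> > 0" and c0: "c0 > 0"
    and K: "\<And>x y y'. norm (x - y) > 2 * norm (y - y') \<Longrightarrow>
           cmod (K x y - K x y') + cmod (K y x - K y' x)
             \<le> c0 * norm (y - y') powr \<tau> * norm (x - y) powr (- real CARD('n) - \<tau>)"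
    and [measurable]: "f \<in> borel_measurable lebesgue" and \<delta>: "\<delta> > 0" and x: "norm (x - z) \<le> \<delta>"
        and \<Gamma>: "\<Gamma> \<ge> 0"
    and avg: "\<And>s. s \<ge> \<delta> \<Longrightarrow> (\<integral>\<^sup>+y\<in>cball z s. ennreal (cmod (f y)) \<partial>lebesgue) \<le> ennreal (\<Gamma> * s ^ CARD('n))"
  shows "(\<integral>\<^sup>+y\<in>- cball z (2 * \<delta>). ennreal (cmod (K x y - K z y) * cmod (f y)) \<partial>lebesgue)
    \<le> ennreal (c0 * 2 ^ CARD('n) * (\<Sum>k. (2 powr (- \<tau>)) ^ k) * \<Gamma>)"
proof -
  define q where "q = 2 powr (- \<tau>)"
  have q: "0 < q" "q < 1" using \<tau> by (auto simp: q_def powr_minus field_simps)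
  \<comment> \<open>A bound for the kernel difference on the annulus of index \<open>k\<close>. The
    computation gives \<open>q * a k\<close>; the factor \<open>q < 1\<close> is dropped for a
    simpler constant.\<close>
  define a where "a k = c0 * q ^ k * (1 / (2 ^ Suc k * \<delta>) ^ CARD('n))" for k :: nat
  have a0: "a k \<ge> 0" for k using c0 q \<delta> by (simp add: a_def)
  have pw: "ennreal (cmod (K x y - K z y) * cmod (f y)) * indicator (- cball z (2 * \<delta>)) y \<le>
      (\<Sum>k. ennreal (a k) * (ennreal (cmod (f y)) * indicator (cball z (2 ^ Suc (Suc k) * \<delta>)) y))" for y
  proof (cases "y \<in> cball z (2 * \<delta>)")
    case False
    define s where "s = norm (y - z)"
    have s: "s > 2 * \<delta>" using False by (simp add: s_def dist_norm norm_minus_commute)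
    then have "s / (2 * \<delta>) > 1" using \<delta> by simp
    then obtain k where "2 ^ k < s / (2 * \<delta>)" "s / (2 * \<delta>) \<le> 2 ^ Suc k" by (rule dyadic_scale)
    then have k: "2 ^ Suc k * \<delta> < s" "s \<le> 2 ^ Suc (Suc k) * \<delta>" using \<delta> by (simp_all add: field_simps)
    \<comment> \<open>Smoothness is needed in the first argument. With \<open>y\<close> as base
      point it is the second summand of the kernel condition.\<close>
    have "cmod (K x y - K z y) \<le> cmod (K y z - K y x) + cmod (K z y - K x y)"
      by (simp add: norm_minus_commute)
    also have "\<dots> \<le> c0 * norm (z - x) powr \<tau> * norm (y - z) powr (- real CARD('n) - \<tau>)"
      using s x by (intro K) (simp add: s_def norm_minus_commute)
    also have "\<dots> \<le> c0 * \<delta> powr \<tau> * (2 ^ Suc k * \<delta>) powr (- real CARD('n) - \<tau>)"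
      using x k c0 \<tau> \<delta> unfolding s_def
      by (intro mult_mono powr_mono2 powr_mono2' mult_nonneg_nonneg) (auto simp: norm_minus_commute)
    also have "(2 ^ Suc k * \<delta>) powr (- real CARD('n) - \<tau>)
        = (2 ^ Suc k * \<delta>) powr (- real CARD('n)) * ((2 ^ Suc k) powr (- \<tau>) * \<delta> powr (- \<tau>))"
      using \<delta> by (subst powr_mult[symmetric]) (auto simp: powr_add[symmetric])
    also have "(2 ^ Suc k) powr (- \<tau>) = q ^ Suc k" unfolding q_def by (rule powr_power_commute[symmetric])
    also have "(2 ^ Suc k * \<delta>) powr (- real CARD('n)) = 1 / (2 ^ Suc k * \<delta>) ^ CARD('n)"
      using \<delta> by (simp add: powr_minus powr_realpow divide_inverse)
    also have "c0 * \<delta> powr \<tau> * (1 / (2 ^ Suc k * \<delta>) ^ CARD('n) * (q ^ Suc k * \<delta> powr (- \<tau>))) = q * a k"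
      using \<delta> by (simp add: a_def powr_minus field_simps)
    also have "\<dots> \<le> 1 * a k" using q a0 by (intro mult_right_mono) auto
    finally have "cmod (K x y - K z y) \<le> a k" by simp
    then have "cmod (K x y - K z y) * cmod (f y) \<le> a k * cmod (f y)" by (rule mult_right_mono) simp
    then have "ennreal (cmod (K x y - K z y) * cmod (f y)) * indicator (- cball z (2 * \<delta>)) y \<le>
        ennreal (a k) * (ennreal (cmod (f y)) * indicator (cball z (2 ^ Suc (Suc k) * \<delta>)) y)"
      using False k(2) a0 by (simp add: s_def dist_norm norm_minus_commute ennreal_mult[symmetric]
          ennreal_leI)
    also have "\<dots> \<le> (\<Sum>k. ennreal (a k) *
        (ennreal (cmod (f y)) * indicator (cball z (2 ^ Suc (Suc k) * \<delta>)) y))"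
      using sum_le_suminf[of "\<lambda>k. ennreal (a k) *
          (ennreal (cmod (f y)) * indicator (cball z (2 ^ Suc (Suc k) * \<delta>)) y)" "{k}"] by simp
    finally show ?thesis .
  qed simp
  have "(\<integral>\<^sup>+y\<in>- cball z (2 * \<delta>). ennreal (cmod (K x y - K z y) * cmod (f y)) \<partial>lebesgue) \<le>
      (\<integral>\<^sup>+y. (\<Sum>k. ennreal (a k) * (ennreal (cmod (f y)) * indicator
          (cball z (2 ^ Suc (Suc k) * \<delta>)) y)) \<partial>lebesgue)"
    by (intro nn_integral_mono pw)
  also have "\<dots> = (\<Sum>k. \<integral>\<^sup>+y. ennreal (a k) *
      (ennreal (cmod (f y)) * indicator (cball z (2 ^ Suc (Suc k) * \<delta>)) y) \<partial>lebesgue)"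
    by (intro nn_integral_suminf) measurable
  also have "\<dots> = (\<Sum>k. ennreal (a k) * (\<integral>\<^sup>+y\<in>cball z (2 ^ Suc (Suc k) * \<delta>). ennreal (cmod (f y)) \<partial>lebesgue))"
    by (intro suminf_cong nn_integral_cmult) measurable
  also have "\<dots> \<le> (\<Sum>k. ennreal (c0 * 2 ^ CARD('n) * \<Gamma> * q ^ k))"
  proof (intro suminf_le)
    fix k
    have "1 * \<delta> \<le> 2 ^ Suc (Suc k) * \<delta>" using \<delta> by (intro mult_right_mono one_le_power) auto
    then have "ennreal (a k) * (\<integral>\<^sup>+y\<in>cball z (2 ^ Suc (Suc k) * \<delta>). ennreal (cmod (f y)) \<partial>lebesgue)
        \<le> ennreal (a k) * ennreal (\<Gamma> * (2 ^ Suc (Suc k) * \<delta>) ^ CARD('n))"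
      by (intro mult_left_mono avg) auto
    also have "\<dots> = ennreal (a k * (\<Gamma> * (2 ^ Suc (Suc k) * \<delta>) ^ CARD('n)))"
      using a0 \<Gamma> \<delta> by (intro ennreal_mult[symmetric]) auto
    also have "(2 ^ Suc (Suc k) * \<delta>) ^ CARD('n) = 2 ^ CARD('n) * (2 ^ Suc k * \<delta>) ^ CARD('n)"
      by (subst power_mult_distrib[symmetric]) (simp add: mult.assoc)
    also have "a k * (\<Gamma> * (2 ^ CARD('n) * (2 ^ Suc k * \<delta>) ^ CARD('n))) = c0 * 2 ^ CARD('n) * \<Gamma> * q ^ k"
      using \<delta> by (simp add: a_def)
    finally show "ennreal (a k) * (\<integral>\<^sup>+y\<in>cball z (2 ^ Suc (Suc k) * \<delta>). ennreal (cmod (f y)) \<partial>lebesgue)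
      \<le> ennreal (c0 * 2 ^ CARD('n) * \<Gamma> * q ^ k)" .
  qed auto
  also have "\<dots> = ennreal (\<Sum>k. c0 * 2 ^ CARD('n) * \<Gamma> * q ^ k)"
    using c0 \<Gamma> q by (intro suminf_ennreal2) (auto intro!: summable_mult summable_geometric)
  also have "(\<Sum>k. c0 * 2 ^ CARD('n) * \<Gamma> * q ^ k) = c0 * 2 ^ CARD('n) * \<Gamma> * (\<Sum>k. q ^ k)"
    using q by (intro suminf_mult) (auto intro: summable_geometric)
  finally show ?thesis by (simp add: q_def mult_ac)
qed

section \<open>Oscillation of the maximally modulated operator\<close>

lemma max_modulated_is_ae_SUP:
  fixes T :: "(real^'n \<Rightarrow> complex) \<Rightarrow> real^'n \<Rightarrow> complex"
  assumes T: "CZ_operator T" and \<phi>: "\<forall>\<alpha>\<in>I. \<phi> \<alpha> \<in> borel_measurable lebesgue" and F: "F \<in> Linf0"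
  shows "is_ae_SUP I (\<lambda>\<alpha> x. ennreal (cmod (T (modulation (\<phi> \<alpha>) F) x))) (max_modulated T I \<phi> F)"
  unfolding max_modulated_def
proof (rule ae_SUP_spec)
  fix \<alpha> assume "\<alpha> \<in> I"
  then have "modulation (\<phi> \<alpha>) F \<in> Lp 2" using \<phi> F by (intro Linf0_Lp Linf0_modulation) auto
  then have "T (modulation (\<phi> \<alpha>) F) \<in> Lp 2" using T by (auto simp: CZ_operator_def)
  then have [measurable]: "T (modulation (\<phi> \<alpha>) F) \<in> borel_measurable lebesgue" by (simp add: Lp_def)
  show "(\<lambda>x. ennreal (cmod (T (modulation (\<phi> \<alpha>) F) x))) \<in> borel_measurable lebesgue" by measurable
qed

text \<open>Near \<open>z\<close> each \<open>T\<close> of a modulated \<open>F\<close> is a kernel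
  integral and differs from the same integral at \<open>z\<close> by at most
  \<open>D * \<Gamma>\<close>. This is uniform in the phase, since modulation preserves modulus, so
  it survives the supremum; \<open>c\<close> is the supremum of the moduli at \<open>z\<close>. It
  depends on \<open>F\<close>, \<open>z\<close> and \<open>\<delta>\<close> only, hence one
  \<open>c\<close> serves all \<open>\<Gamma>\<close>.\<close>

lemma max_modulated_oscillation:
  fixes T :: "(real^'n \<Rightarrow> complex) \<Rightarrow> real^'n \<Rightarrow> complex" and I :: "'i set"
  assumes T: "CZ_operator T" and \<phi>: "\<forall>\<alpha>\<in>I. \<phi> \<alpha> \<in> borel_measurable lebesgue"
  obtains D where "D \<ge> 0"
    and "\<And>F z \<delta>. F \<in> Linf0 \<Longrightarrow> \<delta> > 0 \<Longrightarrow> (\<And>y. norm (y - z) \<le> 2 * \<delta> \<Longrightarrow> F y = 0) \<Longrightarrow>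
      \<exists>c\<ge>0. ((AE y in lebesgue. F y = 0) \<longrightarrow> c = 0) \<and>
        (\<forall>\<Gamma>\<ge>0. (\<forall>s\<ge>\<delta>. (\<integral>\<^sup>+y\<in>cball z s. ennreal (cmod (F y)) \<partial>lebesgue) \<le> ennreal (\<Gamma> * s ^ CARD('n))) \<longrightarrow>
          (AE x in lebesgue. norm (x - z) \<le> \<delta> \<longrightarrow> max_modulated T I \<phi> F x \<le> ennreal (c + D * \<Gamma>) \<and>
            ennreal c \<le> max_modulated T I \<phi> F x + ennreal (D * \<Gamma>)))"
proof -
  obtain K where K: "CZ_kernel K" and TK: "\<And>f. f \<in> Linf0 \<Longrightarrow> AE x in lebesgue.
           x \<notin> ess_supp f \<longrightarrow> T f x = (LINT y|lebesgue. K x y * f y)"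
    using T unfolding CZ_operator_def by blast
  obtain c0 \<tau> where c0: "c0 > 0" and \<tau>: "\<tau> > 0"
    and size: "\<And>x y. x \<noteq> y \<Longrightarrow> cmod (K x y) \<le> c0 * norm (x - y) powr (- real CARD('n))"
    and smooth: "\<And>x y y'. norm (x - y) > 2 * norm (y - y') \<Longrightarrow>
           cmod (K x y - K x y') + cmod (K y x - K y' x)
             \<le> c0 * norm (y - y') powr \<tau> * norm (x - y) powr (- real CARD('n) - \<tau>)"
    using K unfolding CZ_kernel_def by blast
  define D where "D = c0 * 2 ^ CARD('n) * (\<Sum>k. (2 powr (- \<tau>)) ^ k)"
  have q: "2 powr (- \<tau>) < 1" using \<tau> by (simp add: powr_minus field_simps)
  have "(\<Sum>k. (2 powr (- \<tau>)) ^ k) \<ge> 0" using q by (intro suminf_nonneg summable_geometric) auto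
  then have D: "D \<ge> 0" using c0 by (simp add: D_def)
  show thesis
  proof (rule that[OF D])
    fix F :: "real^'n \<Rightarrow> complex" and z :: "real^'n" and \<delta> :: real
    assume F: "F \<in> Linf0" and \<delta>: "\<delta> > 0" and far: "\<And>y. norm (y - z) \<le> 2 * \<delta> \<Longrightarrow> F y = 0"
    have Fm[measurable]: "F \<in> borel_measurable lebesgue" using F by (rule Linf0_measurable)
    let ?S = "max_modulated T I \<phi> F"
    let ?h = "\<lambda>\<alpha>. modulation (\<phi> \<alpha>) F"
    define S where "S = ?S"
    have spec: "is_ae_SUP I (\<lambda>\<alpha> x. ennreal (cmod (T (?h \<alpha>) x))) S"
      unfolding S_def by (rule max_modulated_is_ae_SUP[OF T \<phi> F])
    then have Sm[measurable]: "S \<in> borel_measurable lebesgue"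
      and Sup: "\<And>\<alpha>. \<alpha> \<in> I \<Longrightarrow> AE x in lebesgue. ennreal (cmod (T (?h \<alpha>) x)) \<le> S x"
      and Smin: "\<And>g. g \<in> borel_measurable lebesgue \<Longrightarrow>
        (\<forall>\<alpha>\<in>I. AE x in lebesgue. ennreal (cmod (T (?h \<alpha>) x)) \<le> g x) \<Longrightarrow> AE x in lebesgue. S x \<le> g x"
      by (auto simp: is_ae_SUP_def)
    have h: "?h \<alpha> \<in> Linf0" if "\<alpha> \<in> I" for \<alpha> using \<phi> that F by (intro Linf0_modulation) auto
    have hfar: "?h \<alpha> y = 0" if "norm (y - z) \<le> 2 * \<delta>" for \<alpha> y using far[OF that]
      by (simp add: modulation_def)
    define a where "a \<alpha> = cmod (LINT y|lebesgue. K z y * ?h \<alpha> y)" for \<alpha>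
    have int_z: "integrable lebesgue (\<lambda>y. K z y * ?h \<alpha> y)" if "\<alpha> \<in> I" for \<alpha>
      using \<delta> by (intro CZ_kernel_integrable(1)[OF K h[OF that], of "2 * \<delta>"])
        (auto intro: hfar simp: norm_minus_commute)
    let ?B = "ennreal (c0 * (2 * \<delta>) powr (- real CARD('n))) * (\<integral>\<^sup>+y. ennreal (cmod (F y)) \<partial>lebesgue)"
    \<comment> \<open>A bound independent of the phase, which makes the supremum over the whole
      index set finite and vanishes together with \<open>F\<close>.\<close>
    have aB: "ennreal (a \<alpha>) \<le> ?B" if "\<alpha> \<in> I" for \<alpha>
    proof -
      have "ennreal (a \<alpha>) \<le> (\<integral>\<^sup>+y. ennreal (cmod (K z y * ?h \<alpha> y)) \<partial>lebesgue)"
        unfolding a_def using int_z[OF that] by (rule integral_norm_bound_ennreal)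
      also have "\<dots> \<le> ennreal (c0 * (2 * \<delta>) powr (- real CARD('n))) *
          (\<integral>\<^sup>+y. ennreal (cmod (?h \<alpha> y)) \<partial>lebesgue)"
      proof (rule CZ_kernel_integrable(2)[OF K h[OF that]])
        show "cmod (K z y) \<le> c0 * norm (z - y) powr (- real CARD('n))" if "y \<noteq> z" for y
          using size[of z y] that by blast
      qed (use \<delta> c0 in \<open>auto intro: hfar simp: norm_minus_commute\<close>)
      finally show ?thesis by (simp add: cmod_modulation)
    qed
    define s where "s = (SUP \<alpha>\<in>I. ennreal (a \<alpha>))"
    have "(\<integral>\<^sup>+y. ennreal (cmod (F y)) \<partial>lebesgue) < \<infinity>" using Linf0_powr_finite[OF F, of 1] by simp
    then have "?B < \<infinity>" by (simp add: ennreal_mult_less_top)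
    moreover have "s \<le> ?B" unfolding s_def by (intro SUP_least aB)
    ultimately have "s < \<infinity>" by (rule order_le_less_trans[rotated])
    define c where "c = enn2real s"
    have c: "ennreal c = s" unfolding c_def using \<open>s < \<infinity>\<close> by (intro ennreal_enn2real) auto
    have close: "AE x in lebesgue. norm (x - z) \<le> \<delta> \<longrightarrow> \<bar>cmod (T (?h \<alpha>) x) - a \<alpha>\<bar> \<le> D * \<Gamma>"
      if \<alpha>: "\<alpha> \<in> I" and \<Gamma>: "\<Gamma> \<ge> 0"
        "\<forall>s\<ge>\<delta>. (\<integral>\<^sup>+y\<in>cball z s. ennreal (cmod (F y)) \<partial>lebesgue) \<le> ennreal (\<Gamma> * s ^ CARD('n))" for \<alpha> \<Gamma>
      using TK[OF h[OF \<alpha>]]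
    proof eventually_elim
      case (elim x)
      show ?case
      proof
        assume x: "norm (x - z) \<le> \<delta>"
        have "ball z (2 * \<delta>) \<subseteq> - ess_supp (?h \<alpha>)"
        proof -
          have "AE y in lebesgue. y \<in> ball z (2 * \<delta>) \<longrightarrow> ?h \<alpha> y = 0"
            by (intro AE_I2 impI hfar) (simp add: dist_norm norm_minus_commute)
          then show ?thesis unfolding ess_supp_def using open_ball[of z "2 * \<delta>"] by blast
        qed
        moreover have "x \<in> ball z (2 * \<delta>)" using x \<delta> by (simp add: dist_norm norm_minus_commute)
        ultimately have Tx: "T (?h \<alpha>) x = (LINT y|lebesgue. K x y * ?h \<alpha> y)" using elim by auto
        have int_x: "integrable lebesgue (\<lambda>y. K x y * ?h \<alpha> y)"
        proof (rule CZ_kernel_integrable(1)[OF K h[OF \<alpha>] \<delta>])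
          fix y assume "norm (x - y) \<le> \<delta>"
          then have "norm (y - z) \<le> 2 * \<delta>"
            using x norm_triangle_ineq[of "y - x" "x - z"] by (simp add: norm_minus_commute)
          then show "?h \<alpha> y = 0" by (rule hfar)
        qed
        have int_d: "integrable lebesgue (\<lambda>y. (K x y - K z y) * ?h \<alpha> y)"
          using Bochner_Integration.integrable_diff[OF int_x int_z[OF \<alpha>]] by (simp add: left_diff_distrib)
        have "T (?h \<alpha>) x - (LINT y|lebesgue. K z y * ?h \<alpha> y) = (LINT y|lebesgue. (K x y - K z y) * ?h \<alpha> y)"
          unfolding Tx left_diff_distrib
            by (rule Bochner_Integration.integral_diff[OF int_x int_z[OF \<alpha>], symmetric])
        then have "ennreal (cmod (T (?h \<alpha>) x - (LINT y|lebesgue. K z y * ?h \<alpha> y)))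
            \<le> (\<integral>\<^sup>+y. ennreal (cmod ((K x y - K z y) * ?h \<alpha> y)) \<partial>lebesgue)"
          using integral_norm_bound_ennreal[OF int_d] by simp
        also have "\<dots> = (\<integral>\<^sup>+y\<in>- cball z (2 * \<delta>). ennreal (cmod (K x y - K z y) * cmod (F y)) \<partial>lebesgue)"
          by (intro nn_integral_cong)
            (auto simp: norm_mult cmod_modulation dist_norm norm_minus_commute far split: split_indicator)
        also have "\<dots> \<le> ennreal (D * \<Gamma>)"
          unfolding D_def using \<Gamma>(2) by (intro kernel_smoothness_integral[OF \<tau> c0 smooth Fm \<delta> x \<Gamma>(1)]) auto
        finally have "cmod (T (?h \<alpha>) x - (LINT y|lebesgue. K z y * ?h \<alpha> y)) \<le> D * \<Gamma>"
          using D \<Gamma>(1) by (subst (asm) ennreal_le_iff) auto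
        then show "\<bar>cmod (T (?h \<alpha>) x) - a \<alpha>\<bar> \<le> D * \<Gamma>"
          unfolding a_def using norm_triangle_ineq3 order_trans by blast
      qed
    qed
    show "\<exists>c\<ge>0. ((AE y in lebesgue. F y = 0) \<longrightarrow> c = 0) \<and>
        (\<forall>\<Gamma>\<ge>0. (\<forall>s\<ge>\<delta>. (\<integral>\<^sup>+y\<in>cball z s. ennreal (cmod (F y)) \<partial>lebesgue) \<le> ennreal (\<Gamma> * s ^ CARD('n))) \<longrightarrow>
          (AE x in lebesgue. norm (x - z) \<le> \<delta> \<longrightarrow> ?S x \<le> ennreal (c + D * \<Gamma>) \<and>
            ennreal c \<le> ?S x + ennreal (D * \<Gamma>)))"
      unfolding S_def[symmetric]
    proof (intro exI[of _ c] conjI impI allI)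
      show "0 \<le> c" by (simp add: c_def)
    next
      assume "AE y in lebesgue. F y = 0"
      then have "AE y in lebesgue. ennreal (cmod (F y)) = 0" by eventually_elim simp
      then have "(\<integral>\<^sup>+y. ennreal (cmod (F y)) \<partial>lebesgue) = 0" by (subst nn_integral_0_iff_AE) auto
      with \<open>s \<le> ?B\<close> show "c = 0" by (simp add: c_def)
    next
      fix \<Gamma> :: real
      assume \<Gamma>: "\<Gamma> \<ge> 0" "\<forall>s\<ge>\<delta>. (\<integral>\<^sup>+y\<in>cball z s. ennreal (cmod (F y)) \<partial>lebesgue)
          \<le> ennreal (\<Gamma> * s ^ CARD('n))"
      \<comment> \<open>Minimality of the a.e. supremum is a statement on the whole space, so the
        local bound is extended by \<open>top\<close> outside the ball.\<close>
      define g where "g x = (if x \<in> cball z \<delta> then ennreal (c + D * \<Gamma>) else top)" for x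
      have "AE x in lebesgue. S x \<le> g x"
      proof (rule Smin)
        show "g \<in> borel_measurable lebesgue" unfolding g_def by measurable
        show "\<forall>\<alpha>\<in>I. AE x in lebesgue. ennreal (cmod (T (?h \<alpha>) x)) \<le> g x"
        proof
          fix \<alpha> assume \<alpha>: "\<alpha> \<in> I"
          have ac: "a \<alpha> \<le> c"
          proof -
            have "ennreal (a \<alpha>) \<le> ennreal c" unfolding c s_def using \<alpha> by (rule SUP_upper)
            then show ?thesis by (subst (asm) ennreal_le_iff) (auto simp: c_def)
          qed
          show "AE x in lebesgue. ennreal (cmod (T (?h \<alpha>) x)) \<le> g x"
            using close[OF \<alpha> \<Gamma>] by eventually_elim
              (use ac in \<open>auto simp: g_def dist_norm norm_minus_commute intro!: ennreal_leI\<close>)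
        qed
      qed
      \<comment> \<open>Only countably many exceptional null sets can be discarded at once, so
        \<open>s\<close> is attained along a sequence of indices. An empty index set admits no such
        sequence, but then \<open>s = 0\<close>.\<close>
      moreover have "AE x in lebesgue. norm (x - z) \<le> \<delta> \<longrightarrow> s \<le> S x + ennreal (D * \<Gamma>)"
      proof (cases "I = {}")
        case True then show ?thesis by (simp add: s_def)
      next
        case False
        then obtain f where f: "range f \<subseteq> (\<lambda>\<alpha>. ennreal (a \<alpha>)) ` I" "s = (SUP n::nat. f n)"
          unfolding s_def using ennreal_Sup_countable_SUP[of "(\<lambda>\<alpha>. ennreal (a \<alpha>)) ` I"] by auto
        then have "\<forall>n. \<exists>\<alpha>\<in>I. f n = ennreal (a \<alpha>)" by auto
        then obtain \<beta> where \<beta>: "\<And>n. \<beta> n \<in> I" "\<And>n. f n = ennreal (a (\<beta> n))" by metis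
        have "AE x in lebesgue. \<forall>n. ennreal (cmod (T (?h (\<beta> n)) x)) \<le> S x"
          using Sup[OF \<beta>(1)] by (simp add: AE_all_countable)
        moreover have "AE x in lebesgue. \<forall>n. norm (x - z) \<le> \<delta> \<longrightarrow> \<bar>cmod (T (?h (\<beta> n)) x) - a (\<beta> n)\<bar> \<le> D * \<Gamma>"
          unfolding AE_all_countable using close[OF \<beta>(1) \<Gamma>] by blast
        ultimately show ?thesis
        proof eventually_elim
          case (elim x)
          show ?case
          proof
            assume x: "norm (x - z) \<le> \<delta>"
            have "f n \<le> S x + ennreal (D * \<Gamma>)" for n
            proof -
              have "a (\<beta> n) \<le> cmod (T (?h (\<beta> n)) x) + D * \<Gamma>" using elim(2) x by (smt (verit))
              then have "f n \<le> ennreal (cmod (T (?h (\<beta> n)) x) + D * \<Gamma>)" unfolding \<beta>(2) by (rule ennreal_leI)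
              also have "\<dots> = ennreal (cmod (T (?h (\<beta> n)) x)) + ennreal (D * \<Gamma>)"
                using D \<Gamma>(1) by (intro ennreal_plus) auto
              also have "\<dots> \<le> S x + ennreal (D * \<Gamma>)" using elim(1) by (intro add_right_mono) blast
              finally show ?thesis .
            qed
            then show "s \<le> S x + ennreal (D * \<Gamma>)" unfolding f(2) by (rule SUP_least)
          qed
        qed
      qed
      ultimately show "AE x in lebesgue. norm (x - z) \<le> \<delta> \<longrightarrow> S x \<le> ennreal (c + D * \<Gamma>) \<and>
            ennreal c \<le> S x + ennreal (D * \<Gamma>)"
        unfolding c by eventually_elim (auto simp: g_def dist_norm norm_minus_commute)
    qed
  qed
qed

text \<open>The weak type hypothesis provides an extension to \<open>Lp r\<close>. On
  \<open>Linf0\<close> it agrees a.e. with the supremum, which inherits sublinearity, a.e.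
  finiteness and the distributional estimate.\<close>

lemma max_modulated_weak:
  fixes T :: "(real^'n \<Rightarrow> complex) \<Rightarrow> real^'n \<Rightarrow> complex"
  assumes T: "CZ_operator T" and \<phi>: "\<forall>\<alpha>\<in>I. \<phi> \<alpha> \<in> borel_measurable lebesgue"
    and r: "r > 0" and weak: "extends_to_weak_type r (max_modulated T I \<phi>)"
  shows "nonneg_sublinear_on Linf0 (max_modulated T I \<phi>)"
    and "\<exists>C>0. \<forall>f\<in>Linf0. \<forall>t>0. emeasure lebesgue {x. max_modulated T I \<phi> f x > ennreal t}
          \<le> ennreal (C powr r / t powr r) * (\<integral>\<^sup>+y. ennreal (cmod (f y) powr r) \<partial>lebesgue)"
proof -
  let ?S = "max_modulated T I \<phi>"
  obtain B where B: "\<And>f. f \<in> Linf0 \<Longrightarrow> AE x in lebesgue. B f x = ?S f x" and wB: "weak_type r B"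
    using weak by (auto simp: extends_to_weak_type_def extends_from_def)
  have sub: "nonneg_sublinear_on (Lp r) B" using wB by (simp add: weak_type_def)
  have Sm: "?S f \<in> borel_measurable lebesgue" if "f \<in> Linf0" for f
    using max_modulated_is_ae_SUP[OF T \<phi> that] by (simp add: is_ae_SUP_def)
  have LL: "f \<in> Lp r" if "f \<in> Linf0" for f :: "real^'n \<Rightarrow> complex" using that r by (rule Linf0_Lp)
  have Bm: "B f \<in> borel_measurable lebesgue" and Bfin: "AE x in lebesgue. B f x < \<infinity>" if "f \<in> Linf0" for f
    using sub LL[OF that] by (auto simp: nonneg_sublinear_on_def)
  have Bcong: "AE x in lebesgue. B f x = B g x"
      if "f \<in> Linf0" "g \<in> Linf0" "AE x in lebesgue. f x = g x" for f g
    using sub LL that by (auto simp: nonneg_sublinear_on_def)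
  have Badd: "AE x in lebesgue. B (\<lambda>y. f y + g y) x \<le> B f x + B g x" if "f \<in> Linf0" "g \<in> Linf0" for f g
    using sub LL that by (auto simp: nonneg_sublinear_on_def)
  have Bscale: "AE x in lebesgue. B (\<lambda>y. c * f y) x = ennreal (cmod c) * B f x" if "f \<in> Linf0" for f c
    using sub LL that by (auto simp: nonneg_sublinear_on_def)
  show "nonneg_sublinear_on Linf0 ?S"
    unfolding nonneg_sublinear_on_def
  proof (intro conjI ballI impI allI)
    fix f :: "real^'n \<Rightarrow> complex" assume f: "f \<in> Linf0"
    show "?S f \<in> borel_measurable lebesgue" by (rule Sm[OF f])
    show "AE x in lebesgue. ?S f x < \<infinity>" using B[OF f] Bfin[OF f] by eventually_elim auto
    fix c :: complex
    show "AE x in lebesgue. ?S (\<lambda>y. c * f y) x = ennreal (cmod c) * ?S f x"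
      using B[OF f] B[OF Linf0_cmult[OF f, of c]] Bscale[OF f, of c] by eventually_elim auto
  next
    fix f g :: "real^'n \<Rightarrow> complex" assume f: "f \<in> Linf0" and g: "g \<in> Linf0"
    show "AE x in lebesgue. ?S (\<lambda>y. f y + g y) x \<le> ?S f x + ?S g x"
      using B[OF f] B[OF g] B[OF Linf0_add[OF f g]] Badd[OF f g] by eventually_elim auto
    assume "AE x in lebesgue. f x = g x"
    from Bcong[OF f g this] show "AE x in lebesgue. ?S f x = ?S g x"
      using B[OF f] B[OF g] by eventually_elim auto
  qed
  obtain C where C: "C > 0" "\<forall>f\<in>Lp r. \<forall>t>0. emeasure lebesgue {x. B f x > ennreal t}
          \<le> ennreal (C powr r / t powr r) * (\<integral>\<^sup>+y. ennreal (cmod (f y) powr r) \<partial>lebesgue)"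
    using wB by (auto simp: weak_type_def)
  show "\<exists>C>0. \<forall>f\<in>Linf0. \<forall>t>0. emeasure lebesgue {x. ?S f x > ennreal t}
          \<le> ennreal (C powr r / t powr r) * (\<integral>\<^sup>+y. ennreal (cmod (f y) powr r) \<partial>lebesgue)"
  proof (intro exI[of _ C] conjI C(1) ballI allI impI)
    fix f :: "real^'n \<Rightarrow> complex" and t :: real assume f: "f \<in> Linf0" and t: "t > 0"
    have [measurable]: "?S f \<in> borel_measurable lebesgue" "B f \<in> borel_measurable lebesgue"
      using Sm Bm f by auto
    have "{x \<in> space lebesgue. ?S f x > ennreal t} \<in> sets lebesgue"
      "{x \<in> space lebesgue. B f x > ennreal t} \<in> sets lebesgue" by measurable
    then have "emeasure lebesgue {x. ?S f x > ennreal t} = emeasure lebesgue {x. B f x > ennreal t}"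
      using B[OF f] by (intro emeasure_eq_AE) (auto elim: eventually_mono)
    also have "\<dots> \<le> ennreal (C powr r / t powr r) * (\<integral>\<^sup>+y. ennreal (cmod (f y) powr r) \<partial>lebesgue)"
      using C(2) LL[OF f] t by blast
    finally show "emeasure lebesgue {x. ?S f x > ennreal t}
          \<le> ennreal (C powr r / t powr r) * (\<integral>\<^sup>+y. ennreal (cmod (f y) powr r) \<partial>lebesgue)" .
  qed
qed

lemma hcube_subset_cball: "l > 0 \<Longrightarrow> hcube a l \<subseteq> cball a (real CARD('n) * l)" for a :: "real^'n"
proof
  fix x assume l: "l > 0" and "x \<in> hcube a l"
  then have "\<bar>(x - a) $ i\<bar> \<le> l" for i by (auto simp: hcube_def abs_le_iff) (smt (verit))+
  then have "(\<Sum>i\<in>UNIV. \<bar>(x - a) $ i\<bar>) \<le> (\<Sum>i\<in>(UNIV::'n set). l)" by (intro sum_mono)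
  with norm_le_l1_cart[of "x - a"] show "x \<in> cball a (real CARD('n) * l)"
    by (simp add: dist_norm norm_minus_commute)
qed

text \<open>\<open>f\<close> is split at a ball of twice the radius \<open>\<delta>\<close>. The
  weak type inequality treats the near part \<open>f1\<close>, the oscillation lemma the far part
  \<open>F\<close>. If \<open>f\<close> lives in the large ball, then \<open>F\<close> vanishes and
  the constant is 0.\<close>

lemma local_oscillation:
  fixes T :: "(real^'n \<Rightarrow> complex) \<Rightarrow> real^'n \<Rightarrow> complex" and I :: "'i set"
  assumes T: "CZ_operator T" and \<phi>: "\<forall>\<alpha>\<in>I. \<phi> \<alpha> \<in> borel_measurable lebesgue"
    and r: "r > 0" and weak: "extends_to_weak_type r (max_modulated T I \<phi>)"
  obtains C D where "C > 0" "D \<ge> 0"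
    and "\<And>f a l. f \<in> Linf0 \<Longrightarrow> l > 0 \<Longrightarrow>
      \<exists>c. ((\<forall>y. 2 * (real CARD('n) * l) < norm (y - a) \<longrightarrow> f y = 0) \<longrightarrow> c = 0) \<and>
        (\<forall>\<Gamma>\<ge>0. (\<forall>s\<ge>real CARD('n) * l. (\<integral>\<^sup>+y\<in>cball a s. ennreal (cmod (f y)) \<partial>lebesgue) \<le> ennreal
            (\<Gamma> * s ^ CARD('n))) \<longrightarrow>
          (\<forall>t>0. emeasure lebesgue {x \<in> hcube a l. \<bar>enn2real (max_modulated T I \<phi> f x) - c\<bar> > t + D * \<Gamma>}
            \<le> ennreal (C powr r / t powr r) *
                (\<integral>\<^sup>+y\<in>cball a (2 * (real CARD('n) * l)). ennreal (cmod (f y) powr r) \<partial>lebesgue)))"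
proof -
  let ?S = "max_modulated T I \<phi>"
  obtain D where D: "D \<ge> 0" and osc: "\<And>F z \<delta>. F \<in> Linf0 \<Longrightarrow> \<delta> > 0 \<Longrightarrow> (\<And>y. norm (y - z) \<le> 2 * \<delta> \<Longrightarrow> F y = 0) \<Longrightarrow>
      \<exists>c\<ge>0. ((AE y in lebesgue. F y = 0) \<longrightarrow> c = 0) \<and>
        (\<forall>\<Gamma>\<ge>0. (\<forall>s\<ge>\<delta>. (\<integral>\<^sup>+y\<in>cball z s. ennreal (cmod (F y)) \<partial>lebesgue) \<le> ennreal (\<Gamma> * s ^ CARD('n))) \<longrightarrow>
          (AE x in lebesgue. norm (x - z) \<le> \<delta> \<longrightarrow> ?S F x \<le> ennreal (c + D * \<Gamma>) \<and>
            ennreal c \<le> ?S F x + ennreal (D * \<Gamma>)))"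
    using max_modulated_oscillation[OF T \<phi>] by blast
  obtain C where C: "C > 0" and wk: "\<And>f t. f \<in> Linf0 \<Longrightarrow> t > 0 \<Longrightarrow> emeasure lebesgue {x. ?S f x > ennreal t}
          \<le> ennreal (C powr r / t powr r) * (\<integral>\<^sup>+y. ennreal (cmod (f y) powr r) \<partial>lebesgue)"
    using max_modulated_weak(2)[OF T \<phi> r weak] by blast
  have sub: "nonneg_sublinear_on Linf0 ?S" by (rule max_modulated_weak(1)[OF T \<phi> r weak])
  have Sm: "?S f \<in> borel_measurable lebesgue" and Sfin: "AE x in lebesgue. ?S f x < \<infinity>" if "f \<in> Linf0" for f
    using sub that by (auto simp: nonneg_sublinear_on_def)
  have Sadd: "AE x in lebesgue. ?S (\<lambda>y. f y + g y) x \<le> ?S f x + ?S g x" if "f \<in> Linf0" "g \<in> Linf0" for f g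
    using sub that by (auto simp: nonneg_sublinear_on_def)
  have Sneg: "AE x in lebesgue. ?S (\<lambda>y. - f y) x = ?S f x" if "f \<in> Linf0" for f
  proof -
    have "AE x in lebesgue. ?S (\<lambda>y. (- 1) * f y) x = ennreal (cmod (- 1)) * ?S f x"
      using sub that unfolding nonneg_sublinear_on_def by blast
    then show ?thesis by simp
  qed
  show thesis
  proof (rule that[OF C D])
    fix f :: "real^'n \<Rightarrow> complex" and a :: "real^'n" and l :: real
    assume f: "f \<in> Linf0" and l: "l > 0"
    \<comment> \<open>The bound of the norm by the sum of the coordinates puts the cube into the
      ball of this radius about its corner.\<close>
    define \<delta> where "\<delta> = real CARD('n) * l"
    have \<delta>: "\<delta> > 0" using l by (simp add: \<delta>_def)
    define f1 where "f1 y = f y * indicator (cball a (2 * \<delta>)) y" for y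
    define F where "F y = f y * indicator (- cball a (2 * \<delta>)) y" for y
    have f1: "f1 \<in> Linf0" unfolding f1_def by (intro Linf0_indicator f) auto
    have F: "F \<in> Linf0" unfolding F_def
      by (intro Linf0_indicator f sets.compl_sets) (auto simp: Compl_eq_Diff_UNIV)
    have fsum: "f = (\<lambda>y. f1 y + F y)" "F = (\<lambda>y. f y + - f1 y)"
      by (auto simp: fun_eq_iff f1_def F_def split: split_indicator)
    have Ffar: "F y = 0" if "norm (y - a) \<le> 2 * \<delta>" for y
      using that by (simp add: F_def dist_norm norm_minus_commute)
    obtain c where c: "c \<ge> 0" and c0: "(AE y in lebesgue. F y = 0) \<Longrightarrow> c = 0"
      and cosc: "\<And>\<Gamma>. \<Gamma> \<ge> 0 \<Longrightarrow> (\<forall>s\<ge>\<delta>. (\<integral>\<^sup>+y\<in>cball a s. ennreal (cmod (F y)) \<partial>lebesgue)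
          \<le> ennreal (\<Gamma> * s ^ CARD('n))) \<Longrightarrow>
          (AE x in lebesgue. norm (x - a) \<le> \<delta> \<longrightarrow> ?S F x \<le> ennreal (c + D * \<Gamma>) \<and>
            ennreal c \<le> ?S F x + ennreal (D * \<Gamma>))"
      using osc[OF F \<delta> Ffar] by blast
    show "\<exists>c. ((\<forall>y. 2 * (real CARD('n) * l) < norm (y - a) \<longrightarrow> f y = 0) \<longrightarrow> c = 0) \<and>
        (\<forall>\<Gamma>\<ge>0. (\<forall>s\<ge>real CARD('n) * l. (\<integral>\<^sup>+y\<in>cball a s. ennreal (cmod (f y)) \<partial>lebesgue) \<le> ennreal
            (\<Gamma> * s ^ CARD('n))) \<longrightarrow>
          (\<forall>t>0. emeasure lebesgue {x \<in> hcube a l. \<bar>enn2real (?S f x) - c\<bar> > t + D * \<Gamma>}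
            \<le> ennreal (C powr r / t powr r) *
                (\<integral>\<^sup>+y\<in>cball a (2 * (real CARD('n) * l)). ennreal (cmod (f y) powr r) \<partial>lebesgue)))"
      unfolding \<delta>_def[symmetric]
    proof (intro exI[of _ c] conjI impI allI)
      assume "\<forall>y. 2 * \<delta> < norm (y - a) \<longrightarrow> f y = 0"
      then have "F y = 0" for y by (auto simp: F_def dist_norm norm_minus_commute split: split_indicator)
      then show "c = 0" by (intro c0) auto
    next
      fix \<Gamma> t :: real
      assume \<Gamma>: "\<Gamma> \<ge> 0" and avg: "\<forall>s\<ge>\<delta>. (\<integral>\<^sup>+y\<in>cball a s. ennreal (cmod (f y)) \<partial>lebesgue)
          \<le> ennreal (\<Gamma> * s ^ CARD('n))"
        and t: "t > 0"
      have D\<Gamma>: "D * \<Gamma> \<ge> 0" using D \<Gamma> by simp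
      have "\<forall>s\<ge>\<delta>. (\<integral>\<^sup>+y\<in>cball a s. ennreal (cmod (F y)) \<partial>lebesgue) \<le> ennreal (\<Gamma> * s ^ CARD('n))"
      proof (intro allI impI)
        fix s assume s: "s \<ge> \<delta>"
        have "(\<integral>\<^sup>+y\<in>cball a s. ennreal (cmod (F y)) \<partial>lebesgue)
            \<le> (\<integral>\<^sup>+y\<in>cball a s. ennreal (cmod (f y)) \<partial>lebesgue)"
          by (intro nn_integral_mono mult_right_mono) (auto simp: F_def split: split_indicator)
        with avg s show "(\<integral>\<^sup>+y\<in>cball a s. ennreal (cmod (F y)) \<partial>lebesgue) \<le> ennreal (\<Gamma> * s ^ CARD('n))"
          by (meson order_trans)
      qed
      note osc' = cosc[OF \<Gamma> this]
      have nf1: "(\<lambda>y. - f1 y) \<in> Linf0" using Linf0_cmult[OF f1, of "- 1"] by simp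
      \<comment> \<open>Sublinearity in both directions, with \<open>- f1\<close> for the lower
        bound, keeps the operator on \<open>f\<close> within its value on \<open>f1\<close> of that
        on \<open>F\<close>. So a deviation above \<open>t + D * \<Gamma>\<close> forces the value
        on \<open>f1\<close> above \<open>t\<close>.\<close>
      have "AE x in lebesgue. x \<in> {x \<in> hcube a l. \<bar>enn2real (?S f x) - c\<bar> > t + D * \<Gamma>}
          \<longrightarrow> x \<in> {x. ?S f1 x > ennreal t}"
        using osc' Sfin[OF f] Sadd[OF f1 F, folded fsum] Sadd[OF f nf1, folded fsum] Sneg[OF f1] Sfin[OF F]
      proof eventually_elim
        case (elim x)
        show ?case
        proof (intro impI, rule ccontr)
          assume x: "x \<in> {x \<in> hcube a l. \<bar>enn2real (?S f x) - c\<bar> > t + D * \<Gamma>}"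
              and "x \<notin> {x. ?S f1 x > ennreal t}"
          then have le: "?S f1 x \<le> ennreal t" by (simp add: not_less)
          have "norm (x - a) \<le> \<delta>"
            using x hcube_subset_cball[OF l, of a] by (auto simp: \<delta>_def dist_norm norm_minus_commute)
          then have o: "?S F x \<le> ennreal (c + D * \<Gamma>)" "ennreal c \<le> ?S F x + ennreal (D * \<Gamma>)"
            using elim(1) by auto
          obtain u where u: "?S f x = ennreal u" "u \<ge> 0" using elim(2) by (cases "?S f x") auto
          have "?S f x \<le> ennreal t + ennreal (c + D * \<Gamma>)"
            using elim(3) add_mono[OF le o(1)] by (rule order_trans)
          then have "ennreal u \<le> ennreal (t + (c + D * \<Gamma>))" using u t c D\<Gamma> by (simp add: ennreal_plus)
          then have 1: "u \<le> t + (c + D * \<Gamma>)" using t c D\<Gamma> by (subst (asm) ennreal_le_iff) auto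
          have "?S F x \<le> ?S f x + ennreal t"
            using elim(4) unfolding elim(5) using add_left_mono[OF le, of "?S f x"] by (rule order_trans)
          then have "ennreal c \<le> ?S f x + ennreal t + ennreal (D * \<Gamma>)"
            using o(2) add_right_mono order_trans by blast
          then have "ennreal c \<le> ennreal (u + t + D * \<Gamma>)" using u t D\<Gamma> by (simp add: ennreal_plus)
          then have "c \<le> u + t + D * \<Gamma>" using u t D\<Gamma> by (subst (asm) ennreal_le_iff) auto
          with 1 have "\<bar>u - c\<bar> \<le> t + D * \<Gamma>" by linarith
          then show False using x u by simp
        qed
      qed
      moreover have "{x. ?S f1 x > ennreal t} \<in> sets lebesgue"
      proof -
        have [measurable]: "?S f1 \<in> borel_measurable lebesgue" by (rule Sm[OF f1])
        have "{x \<in> space lebesgue. ?S f1 x > ennreal t} \<in> sets lebesgue" by measurable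
        then show ?thesis by simp
      qed
      ultimately have "emeasure lebesgue {x \<in> hcube a l. \<bar>enn2real (?S f x) - c\<bar> > t + D * \<Gamma>}
          \<le> emeasure lebesgue {x. ?S f1 x > ennreal t}"
        by (rule emeasure_mono_AE)
      also have "\<dots> \<le> ennreal (C powr r / t powr r) * (\<integral>\<^sup>+y. ennreal (cmod (f1 y) powr r) \<partial>lebesgue)"
        by (rule wk[OF f1 t])
      also have "(\<integral>\<^sup>+y. ennreal (cmod (f1 y) powr r) \<partial>lebesgue)
          = (\<integral>\<^sup>+y\<in>cball a (2 * \<delta>). ennreal (cmod (f y) powr r) \<partial>lebesgue)"
        using r by (intro nn_integral_cong) (auto simp: f1_def split: split_indicator)
      finally show "emeasure lebesgue {x \<in> hcube a l. \<bar>enn2real (?S f x) - c\<bar> > t + D * \<Gamma>}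
            \<le> ennreal (C powr r / t powr r) *
                (\<integral>\<^sup>+y\<in>cball a (2 * \<delta>). ennreal (cmod (f y) powr r) \<partial>lebesgue)" .
    qed
  qed
qed

section \<open>The bound on bounded functions with compact support\<close>

lemma self_mem_hcube: "l > 0 \<Longrightarrow> a \<in> hcube a l"
  by (simp add: hcube_def)

text \<open>Side \<open>3 * s\<close> instead of \<open>2 * s\<close> leaves room at the open faces
  of the cube.\<close>

lemma cball_subset_hcube: "s > 0 \<Longrightarrow> cball a s \<subseteq> hcube (\<chi> i. a $ i - s) (3 * s)" for a :: "real^'n"
proof
  fix x assume s: "s > 0" and x: "x \<in> cball a s"
  have "\<bar>(x - a) $ i\<bar> \<le> s" for i
    using component_le_norm_cart[of "x - a" i] x by (simp add: dist_norm norm_minus_commute)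
  then have "- s \<le> x $ i - a $ i \<and> x $ i - a $ i \<le> s" for i by (simp add: abs_le_iff) (smt (verit))
  then show "x \<in> hcube (\<chi> i. a $ i - s) (3 * s)" using s by (auto simp: hcube_def) (smt (verit))+
qed

text \<open>The weight condition on the large cube holds at each point of the small one. The
  integral is then finite, and the infimum can be taken among real numbers.\<close>

lemma A1_weight_Inf:
  fixes v :: "real^'n \<Rightarrow> real"
  assumes v: "A1_weight A v" and A: "A \<ge> 1" and l: "l > 0" and L: "L > 0" and sub: "hcube a l \<subseteq> hcube b L"
  shows "(\<integral>\<^sup>+y\<in>hcube b L. ennreal (v y) \<partial>lebesgue) \<le> ennreal (A * Inf (v ` hcube a l) * L ^ CARD('n))"
proof -
  have le: "(\<integral>\<^sup>+y\<in>hcube b L. ennreal (v y) \<partial>lebesgue) \<le> ennreal (A * v x * L ^ CARD('n))"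
      if "x \<in> hcube a l" for x
    using A1_weightD(3)[OF v L, of x b] that sub A A1_weightD(2)[OF v, of x] L by (auto simp: ennreal_mult)
  then have "(\<integral>\<^sup>+y\<in>hcube b L. ennreal (v y) \<partial>lebesgue) < \<infinity>"
    using order_le_less_trans[OF le[OF self_mem_hcube[OF l]] ennreal_less_top] by simp
  then obtain J where J: "(\<integral>\<^sup>+y\<in>hcube b L. ennreal (v y) \<partial>lebesgue) = ennreal J" "J \<ge> 0"
    by (cases "\<integral>\<^sup>+y\<in>hcube b L. ennreal (v y) \<partial>lebesgue") auto
  have pos: "A * L ^ CARD('n) > 0" using A L by simp
  have "J / (A * L ^ CARD('n)) \<le> v x" if "x \<in> hcube a l" for x
  proof -
    have "J \<le> A * v x * L ^ CARD('n)"
      using le[OF that] J A L A1_weightD(2)[OF v, of x] by (simp add: ennreal_le_iff)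
    then show ?thesis using pos by (simp add: pos_divide_le_eq mult_ac)
  qed
  then have "J / (A * L ^ CARD('n)) \<le> Inf (v ` hcube a l)"
    using self_mem_hcube[OF l, of a] by (intro cINF_greatest) auto
  then have "J \<le> A * Inf (v ` hcube a l) * L ^ CARD('n)" using pos by (simp add: pos_divide_le_eq mult_ac)
  then show ?thesis unfolding J(1) by (rule ennreal_leI)
qed

lemma small_exponent:
  fixes B :: real
  assumes "B > 0"
  obtains \<epsilon> :: real where "0 < \<epsilon>" "\<epsilon> \<le> 1" "(2 powr \<epsilon> - 1) * B \<le> 1 / 2"
proof -
  have "((\<lambda>\<epsilon>. (2 powr \<epsilon> - 1) * B) \<longlongrightarrow> (2 powr 0 - 1) * B) (at_right (0::real))"
    by (intro tendsto_intros) auto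
  then have "\<forall>\<^sub>F \<epsilon> in at_right 0. (2 powr \<epsilon> - 1) * B < 1 / 2"
    by (rule order_tendstoD) simp
  moreover have "\<forall>\<^sub>F \<epsilon> in at_right (0::real). \<epsilon> \<in> {0<..<1}"
    by (rule eventually_at_right_real) simp
  ultimately have "\<forall>\<^sub>F \<epsilon> in at_right (0::real). (2 powr \<epsilon> - 1) * B < 1 / 2 \<and> \<epsilon> \<in> {0<..<1}"
    by (rule eventually_conj)
  then obtain \<epsilon> where "(2 powr \<epsilon> - 1) * B < 1 / 2" "\<epsilon> \<in> {0<..<1}"
    using eventually_happens trivial_limit_at_right_real by blast
  then show thesis by (intro that[of \<epsilon>]) auto
qed

text \<open>The order of choices gives a constant independent of \<open>f\<close>: \<open>A\<close>
  from \<open>M\<close> on \<open>X\<close>, then \<open>\<epsilon>\<close> and \<open>r\<close>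
  from the dimension and \<open>A\<close>, then the weak type constant at \<open>r\<close>. Only the
  weight depends on \<open>f\<close>.\<close>

lemma max_modulated_bounded_Linf0:
  fixes \<rho> :: "(real^'n \<Rightarrow> ennreal) \<Rightarrow> ennreal" and I :: "'i set"
  assumes bfn: "banach_function_norm \<rho>"
    and M: "bounded_on_bfs \<rho> hl_maximal"
    and M': "bounded_on_bfs (associate_norm \<rho>) hl_maximal"
    and T: "CZ_operator T" and \<phi>: "\<forall>\<alpha>\<in>I. \<phi> \<alpha> \<in> borel_measurable lebesgue"
    and weak: "\<forall>r>1. extends_to_weak_type r (max_modulated T I \<phi>)"
  obtains C where "C > 0" "\<And>f. f \<in> Linf0 \<Longrightarrow> \<rho> (max_modulated T I \<phi> f) \<le> ennreal C * bfs_norm \<rho> f"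
proof -
  let ?S = "max_modulated T I \<phi>"
  let ?N = "CARD('n)"
  define n where "n = real ?N"
  have n: "n \<ge> 1" by (simp add: n_def Suc_leI)
  obtain A where A: "A \<ge> 1" and rdf: "\<And>f N. f \<in> bfs \<rho> \<Longrightarrow> AE x in lebesgue. cmod (f x) \<le> N \<Longrightarrow>
      \<exists>v. A1_weight A v \<and> (AE x in lebesgue. cmod (f x) \<le> v x) \<and> (\<forall>x. v x \<le> max N 0) \<and>
        \<rho> (\<lambda>x. ennreal (v x)) \<le> 2 * bfs_norm \<rho> f"
    using rubio_de_francia[OF bfn M] by blast
  have "2 ^ (?N + 1) * A ^ 2 > 0" using A by simp
  then obtain \<epsilon> where \<epsilon>: "0 < \<epsilon>" "\<epsilon> \<le> 1" "(2 powr \<epsilon> - 1) * (2 ^ (?N + 1) * A ^ 2) \<le> 1 / 2"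
    by (rule small_exponent)
  define r where "r = 1 + \<epsilon>"
  have r: "r > 1" using \<epsilon> by (simp add: r_def)
  have weak_r: "extends_to_weak_type r ?S" using weak r by blast
  have r0: "r > 0" using r by simp
  obtain C D where C: "C > 0" and D: "D \<ge> 0" and osc: "\<And>f a l. f \<in> Linf0 \<Longrightarrow> l > 0 \<Longrightarrow>
      \<exists>c. ((\<forall>y. 2 * (real ?N * l) < norm (y - a) \<longrightarrow> f y = 0) \<longrightarrow> c = 0) \<and>
        (\<forall>\<Gamma>\<ge>0. (\<forall>s\<ge>real ?N * l. (\<integral>\<^sup>+y\<in>cball a s. ennreal (cmod (f y)) \<partial>lebesgue) \<le> ennreal (\<Gamma> * s ^ ?N)) \<longrightarrow>
          (\<forall>t>0. emeasure lebesgue {x \<in> hcube a l. \<bar>enn2real (?S f x) - c\<bar> > t + D * \<Gamma>}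
            \<le> ennreal (C powr r / t powr r) *
                (\<integral>\<^sup>+y\<in>cball a (2 * (real ?N * l)). ennreal (cmod (f y) powr r) \<partial>lebesgue)))"
    using local_oscillation[OF T \<phi> r0 weak_r] by blast
  obtain C' where C': "C' > 0" "\<And>g. g \<in> bfs (associate_norm \<rho>) \<Longrightarrow>
      associate_norm \<rho> (hl_maximal g) \<le> ennreal C' * bfs_norm (associate_norm \<rho>) g"
    using M' by (auto simp: bounded_on_bfs_def)
  have sub: "nonneg_sublinear_on Linf0 ?S" by (rule max_modulated_weak(1)[OF T \<phi> r0 weak_r])
  have Sm: "?S f \<in> borel_measurable lebesgue" and Sfin: "AE x in lebesgue. ?S f x < \<infinity>" if "f \<in> Linf0" for f
    using sub that by (auto simp: nonneg_sublinear_on_def)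
  have Scong: "AE x in lebesgue. ?S f x = ?S g x"
    if "f \<in> Linf0" "g \<in> Linf0" "AE x in lebesgue. f x = g x" for f g
    using sub that unfolding nonneg_sublinear_on_def by blast
  \<comment> \<open>Chosen so that the weak type bound at height \<open>Ct * \<beta> p\<close> is
    exactly the fraction \<open>1 / (4 * 2 ^ ?N)\<close> of the cube. The powers of
    \<open>C\<close>, \<open>A\<close> and \<open>\<beta> p\<close> cancel, and
    \<open>12 * n\<close> against the enlargement \<open>6 * n\<close> of the side supplies
    \<open>2 ^ ?N\<close>.\<close>
  define Ct where "Ct = C * A * (8 * (12 * n) ^ ?N) powr (1 / r)"
  have Ct: "Ct > 0" using C A n by (simp add: Ct_def)
  have Ctr: "Ct powr r = C powr r * A powr r * (8 * (12 * n) ^ ?N)"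
    using C A n r by (simp add: Ct_def powr_mult powr_powr)
  \<comment> \<open>The second summand is the contribution of the far part, with
    \<open>\<Gamma> = 3 ^ ?N * A * \<beta> p\<close>.\<close>
  define C1 where "C1 = Ct + D * (3 ^ ?N * A)"
  have C1: "C1 > 0" using Ct D A by (simp add: C1_def add_pos_nonneg)
  have key: "\<rho> (?S f) \<le> ennreal (8 * C1 * C') * bfs_norm \<rho> f"
    if f: "f \<in> Linf0" and R: "R > 0" and supp: "\<And>y. norm y > R \<Longrightarrow> f y = 0" for f R
  proof -
    have fm[measurable]: "f \<in> borel_measurable lebesgue" using f by (rule Linf0_measurable)
    have fX: "f \<in> bfs \<rho>" using bfn f by (rule Linf0_bfs)
    obtain B where "AE x in lebesgue. cmod (f x) \<le> B" using f by (auto simp: Linf0_def)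
    from rdf[OF fX this] obtain v where v: "A1_weight A v" and fv: "AE x in lebesgue. cmod (f x) \<le> v x"
      and vB: "\<And>x. v x \<le> max B 0" and \<rho>v: "\<rho> (\<lambda>x. ennreal (v x)) \<le> 2 * bfs_norm \<rho> f" by blast
    note [measurable] = A1_weightD(1)[OF v]
    have v0: "0 \<le> v x" for x by (rule A1_weightD(2)[OF v])
    define \<beta> where "\<beta> p = Inf (v ` hc p)" for p
    have \<beta>_le: "\<beta> p \<le> v x" if "x \<in> hc p" for p x
      unfolding \<beta>_def using that v0 by (intro cINF_lower bdd_belowI2[of _ 0]) auto
    have \<beta>0: "\<beta> p \<ge> 0" if "snd p > 0" for p
      unfolding \<beta>_def using v0 self_mem_hcube[OF that, of "fst p"] by (intro cINF_greatest) auto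
    \<comment> \<open>A cube of side \<open>3 * s\<close> contains both the ball and
      \<open>hc p\<close>. On it the weight condition handles the first average; the reverse Hoelder
      inequality handles the second, since the average \<open>w\<close> of the weight is at most
      \<open>A * \<beta> p\<close>.\<close>
    have avg1: "(\<integral>\<^sup>+y\<in>cball (fst p) s. ennreal (cmod (f y)) \<partial>lebesgue)
        \<le> ennreal (3 ^ ?N * A * \<beta> p * s ^ ?N)"
      and avg2: "(\<integral>\<^sup>+y\<in>cball (fst p) s. ennreal (cmod (f y) powr r) \<partial>lebesgue)
          \<le> ennreal (2 * (A * \<beta> p) powr r * (3 * s) ^ ?N)"
      if p: "snd p > 0" and s: "s \<ge> n * snd p" for p s
    proof -
      have "1 * snd p \<le> n * snd p" using n p by (intro mult_right_mono) auto
      then have s0: "s > 0" "snd p \<le> s" using p s by linarith+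
      let ?b = "\<chi> i. fst p $ i - s"
      have cs: "cball (fst p) s \<subseteq> hcube ?b (3 * s)" by (rule cball_subset_hcube[OF s0(1)])
      have hs: "hc p \<subseteq> hcube ?b (3 * s)"
      proof
        fix x assume "x \<in> hc p"
        then have "fst p $ i \<le> x $ i \<and> x $ i < fst p $ i + snd p" for i by (simp add: hcube_def)
        then have "fst p $ i - s \<le> x $ i \<and> x $ i < fst p $ i - s + 3 * s" for i using s0 by (smt (verit))
        then show "x \<in> hcube ?b (3 * s)" by (simp add: hcube_def)
      qed
      have int: "(\<integral>\<^sup>+y\<in>hcube ?b (3 * s). ennreal (v y) \<partial>lebesgue) \<le> ennreal (A * \<beta> p * (3 * s) ^ ?N)"
        unfolding \<beta>_def using s0 by (intro A1_weight_Inf[OF v A p _ hs]) auto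
      have "(\<integral>\<^sup>+y\<in>cball (fst p) s. ennreal (cmod (f y)) \<partial>lebesgue)
          \<le> (\<integral>\<^sup>+y\<in>hcube ?b (3 * s). ennreal (v y) \<partial>lebesgue)"
        using fv by (intro nn_integral_mono_AE)
            (use cs in \<open>auto elim!: eventually_mono intro!: ennreal_leI split: split_indicator\<close>)
      also note int
      finally show "(\<integral>\<^sup>+y\<in>cball (fst p) s. ennreal (cmod (f y)) \<partial>lebesgue)
          \<le> ennreal (3 ^ ?N * A * \<beta> p * s ^ ?N)"
        by (simp add: power_mult_distrib mult_ac)
      have "(\<integral>\<^sup>+y\<in>hcube ?b (3 * s). ennreal (v y) \<partial>lebesgue) < \<infinity>"
        using int by (rule order_le_less_trans) simp
      then obtain J where J: "(\<integral>\<^sup>+y\<in>hcube ?b (3 * s). ennreal (v y) \<partial>lebesgue) = ennreal J" "J \<ge> 0"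
        by (cases "\<integral>\<^sup>+y\<in>hcube ?b (3 * s). ennreal (v y) \<partial>lebesgue") auto
      define w where "w = J / (3 * s) ^ ?N"
      have w0: "w \<ge> 0" using J s0 by (simp add: w_def)
      have w: "(\<integral>\<^sup>+y\<in>hcube ?b (3 * s). ennreal (v y) \<partial>lebesgue) = ennreal w * ennreal ((3 * s) ^ ?N)"
        unfolding J(1) using w0 s0 by (subst ennreal_mult[symmetric]) (auto simp: w_def)
      have "J \<le> A * \<beta> p * (3 * s) ^ ?N" using int J A \<beta>0[OF p] s0 by (simp add: ennreal_le_iff)
      then have wA: "w \<le> A * \<beta> p" using s0 by (simp add: w_def pos_divide_le_eq)
      have "(\<integral>\<^sup>+y\<in>cball (fst p) s. ennreal (cmod (f y) powr r) \<partial>lebesgue)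
          \<le> (\<integral>\<^sup>+y\<in>hcube ?b (3 * s). ennreal (v y powr r) \<partial>lebesgue)"
        using fv by (intro nn_integral_mono_AE)
          (use cs r0 in \<open>auto elim!: eventually_mono intro!: ennreal_leI powr_mono2 split: split_indicator\<close>)
      also have "\<dots> \<le> ennreal (2 * w powr r * (3 * s) ^ ?N)"
        unfolding r_def using s0 \<epsilon> by (intro reverse_holder[OF v A vB _ _ _ _ w0 w]) (auto simp: mult_ac)
      also have "\<dots> \<le> ennreal (2 * (A * \<beta> p) powr r * (3 * s) ^ ?N)"
        using wA w0 r0 s0 by (intro ennreal_leI mult_right_mono mult_left_mono powr_mono2) auto
      finally show "(\<integral>\<^sup>+y\<in>cball (fst p) s. ennreal (cmod (f y) powr r) \<partial>lebesgue)
          \<le> ennreal (2 * (A * \<beta> p) powr r * (3 * s) ^ ?N)" .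
    qed
    define F where "F x = enn2real (?S f x)" for x
    have Fm[measurable]: "F \<in> borel_measurable lebesgue" unfolding F_def using Sm[OF f] by measurable
    define good where "good p c \<longleftrightarrow> ((\<forall>y. 2 * (n * snd p) < norm (y - fst p) \<longrightarrow> f y = 0) \<longrightarrow> c = 0) \<and>
        (\<forall>\<Gamma>\<ge>0. (\<forall>s\<ge>n * snd p. (\<integral>\<^sup>+y\<in>cball (fst p) s. ennreal (cmod (f y)) \<partial>lebesgue) \<le> ennreal
            (\<Gamma> * s ^ ?N)) \<longrightarrow>
          (\<forall>t>0. emeasure lebesgue {x \<in> hc p. \<bar>F x - c\<bar> > t + D * \<Gamma>}
            \<le> ennreal (C powr r / t powr r) *
                (\<integral>\<^sup>+y\<in>cball (fst p) (2 * (n * snd p)). ennreal (cmod (f y) powr r) \<partial>lebesgue)))" for p c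
    have "\<exists>c. good p c" if "snd p > 0" for p
      unfolding good_def n_def F_def by (rule osc[OF f that])
    then obtain c where good: "\<And>p. snd p > 0 \<Longrightarrow> good p (c p)" by metis
    have c0: "c p = 0" if "snd p > 0" "\<forall>y. 2 * (n * snd p) < norm (y - fst p) \<longrightarrow> f y = 0" for p
      using good[OF that(1)] that(2) unfolding good_def by blast
    have c: "emeasure lebesgue {x \<in> hc p. \<bar>F x - c p\<bar> > t + D * \<Gamma>}
            \<le> ennreal (C powr r / t powr r) *
                (\<integral>\<^sup>+y\<in>cball (fst p) (2 * (n * snd p)). ennreal (cmod (f y) powr r) \<partial>lebesgue)"
      if "snd p > 0" "\<Gamma> \<ge> 0"
        "\<forall>s\<ge>n * snd p. (\<integral>\<^sup>+y\<in>cball (fst p) s. ennreal (cmod (f y)) \<partial>lebesgue)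
            \<le> ennreal (\<Gamma> * s ^ ?N)" "t > 0" for p \<Gamma> t
      using good[OF that(1)] that(2-4) unfolding good_def by blast
    \<comment> \<open>The iteration asks for \<open>\<alpha> p \<ge> 0\<close> at all pairs. For
      nonpositive side the cube is empty and the infimum \<open>\<beta> p\<close> carries no
      information.\<close>
    define \<alpha> where "\<alpha> p = (if snd p > 0 then C1 * \<beta> p else 0)" for p
    have \<alpha>0: "\<alpha> p \<ge> 0" for p using \<beta>0[of p] C1 by (simp add: \<alpha>_def)
    have local: "emeasure lebesgue {x \<in> hc p. \<bar>F x - c p\<bar> > \<alpha> p}
      \<le> ennreal (1 / (4 * 2 ^ ?N)) * emeasure lebesgue (hc p)" if p: "snd p > 0" for p
    proof -
      have \<Gamma>: "3 ^ ?N * A * \<beta> p \<ge> 0" using A \<beta>0[OF p] by simp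
      have nl: "n * snd p > 0" using n p by simp
      have two: "2 * (n * snd p) \<ge> n * snd p" using nl by linarith
      have est: "emeasure lebesgue {x \<in> hc p. \<bar>F x - c p\<bar> > t + D * (3 ^ ?N * A * \<beta> p)}
            \<le> ennreal (C powr r / t powr r) * ennreal
                (2 * (A * \<beta> p) powr r * (3 * (2 * (n * snd p))) ^ ?N)" if "t > 0" for t
      proof -
        have "emeasure lebesgue {x \<in> hc p. \<bar>F x - c p\<bar> > t + D * (3 ^ ?N * A * \<beta> p)}
            \<le> ennreal (C powr r / t powr r) *
                (\<integral>\<^sup>+y\<in>cball (fst p) (2 * (n * snd p)). ennreal (cmod (f y) powr r) \<partial>lebesgue)"
          using avg1[OF p] that by (intro c[OF p \<Gamma>]) auto
        also have "\<dots> \<le> ennreal (C powr r / t powr r) * ennreal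
            (2 * (A * \<beta> p) powr r * (3 * (2 * (n * snd p))) ^ ?N)"
          by (intro mult_left_mono avg2[OF p two]) auto
        finally show ?thesis .
      qed
      show ?thesis
      proof (cases "\<beta> p = 0")
        \<comment> \<open>The threshold is 0 here, while the weak type bound needs
          \<open>t > 0\<close>. At every height \<open>1 / real (Suc k)\<close> it gives measure 0,
          and these sets exhaust the exceptional set.\<close>
        case True
        define E where "E k = {x \<in> hc p. \<bar>F x - c p\<bar> > 1 / real (Suc k)}" for k
        have "emeasure lebesgue (E k) = 0" for k
          using est[of "1 / real (Suc k)"] True r0 by (simp add: E_def)
        moreover have "E k \<in> sets lebesgue" for k
        proof -
          have "{x \<in> space lebesgue. \<bar>F x - c p\<bar> > 1 / real (Suc k)} \<in> sets lebesgue" by measurable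
          then have "hc p \<inter> {x. \<bar>F x - c p\<bar> > 1 / real (Suc k)} \<in> sets lebesgue" by auto
          then show ?thesis by (simp add: E_def Int_def)
        qed
        ultimately have "(\<Union>k. E k) \<in> null_sets lebesgue" by (intro null_sets_UN) (auto intro: null_setsI)
        moreover have "{x \<in> hc p. \<bar>F x - c p\<bar> > \<alpha> p} \<subseteq> (\<Union>k. E k)"
        proof
          fix x assume x: "x \<in> {x \<in> hc p. \<bar>F x - c p\<bar> > \<alpha> p}"
          then have "\<bar>F x - c p\<bar> > 0" using \<alpha>0[of p] by auto
          then obtain k where "inverse (real (Suc k)) < \<bar>F x - c p\<bar>" using reals_Archimedean by blast
          then show "x \<in> (\<Union>k. E k)" using x by (auto simp: E_def inverse_eq_divide)
        qed
        ultimately have "emeasure lebesgue {x \<in> hc p. \<bar>F x - c p\<bar> > \<alpha> p} = 0"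
          by (metis (lifting) emeasure_eq_0 null_setsD1 null_setsD2)
        then show ?thesis by simp
      next
        case False
        then have b: "\<beta> p > 0" using \<beta>0[OF p] by simp
        have \<alpha>: "\<alpha> p = Ct * \<beta> p + D * (3 ^ ?N * A * \<beta> p)" using p by (simp add: \<alpha>_def C1_def algebra_simps)
        have "emeasure lebesgue {x \<in> hc p. \<bar>F x - c p\<bar> > \<alpha> p} \<le>
           ennreal (C powr r / (Ct * \<beta> p) powr r) * ennreal
               (2 * (A * \<beta> p) powr r * (3 * (2 * (n * snd p))) ^ ?N)"
          unfolding \<alpha> using Ct b by (intro est) simp
        also have "\<dots> = ennreal (C powr r / (Ct * \<beta> p) powr r *
            (2 * (A * \<beta> p) powr r * (3 * (2 * (n * snd p))) ^ ?N))"
          using nl by (intro ennreal_mult[symmetric]) auto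
        also have "C powr r / (Ct * \<beta> p) powr r * (2 * (A * \<beta> p) powr r * (3 * (2 * (n * snd p))) ^ ?N)
           = 1 / (4 * 2 ^ ?N) * snd p ^ ?N"
        proof -
          have 1: "(Ct * \<beta> p) powr r = C powr r * A powr r * (8 * (12 * n) ^ ?N) * \<beta> p powr r"
            using Ct b by (simp add: powr_mult Ctr)
          have 2: "(A * \<beta> p) powr r = A powr r * \<beta> p powr r" using A b by (simp add: powr_mult)
          have 3: "(12 * n) ^ ?N * (snd p) ^ ?N = 2 ^ ?N * (3 * (2 * (n * snd p))) ^ ?N"
            unfolding power_mult_distrib[symmetric] by (simp add: mult_ac)
          have nz: "C powr r \<noteq> 0" "A powr r \<noteq> 0" "\<beta> p powr r \<noteq> 0" "(12 * n) ^ ?N \<noteq> 0" using C A b n by auto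
          have "X / (X * Y * (8 * Z) * W) * (2 * (Y * W) * V) = 1 / (4 * P) * Q"
            if "X \<noteq> 0" "Y \<noteq> 0" "W \<noteq> 0" "Z \<noteq> 0" "P \<noteq> 0" "Z * Q = P * V" for X Y Z W V P Q :: real
          proof -
            have "X / (X * Y * (8 * Z) * W) * (2 * (Y * W) * V) = V / (4 * Z)" using that
              by (simp add: field_simps)
            also have "\<dots> = 1 / (4 * P) * Q" using that by (simp add: field_simps)
            finally show ?thesis .
          qed
          from this[OF nz(1,2,3,4) _ 3] show ?thesis unfolding 1 2 by simp
        qed
        also have "ennreal (1 / (4 * 2 ^ ?N) * snd p ^ ?N)
            = ennreal (1 / (4 * 2 ^ ?N)) * emeasure lebesgue (hc p)"
          unfolding emeasure_hc[OF p] using p by (intro ennreal_mult) auto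
        finally show ?thesis .
      qed
    qed
    obtain K where K: "bfs_norm \<rho> f = ennreal K" "K \<ge> 0"
      using fX by (cases "bfs_norm \<rho> f") (auto simp: bfs_def)
    have "\<rho> (?S f) \<le> ennreal (8 * C1 * C' * K)"
    proof (rule lorentz_luxemburg[OF bfn Sm[OF f]])
      show "0 \<le> 8 * C1 * C' * K" using C1 C' K by simp
      fix g :: "real^'n \<Rightarrow> real"
      assume gm[measurable]: "g \<in> borel_measurable lebesgue" and g0: "\<And>x. 0 \<le> g x"
        and g1: "associate_norm \<rho> (\<lambda>x. ennreal (g x)) \<le> 1"
      define G where "G x = ennreal (g x)" for x
      have [measurable]: "G \<in> borel_measurable lebesgue" unfolding G_def by measurable
      \<comment> \<open>On a cube, \<open>\<alpha> p\<close> is at most \<open>C1 * v x\<close> and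
        the average of \<open>G\<close> at most \<open>mx G x\<close>, for each point
        \<open>x\<close> of it.\<close>
      define H where "H x = ennreal (C1 * v x) * mx G x" for x
      have [measurable]: "H \<in> borel_measurable lebesgue" unfolding H_def by measurable
      have Hp: "ennreal (\<alpha> p) * (\<integral>\<^sup>+y\<in>hc p. G y \<partial>lebesgue) \<le> H x * emeasure lebesgue (hc p)"
        if p: "snd p > 0" and x: "x \<in> hc p" for p x
      proof -
        have "ennreal (\<alpha> p) * (\<integral>\<^sup>+y\<in>hc p. G y \<partial>lebesgue)
            \<le> ennreal (C1 * v x) * (mx G x * ennreal (snd p ^ ?N))"
          using p C1 \<beta>_le[OF x] mx_upper_hcube[OF p x, of G]
          by (intro mult_mono ennreal_leI) (auto simp: \<alpha>_def)
        then show ?thesis unfolding emeasure_hc[OF p] by (simp add: H_def mult.assoc)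
      qed
      \<comment> \<open>Hoelder between \<open>X\<close> and \<open>X'\<close>: the weight has norm
        at most \<open>2 * K\<close>, and boundedness of \<open>M\<close> on the associate space
        gives \<open>C'\<close> for the maximal function of \<open>g\<close>.\<close>
      have HH: "(\<integral>\<^sup>+x. H x \<partial>lebesgue) \<le> ennreal (C1 * (2 * K * C'))"
      proof -
        define gc where "gc x = complex_of_real (g x)" for x
        have [measurable]: "gc \<in> borel_measurable lebesgue" unfolding gc_def by measurable
        have ng: "(\<lambda>x. ennreal (cmod (gc x))) = G" using g0 by (simp add: gc_def G_def fun_eq_iff)
        have nrm: "bfs_norm (associate_norm \<rho>) gc \<le> 1" unfolding bfs_norm_def ng using g1
          by (simp add: G_def[abs_def])
        then have "gc \<in> bfs (associate_norm \<rho>)" by (auto simp: bfs_def intro: order_le_less_trans)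
        then have "associate_norm \<rho> (mx G) \<le> ennreal C' * bfs_norm (associate_norm \<rho>) gc"
          using C'(2)[of gc] unfolding hl_maximal_eq_mx ng by simp
        also have "\<dots> \<le> ennreal C' * 1" using nrm by (intro mult_left_mono) auto
        finally have mg: "associate_norm \<rho> (mx G) \<le> ennreal C'" by simp
        have \<rho>vK: "\<rho> (\<lambda>x. ennreal (v x)) \<le> ennreal (2 * K)" using \<rho>v K by (simp add: ennreal_mult)
        have "(\<integral>\<^sup>+x. H x \<partial>lebesgue) = (\<integral>\<^sup>+x. ennreal C1 * (ennreal (v x) * mx G x) \<partial>lebesgue)"
          unfolding H_def using C1 v0 by (intro nn_integral_cong) (simp add: ennreal_mult mult.assoc)
        also have "\<dots> = ennreal C1 * (\<integral>\<^sup>+x. ennreal (v x) * mx G x \<partial>lebesgue)"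
          by (intro nn_integral_cmult) measurable
        also have "\<dots> \<le> ennreal C1 * (\<rho> (\<lambda>x. ennreal (v x)) * associate_norm \<rho> (mx G))"
          using \<rho>vK by (intro mult_left_mono associate_holder[OF bfn]) (auto intro: order_le_less_trans)
        also have "\<dots> \<le> ennreal C1 * (ennreal (2 * K) * ennreal C')"
          by (intro mult_left_mono mult_mono \<rho>vK mg) auto
        also have "\<dots> = ennreal (C1 * (2 * K * C'))" using C1 C' K by (simp add: ennreal_mult)
        finally show ?thesis .
      qed
      \<comment> \<open>These cubes exhaust the space, and the double ball about the corner of each
        contains the support of \<open>f\<close>. Hence their constants are 0.\<close>
      define P where "P k = ((\<chi> i. - (R + real k)) :: real^'n, 2 * (R + real k))" for k :: nat
      have P: "snd (P k) > 0" for k using R by (simp add: P_def)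
      have cP: "c (P k) = 0" for k
      proof (rule c0[OF P], intro allI impI, rule supp)
        fix y assume far: "2 * (n * snd (P k)) < norm (y - fst (P k))"
        define s where "s = R + real k"
        have s: "s \<ge> R" "s > 0" using R by (auto simp: s_def)
        have "norm (fst (P k)) \<le> (\<Sum>i\<in>UNIV. \<bar>fst (P k) $ i\<bar>)" by (rule norm_le_l1_cart)
        also have "\<dots> = n * s" using s by (simp add: P_def s_def n_def)
        finally have "norm (fst (P k)) \<le> n * s" .
        moreover have "norm (y - fst (P k)) \<le> norm y + norm (fst (P k))" by (rule norm_triangle_ineq4)
        moreover have "2 * (n * snd (P k)) = 4 * (n * s)" by (simp add: P_def s_def)
        moreover have "n * s \<ge> 1 * s" using n s by (intro mult_right_mono) auto
        ultimately show "norm y > R" using far s by linarith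
      qed
      have "(\<integral>\<^sup>+x. ?S f x * ennreal (g x) \<partial>lebesgue) = (\<integral>\<^sup>+x. ennreal (F x) * G x \<partial>lebesgue)"
        using Sfin[OF f] by (intro nn_integral_cong_AE) (auto elim!: eventually_mono simp: F_def G_def)
      also have "\<dots> = (\<integral>\<^sup>+x. (SUP k. ennreal (F x) * G x * indicator (hc (P k)) x) \<partial>lebesgue)"
      proof (rule nn_integral_cong)
        fix x :: "real^'n"
        obtain k where k: "norm x < real k" using reals_Archimedean2 by blast
        have "x \<in> hc (P k)"
        proof -
          have "- (R + real k) \<le> x $ i \<and> x $ i < R + real k" for i
            using component_le_norm_cart[of x i] k R by (smt (verit))
          then show ?thesis by (simp add: hcube_def P_def)
        qed
        then show "ennreal (F x) * G x = (SUP k. ennreal (F x) * G x * indicator (hc (P k)) x)"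
          by (intro antisym SUP_upper2[of k] SUP_least) (auto split: split_indicator)
      qed
      also have "\<dots> = (SUP k. \<integral>\<^sup>+x\<in>hc (P k). ennreal (F x) * G x \<partial>lebesgue)"
      proof (rule nn_integral_monotone_convergence_SUP)
        have "hc (P k) \<subseteq> hc (P (Suc k))" for k
          unfolding hcube_def P_def by (auto) (smt (verit))+
        then show "incseq (\<lambda>k x. ennreal (F x) * G x * indicator (hc (P k)) x)"
          by (intro incseq_SucI le_funI) (auto split: split_indicator)
      qed measurable
      also have "\<dots> \<le> ennreal (8 * C1 * C' * K)"
      proof (rule SUP_least)
        fix k
        have "F x \<ge> 0" for x by (simp add: F_def)
        then have "(\<integral>\<^sup>+x\<in>hc (P k). ennreal (F x) * G x \<partial>lebesgue)
            = (\<integral>\<^sup>+x\<in>hc (P k). ennreal \<bar>F x - c (P k)\<bar> * G x \<partial>lebesgue)"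
          by (simp add: cP)
        also have "\<dots> \<le> 4 * (\<integral>\<^sup>+x\<in>hc (P k). H x \<partial>lebesgue)"
          by (intro oscillation_iteration[where \<alpha>=\<alpha>] \<alpha>0 local Hp P) measurable
        also have "\<dots> \<le> 4 * (\<integral>\<^sup>+x. H x \<partial>lebesgue)"
          by (intro mult_left_mono nn_integral_mono) (auto split: split_indicator)
        also have "\<dots> \<le> 4 * ennreal (C1 * (2 * K * C'))" by (intro mult_left_mono HH) auto
        also have "\<dots> = ennreal (4 * (C1 * (2 * K * C')))" using C1 C' K by (subst ennreal_mult) auto
        also have "4 * (C1 * (2 * K * C')) = 8 * C1 * C' * K" by simp
        finally show "(\<integral>\<^sup>+x\<in>hc (P k). ennreal (F x) * G x \<partial>lebesgue) \<le> ennreal (8 * C1 * C' * K)" .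
      qed
      finally show "(\<integral>\<^sup>+x. ?S f x * ennreal (g x) \<partial>lebesgue) \<le> ennreal (8 * C1 * C' * K)" .
    qed
    then show ?thesis using K C1 C' by (simp add: ennreal_mult)
  qed
  show thesis
  proof (rule that)
    \<comment> \<open>The 8 is the product of 4 from the iteration and 2 from the norm of the
      weight.\<close>
    show "8 * C1 * C' > 0" using C1 C' by simp
    fix f :: "real^'n \<Rightarrow> complex" assume f: "f \<in> Linf0"
    obtain M0 R where MR: "AE x in lebesgue. cmod (f x) \<le> M0 * indicator (cball 0 R) x"
      using f unfolding Linf0_iff by auto
    define f' where "f' x = f x * indicator (cball 0 (max R 1)) x" for x
    have f': "f' \<in> Linf0" unfolding f'_def by (intro Linf0_indicator f) auto
    have ae: "AE x in lebesgue. f x = f' x"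
      using MR by eventually_elim (auto simp: f'_def split: split_indicator split_indicator_asm)
    have "\<rho> (?S f) = \<rho> (?S f')"
      using Scong[OF f f' ae] Sm[OF f] Sm[OF f'] by (intro bfn_cong_AE[OF bfn])
    also have "\<dots> \<le> ennreal (8 * C1 * C') * bfs_norm \<rho> f'"
      by (rule key[OF f', of "max R 1"]) (auto simp: f'_def split: split_indicator)
    also have "bfs_norm \<rho> f' = bfs_norm \<rho> f"
      unfolding bfs_norm_def using Linf0_measurable[OF f] Linf0_measurable[OF f'] ae
      by (intro bfn_cong_AE[OF bfn]) (auto elim: eventually_mono)
    finally show "\<rho> (?S f) \<le> ennreal (8 * C1 * C') * bfs_norm \<rho> f" .
  qed
qed

section \<open>Density and extension\<close>

context
  fixes \<rho> :: "(real^'n \<Rightarrow> ennreal) \<Rightarrow> ennreal"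
  assumes bfn: "banach_function_norm \<rho>"
begin

section \<open>The norm on complex functions\<close>

lemma bfs_measurable: "f \<in> bfs \<rho> \<Longrightarrow> f \<in> borel_measurable lebesgue"
  by (simp add: bfs_def)

lemma bfs_norm_mono:
  assumes "f \<in> borel_measurable lebesgue" "g \<in> borel_measurable lebesgue"
    and "AE x in lebesgue. cmod (g x) \<le> cmod (f x)"
  shows "bfs_norm \<rho> g \<le> bfs_norm \<rho> f"
  unfolding bfs_norm_def using assms
    by (intro bfn_mono[OF bfn]) (auto elim!: eventually_mono intro!: ennreal_leI)

lemma bfs_norm_triangle:
  assumes [measurable]: "f \<in> borel_measurable lebesgue" "g \<in> borel_measurable lebesgue"
  shows "bfs_norm \<rho> (\<lambda>x. f x + g x) \<le> bfs_norm \<rho> f + bfs_norm \<rho> g"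
proof -
  have "bfs_norm \<rho> (\<lambda>x. f x + g x) \<le> \<rho> (\<lambda>x. ennreal (cmod (f x)) + ennreal (cmod (g x)))"
    unfolding bfs_norm_def
    by (intro bfn_mono[OF bfn] AE_I2)
      (auto simp: ennreal_plus[symmetric] norm_triangle_ineq intro!: ennreal_leI simp del: ennreal_plus)
  also have "\<dots> \<le> bfs_norm \<rho> f + bfs_norm \<rho> g"
    unfolding bfs_norm_def by (intro bfn_add[OF bfn]) measurable
  finally show ?thesis .
qed

lemma bfs_norm_cmult:
  assumes [measurable]: "f \<in> borel_measurable lebesgue"
  shows "bfs_norm \<rho> (\<lambda>x. c * f x) = ennreal (cmod c) * bfs_norm \<rho> f"
  unfolding bfs_norm_def norm_mult ennreal_mult[OF norm_ge_zero norm_ge_zero]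
  by (intro bfn_scale[OF bfn]) auto

lemma bfs_norm_minus_commute: "bfs_norm \<rho> (\<lambda>x. f x - g x) = bfs_norm \<rho> (\<lambda>x. g x - f x)"
  unfolding bfs_norm_def by (simp add: norm_minus_commute)

lemma bfs_norm_diff_triangle:
  assumes [measurable]: "f \<in> borel_measurable lebesgue" "g \<in> borel_measurable lebesgue"
      "h \<in> borel_measurable lebesgue"
  shows "bfs_norm \<rho> (\<lambda>x. f x - g x) \<le> bfs_norm \<rho> (\<lambda>x. f x - h x) + bfs_norm \<rho> (\<lambda>x. h x - g x)"
  using bfs_norm_triangle[of "\<lambda>x. f x - h x" "\<lambda>x. h x - g x"] by simp

text \<open>Otherwise countably many disjoint pieces of \<open>f\<close> have norms bounded below, and their unions
  over subsets of the naturals form an uncountable separated family.\<close>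

lemma separable_absolutely_continuous:
  assumes sep: "bfs_separable \<rho>" and f: "f \<in> bfs \<rho>" and \<epsilon>: "\<epsilon> > 0"
    and Em[measurable]: "\<And>k::nat. E k \<in> sets lebesgue" and dec: "decseq E" and emp: "(\<Inter>k. E k) = {}"
  shows "\<exists>k. bfs_norm \<rho> (\<lambda>x. f x * indicator (E k) x) < ennreal \<epsilon>"
proof (rule ccontr)
  assume "\<not> ?thesis"
  then have big: "ennreal \<epsilon> \<le> bfs_norm \<rho> (\<lambda>x. f x * indicator (E k) x)" for k by (simp add: not_less)
  note [measurable] = bfs_measurable[OF f]
  define p where "p A = bfs_norm \<rho> (\<lambda>x. f x * indicator A x)" for A
  have pm: "p A = \<rho> (\<lambda>x. ennreal (cmod (f x)) * indicator A x)" for A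
    unfolding p_def bfs_norm_def
    by (intro arg_cong[where f=\<rho>] ext) (simp split: split_indicator)
  \<comment> \<open>As \<open>E m\<close> shrinks to the empty set, \<open>f\<close> restricted to
    \<open>E k - E m\<close> increases to \<open>f\<close> restricted to \<open>E k\<close>, whose
    norm is at least \<open>\<epsilon>\<close>. Iterating the choice of \<open>m\<close> produces
    the disjoint pieces.\<close>
  have "\<exists>m. p (E k - E m) > ennreal (\<epsilon> / 2)" for k
  proof -
    have "(\<lambda>m. \<rho> (\<lambda>x. ennreal (cmod (f x)) * indicator (E k - E m) x))
        \<longlonglongrightarrow> \<rho> (\<lambda>x. ennreal (cmod (f x)) * indicator (E k) x)"
    proof (intro bfn_incseq[OF bfn] AE_I2 conjI)
      fix x
      have sub: "E (Suc m) \<subseteq> E m" for m using dec by (auto simp: decseq_Suc_iff)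
      show "incseq (\<lambda>m. ennreal (cmod (f x)) * indicator (E k - E m) x)"
        using sub by (intro incseq_SucI mult_left_mono) (auto split: split_indicator)
      obtain m0 where m0: "x \<notin> E m0" using emp by auto
      have "\<forall>\<^sub>F m in sequentially. ennreal (cmod (f x)) * indicator (E k) x
          = ennreal (cmod (f x)) * indicator (E k - E m) x"
        using eventually_ge_at_top[of m0]
      proof eventually_elim
        case (elim m)
        then have "x \<notin> E m" using m0 dec by (auto simp: decseq_def)
        then show ?case by (auto split: split_indicator)
      qed
      then show "(\<lambda>m. ennreal (cmod (f x)) * indicator (E k - E m) x)
          \<longlonglongrightarrow> ennreal (cmod (f x)) * indicator (E k) x"
        by (rule Lim_transform_eventually[OF tendsto_const])
    qed measurable
    then have "(\<lambda>m. p (E k - E m)) \<longlonglongrightarrow> p (E k)" by (simp add: pm)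
    moreover have "ennreal (\<epsilon> / 2) < p (E k)"
    proof -
      have "ennreal (\<epsilon> / 2) < ennreal \<epsilon>" using \<epsilon> by (intro ennreal_lessI) auto
      also have "\<dots> \<le> p (E k)" using big[of k] by (simp add: p_def)
      finally show ?thesis .
    qed
    ultimately have "\<forall>\<^sub>F m in sequentially. p (E k - E m) > ennreal (\<epsilon> / 2)" by (rule order_tendstoD(1))
    then show ?thesis by (auto dest: eventually_happens)
  qed
  then obtain m where m: "\<And>k. p (E k - E (m k)) > ennreal (\<epsilon> / 2)" by metis
  have mk: "m k > k" for k
  proof (rule ccontr)
    assume "\<not> ?thesis"
    then have e: "E k - E (m k) = {}" using dec by (auto simp: decseq_def not_less)
    have "p (E k - E (m k)) = 0" unfolding pm e by (simp add: bfn_zero[OF bfn])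
    with m[of k] show False by simp
  qed
  define s where "s j = (m ^^ j) 0" for j
  have sS: "s (Suc j) = m (s j)" for j by (simp add: s_def)
  have smono: "strict_mono s" unfolding strict_mono_Suc_iff sS using mk by blast
  define F where "F j = E (s j) - E (s (Suc j))" for j
  have Fm[measurable]: "F j \<in> sets lebesgue" for j unfolding F_def by measurable
  have Fbig: "p (F j) > ennreal (\<epsilon> / 2)" for j unfolding F_def sS by (rule m)
  have Fdis: "F i \<inter> F j = {}" if "i < j" for i j
  proof -
    have "s (Suc i) \<le> s j" using smono that by (simp add: strict_mono_less_eq)
    then have "E (s j) \<subseteq> E (s (Suc i))" using dec by (auto simp: decseq_def)
    then show ?thesis by (auto simp: F_def)
  qed
  have Fdis': "i = j" if "x \<in> F i" "x \<in> F j" for i j x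
    using Fdis[of i j] Fdis[of j i] that by (cases i j rule: linorder_cases) auto
  define h where "h A x = f x * indicator (\<Union>j\<in>A. F j) x" for A :: "nat set" and x
  have hm[measurable]: "h A \<in> borel_measurable lebesgue" for A unfolding h_def by measurable
  have hX: "h A \<in> bfs \<rho>" for A
  proof -
    have "bfs_norm \<rho> (h A) \<le> bfs_norm \<rho> f"
      by (intro bfs_norm_mono) (auto simp: h_def split: split_indicator)
    then show ?thesis using f by (auto simp: bfs_def)
  qed
  have sepa: "bfs_norm \<rho> (\<lambda>x. h A x - h B x) > ennreal (\<epsilon> / 2)" if "j \<in> A" "j \<notin> B" for A B j
  proof -
    have "ennreal (\<epsilon> / 2) < p (F j)" by (rule Fbig)
    also have "\<dots> \<le> bfs_norm \<rho> (\<lambda>x. h A x - h B x)"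
      unfolding p_def
    proof (intro bfs_norm_mono AE_I2)
      fix x
      show "cmod (f x * indicator (F j) x) \<le> cmod (h A x - h B x)"
      proof (cases "x \<in> F j")
        case True
        then have "x \<in> (\<Union>j\<in>A. F j)" "x \<notin> (\<Union>j\<in>B. F j)" using that Fdis' by blast+
        then show ?thesis by (simp add: h_def split: split_indicator)
      qed simp
    qed measurable
    finally show ?thesis .
  qed
  obtain D where D: "D \<subseteq> bfs \<rho>" "countable D"
    "\<And>f \<epsilon>. f \<in> bfs \<rho> \<Longrightarrow> \<epsilon> > 0 \<Longrightarrow> \<exists>g\<in>D. bfs_norm \<rho> (\<lambda>x. f x - g x) < ennreal \<epsilon>"
    using sep by (auto simp: bfs_separable_def)
  have "\<exists>g\<in>D. bfs_norm \<rho> (\<lambda>x. h A x - g x) < ennreal (\<epsilon> / 4)" for A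
    using \<epsilon> by (intro D(3) hX) auto
  then obtain d where d: "\<And>A. d A \<in> D" "\<And>A. bfs_norm \<rho> (\<lambda>x. h A x - d A x) < ennreal (\<epsilon> / 4)" by metis
  have dm: "d A \<in> borel_measurable lebesgue" for A using d(1)[of A] D(1) by (auto simp: bfs_def)
  have ne: "d A \<noteq> d B" if "j \<in> A" "j \<notin> B" for A B j
  proof
    assume eq: "d A = d B"
    have "bfs_norm \<rho> (\<lambda>x. h A x - h B x) \<le> bfs_norm \<rho> (\<lambda>x. h A x - d A x) + bfs_norm \<rho> (\<lambda>x. d A x - h B x)"
      by (intro bfs_norm_diff_triangle hm dm)
    also have "bfs_norm \<rho> (\<lambda>x. d A x - h B x) = bfs_norm \<rho> (\<lambda>x. h B x - d B x)"
      unfolding eq by (rule bfs_norm_minus_commute)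
    also have "bfs_norm \<rho> (\<lambda>x. h A x - d A x) + bfs_norm \<rho> (\<lambda>x. h B x - d B x)
        \<le> ennreal (\<epsilon> / 4) + ennreal (\<epsilon> / 4)"
      using d(2) by (intro add_mono) (auto intro: less_imp_le)
    also have "\<dots> = ennreal (\<epsilon> / 2)" using \<epsilon> by (simp add: ennreal_plus[symmetric] del: ennreal_plus)
    finally show False using sepa[OF that] by simp
  qed
  have "inj d"
  proof (rule injI, rule ccontr)
    fix A B assume eq: "d A = d B" and "A \<noteq> B"
    then obtain j where "(j \<in> A \<and> j \<notin> B) \<or> (j \<in> B \<and> j \<notin> A)" by blast
    then show False using ne eq by metis
  qed
  moreover have "countable (range d)" using d(1) D(2) by (intro countable_subset[of "range d" D]) auto
  ultimately have "countable (UNIV :: nat set set)" using countable_image_inj_on by blast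
  then have "range (from_nat_into (UNIV :: nat set set)) = Pow UNIV" by (simp add: range_from_nat_into)
  then show False using Cantors_theorem[of "UNIV :: nat set"] by blast
qed

text \<open>Absolute continuity is applied to the sets where the point or the value exceeds
  \<open>k\<close>, which decrease to the empty set. The approximants are cut-offs of
  \<open>f\<close>; their domination by \<open>f\<close> lets the operator bound pass to the limit
  with the same constant.\<close>

lemma Linf0_dense:
  assumes sep: "bfs_separable \<rho>" and f: "f \<in> bfs \<rho>" and \<epsilon>: "\<epsilon> > 0"
  obtains g where "g \<in> Linf0" "\<And>x. cmod (g x) \<le> cmod (f x)" "bfs_norm \<rho> (\<lambda>x. f x - g x) < ennreal \<epsilon>"
proof -
  note fm[measurable] = bfs_measurable[OF f]
  define E where "E k = {x. norm x > real k \<or> cmod (f x) > real k}" for k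
  have Em[measurable]: "E k \<in> sets lebesgue" for k
  proof -
    have "{x \<in> space lebesgue. cmod (f x) > real k} \<in> sets lebesgue" by measurable
    moreover have "- cball 0 (real k) \<in> sets lebesgue"
      using sets.compl_sets[OF sets_cball_lebesgue[of 0 "real k"]] by (simp add: Compl_eq_Diff_UNIV)
    ultimately have "- cball 0 (real k) \<union> {x \<in> space lebesgue. cmod (f x) > real k} \<in> sets lebesgue" by auto
    also have "- cball 0 (real k) \<union> {x \<in> space lebesgue. cmod (f x) > real k} = E k"
      by (auto simp: E_def)
    finally show ?thesis .
  qed
  have "decseq E" by (auto simp: decseq_Suc_iff E_def)
  moreover have "(\<Inter>k. E k) = {}"
  proof (rule ccontr)
    assume "(\<Inter>k. E k) \<noteq> {}"
    then obtain x where x: "\<And>k. x \<in> E k" by auto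
    obtain k where "max (norm x) (cmod (f x)) < real k" using reals_Archimedean2 by blast
    then show False using x[of k] by (auto simp: E_def)
  qed
  ultimately obtain k where k: "bfs_norm \<rho> (\<lambda>x. f x * indicator (E k) x) < ennreal \<epsilon>"
    using separable_absolutely_continuous[OF sep f \<epsilon>, of E] Em by blast
  define g where "g x = f x * indicator (- E k) x" for x
  have [measurable]: "- E k \<in> sets lebesgue" using sets.compl_sets[OF Em[of k]]
    by (simp add: Compl_eq_Diff_UNIV)
  have gm: "g \<in> borel_measurable lebesgue" unfolding g_def by measurable
  show thesis
  proof (rule that[of g])
    have "cmod (g x) \<le> real k * indicator (cball 0 (real k)) x" for x
      by (auto simp: g_def E_def split: split_indicator)
    then show "g \<in> Linf0" unfolding Linf0_iff using gm by (intro conjI exI[of _ "real k"]) auto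
    show "cmod (g x) \<le> cmod (f x)" for x by (auto simp: g_def split: split_indicator)
    have "(\<lambda>x. f x - g x) = (\<lambda>x. f x * indicator (E k) x)"
      by (auto simp: g_def fun_eq_iff split: split_indicator)
    then show "bfs_norm \<rho> (\<lambda>x. f x - g x) < ennreal \<epsilon>" using k by simp
  qed
qed

end

text \<open>The two one-sided inequalities express that increments are bounded by \<open>e k\<close>
  without subtracting in \<open>ennreal\<close>. In the reals the telescoping series converges
  absolutely.\<close>

lemma ennreal_convergent_if_increments_summable:
  fixes u e :: "nat \<Rightarrow> ennreal"
  assumes fin: "\<And>k. u k < \<infinity>" and up: "\<And>k. u (Suc k) \<le> u k + e k" and dn: "\<And>k. u k \<le> u (Suc k) + e k"
    and sum: "(\<Sum>k. e k) < \<infinity>"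
  obtains L where "L \<ge> 0" "u \<longlonglongrightarrow> ennreal L"
proof -
  have efin: "e k < \<infinity>" for k
    using sum_le_suminf[of e "{k}"] sum by (auto intro: order_le_less_trans)
  define U where "U k = enn2real (u k)" for k
  define d where "d k = enn2real (e k)" for k
  have Uu: "ennreal (U k) = u k" and de: "ennreal (d k) = e k" for k
    using fin efin by (auto simp: U_def d_def)
  have U0: "U k \<ge> 0" "d k \<ge> 0" for k by (auto simp: U_def d_def)
  have 1: "\<bar>U k - U (Suc k)\<bar> \<le> d k" for k
  proof -
    have "ennreal (U (Suc k)) \<le> ennreal (U k + d k)" "ennreal (U k) \<le> ennreal (U (Suc k) + d k)"
      using up[of k] dn[of k] U0 by (simp_all add: ennreal_plus Uu de)
    then have "U (Suc k) \<le> U k + d k" "U k \<le> U (Suc k) + d k"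
      using U0 by (simp_all add: ennreal_le_iff del: ennreal_plus)
    then show ?thesis by linarith
  qed
  have "summable d"
    using sum U0 by (intro summable_suminf_not_top) (auto simp: de)
  then have "summable (\<lambda>k. U k - U (Suc k))"
    by (rule summable_comparison_test'[of _ 0]) (use 1 in auto)
  then have "(\<lambda>n. U 0 - (\<Sum>i<n. U i - U (Suc i))) \<longlonglongrightarrow> U 0 - (\<Sum>n. U n - U (Suc n))"
    by (intro tendsto_intros summable_LIMSEQ)
  moreover have "U 0 - (\<Sum>i<n. U i - U (Suc i)) = U n" for n
    by (induction n) auto
  ultimately have lim: "U \<longlonglongrightarrow> U 0 - (\<Sum>n. U n - U (Suc n))" by simp
  then have "U 0 - (\<Sum>n. U n - U (Suc n)) \<ge> 0" by (rule LIMSEQ_le_const) (use U0 in auto)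
  moreover from lim have "(\<lambda>k. ennreal (U k)) \<longlonglongrightarrow> ennreal (U 0 - (\<Sum>n. U n - U (Suc n)))"
    by (rule tendsto_ennrealI)
  ultimately show thesis unfolding Uu by (rule that)
qed

lemma ennreal_tendsto_if_close:
  fixes u w d :: "nat \<Rightarrow> ennreal"
  assumes L: "L \<ge> 0" and u: "u \<longlonglongrightarrow> ennreal L" and fin: "\<And>k. u k < \<infinity>"
      and le: "\<And>k. w k \<le> u k + d k" "\<And>k. u k \<le> w k + d k"
    and sum: "(\<Sum>k. d k) < \<infinity>"
  shows "w \<longlonglongrightarrow> ennreal L"
proof -
  have dfin: "d k < \<infinity>" for k
    using sum_le_suminf[of d "{k}"] sum by (auto intro: order_le_less_trans)
  have wfin: "w k < \<infinity>" for k using le(1)[of k] fin[of k] dfin[of k] by (auto intro: order_le_less_trans)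
  define U where "U k = enn2real (u k)" for k
  define W where "W k = enn2real (w k)" for k
  define D where "D k = enn2real (d k)" for k
  have eq: "ennreal (U k) = u k" "ennreal (W k) = w k" "ennreal (D k) = d k" for k
    using fin wfin dfin by (auto simp: U_def W_def D_def)
  have ge0: "U k \<ge> 0" "W k \<ge> 0" "D k \<ge> 0" for k by (auto simp: U_def W_def D_def)
  have b: "W k \<le> U k + D k" "U k \<le> W k + D k" for k
  proof -
    have "ennreal (W k) \<le> ennreal (U k + D k)" "ennreal (U k) \<le> ennreal (W k + D k)"
      using le[of k] ge0 by (simp_all add: ennreal_plus eq)
    then show "W k \<le> U k + D k" "U k \<le> W k + D k" using ge0
      by (simp_all add: ennreal_le_iff del: ennreal_plus)
  qed
  have "summable D" using sum ge0 by (intro summable_suminf_not_top) (auto simp: eq)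
  then have D: "D \<longlonglongrightarrow> 0" by (rule summable_LIMSEQ_zero)
  have U: "U \<longlonglongrightarrow> L" unfolding U_def by (rule tendsto_enn2real[OF u L])
  have "W \<longlonglongrightarrow> L"
  proof (rule tendsto_sandwich[of "\<lambda>k. U k - D k" _ _ "\<lambda>k. U k + D k"])
    show "(\<lambda>k. U k - D k) \<longlonglongrightarrow> L" using tendsto_diff[OF U D] by simp
    show "(\<lambda>k. U k + D k) \<longlonglongrightarrow> L" using tendsto_add[OF U D] by simp
  qed (use b in \<open>auto simp: algebra_simps\<close>)
  then have "(\<lambda>k. ennreal (W k)) \<longlonglongrightarrow> ennreal (L)" by (rule tendsto_ennrealI)
  then show ?thesis unfolding eq by simp
qed

text \<open>For a sublinear \<open>S\<close>, continuity comes from the a.e. inequality between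
  \<open>\<bar>S f - S g\<bar>\<close> and \<open>S (f - g)\<close>. Approximations with geometric
  errors make the sum of the norms of such differences finite, hence the sum of the functions finite
  a.e., so the values converge pointwise a.e. to a limit independent of the approximation.\<close>

lemma extends_to_bounded_if_dense:
  fixes \<rho> :: "(real^'n \<Rightarrow> ennreal) \<Rightarrow> ennreal" and S :: "(real^'n \<Rightarrow> complex) \<Rightarrow> real^'n \<Rightarrow> ennreal"
  assumes bfn: "banach_function_norm \<rho>" and sep: "bfs_separable \<rho>"
    and sub: "nonneg_sublinear_on Linf0 S"
    and C: "C > 0" and bdd: "\<And>f. f \<in> Linf0 \<Longrightarrow> \<rho> (S f) \<le> ennreal C * bfs_norm \<rho> f"
  shows "extends_to_bounded \<rho> S"
proof -
  have Sm: "S f \<in> borel_measurable lebesgue" and Sfin: "AE x in lebesgue. S f x < \<infinity>" if "f \<in> Linf0" for f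
    using sub that by (auto simp: nonneg_sublinear_on_def)
  have Sadd: "AE x in lebesgue. S (\<lambda>y. f y + g y) x \<le> S f x + S g x" if "f \<in> Linf0" "g \<in> Linf0" for f g
    using sub that by (auto simp: nonneg_sublinear_on_def)
  have Sscale: "AE x in lebesgue. S (\<lambda>y. c * f y) x = ennreal (cmod c) * S f x" if "f \<in> Linf0" for f c
    using sub that by (auto simp: nonneg_sublinear_on_def)
  have Sdiff: "AE x in lebesgue. S f x \<le> S g x + S (\<lambda>y. f y - g y) x \<and> S g x \<le> S f x + S (\<lambda>y. f y - g y) x"
    if f: "f \<in> Linf0" and g: "g \<in> Linf0" for f g
  proof -
    have d: "(\<lambda>y. f y - g y) \<in> Linf0" "(\<lambda>y. g y - f y) \<in> Linf0" using f g by (auto intro: Linf0_diff)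
    show ?thesis
      using Sadd[OF g d(1)] Sadd[OF f d(2)] Sscale[OF d(1), of "- 1"] by eventually_elim auto
  qed
  have "\<exists>g. g \<in> Linf0 \<and> (\<forall>x. cmod (g x) \<le> cmod (f x)) \<and> bfs_norm \<rho> (\<lambda>x. f x - g x) < ennreal ((1 / 2) ^ k)"
    if "f \<in> bfs \<rho>" for f k
    using Linf0_dense[OF bfn sep that, of "(1 / 2) ^ k"]
      by (metis zero_less_divide_1_iff zero_less_numeral zero_less_power)
  then obtain a where a: "\<And>f k. f \<in> bfs \<rho> \<Longrightarrow> a f k \<in> Linf0" "\<And>f k x. f \<in> bfs \<rho> \<Longrightarrow> cmod (a f k x) \<le> cmod (f x)"
    "\<And>f k. f \<in> bfs \<rho> \<Longrightarrow> bfs_norm \<rho> (\<lambda>x. f x - a f k x) < ennreal ((1 / 2) ^ k)"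
    by metis
  \<comment> \<open>The lower limit exists everywhere and is measurable, and the Fatou property
    bounds its norm directly.\<close>
  define B where "B f x = liminf (\<lambda>k. S (a f k) x)" for f x
  have summ: "AE x in lebesgue. (\<Sum>k. S (\<lambda>y. h k y - h' k y) x) < \<infinity>"
    if f: "f \<in> bfs \<rho>" and h: "\<And>k. h k \<in> Linf0" "\<And>k. bfs_norm \<rho> (\<lambda>x. f x - h k x)
        \<le> ennreal (c * (1 / 2) ^ k)"
      and h': "\<And>k. h' k \<in> Linf0" "\<And>k. bfs_norm \<rho> (\<lambda>x. f x - h' k x) \<le> ennreal (c * (1 / 2) ^ k)"
          and c: "c \<ge> 0"
    for f h h' c
  proof -
    have d: "(\<lambda>y. h k y - h' k y) \<in> Linf0" for k using h h' by (intro Linf0_diff)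
    have "\<rho> (S (\<lambda>y. h k y - h' k y)) \<le> ennreal (C * (2 * c) * (1 / 2) ^ k)" for k
    proof -
      have "\<rho> (S (\<lambda>y. h k y - h' k y)) \<le> ennreal C * bfs_norm \<rho> (\<lambda>y. h k y - h' k y)" by (rule bdd[OF d])
      also have "bfs_norm \<rho> (\<lambda>y. h k y - h' k y)
          \<le> bfs_norm \<rho> (\<lambda>y. h k y - f y) + bfs_norm \<rho> (\<lambda>y. f y - h' k y)"
        by (rule bfs_norm_diff_triangle[OF bfn Linf0_measurable[OF h(1)] Linf0_measurable[OF h'(1)]
            bfs_measurable[OF bfn f]])
      also have "bfs_norm \<rho> (\<lambda>y. h k y - f y) = bfs_norm \<rho> (\<lambda>y. f y - h k y)"
        by (rule bfs_norm_minus_commute[OF bfn])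
      also have "bfs_norm \<rho> (\<lambda>y. f y - h k y) + bfs_norm \<rho> (\<lambda>y. f y - h' k y)
          \<le> ennreal (c * (1 / 2) ^ k) + ennreal (c * (1 / 2) ^ k)"
        by (intro add_mono h h')
      also have "\<dots> = ennreal (2 * c * (1 / 2) ^ k)" using c by (subst ennreal_plus[symmetric]) auto
      finally show ?thesis using C c by (simp add: mult_left_mono ennreal_mult mult.assoc)
    qed
    then have "(\<Sum>k. \<rho> (S (\<lambda>y. h k y - h' k y))) \<le> (\<Sum>k. ennreal (C * (2 * c) * (1 / 2) ^ k))"
      by (intro suminf_le) auto
    also have "\<dots> = ennreal (\<Sum>k. C * (2 * c) * (1 / 2) ^ k)"
      using C c by (intro suminf_ennreal2) (auto intro!: summable_mult summable_geometric)
    also have "\<dots> < \<infinity>" by simp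
    finally have "(\<Sum>k. \<rho> (S (\<lambda>y. h k y - h' k y))) < \<infinity>" .
    moreover have "\<rho> (\<lambda>x. \<Sum>k. S (\<lambda>y. h k y - h' k y) x) \<le> (\<Sum>k. \<rho> (S (\<lambda>y. h k y - h' k y)))"
      using Sm d by (intro bfn_suminf_le[OF bfn]) auto
    ultimately have "\<rho> (\<lambda>x. \<Sum>k. S (\<lambda>y. h k y - h' k y) x) < \<infinity>" by (rule order_le_less_trans[rotated])
    moreover have "(\<lambda>x. \<Sum>k. S (\<lambda>y. h k y - h' k y) x) \<in> borel_measurable lebesgue"
      using Sm d by (intro borel_measurable_suminf_order) auto
    ultimately show ?thesis by (intro bfn_AE_finite[OF bfn])
  qed
  \<comment> \<open>Any sequence with errors \<open>c * (1 / 2) ^ k\<close> gives the same limit.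
    The factor \<open>c\<close> is needed because sums double the error and scalar multiples scale
    it; \<open>c \<ge> 1\<close> admits the chosen sequence \<open>a f\<close> at the same
    rate.\<close>
  have conv: "AE x in lebesgue. (\<lambda>k. S (h k) x) \<longlonglongrightarrow> B f x \<and> B f x < \<infinity>"
    if f: "f \<in> bfs \<rho>" and h: "\<And>k. h k \<in> Linf0" "\<And>k. bfs_norm \<rho> (\<lambda>x. f x - h k x)
        \<le> ennreal (c * (1 / 2) ^ k)"
      and c: "c \<ge> 1" for f h c
  proof -
    have ak: "bfs_norm \<rho> (\<lambda>x. f x - a f k x) \<le> ennreal (c * (1 / 2) ^ k)" for k
    proof -
      have "bfs_norm \<rho> (\<lambda>x. f x - a f k x) \<le> ennreal ((1 / 2) ^ k)" using a(3)[OF f] by (rule less_imp_le)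
      also have "\<dots> \<le> ennreal (c * (1 / 2) ^ k)" using c by (intro ennreal_leI) (simp add: field_simps)
      finally show ?thesis .
    qed
    \<comment> \<open>The shifted sequence is a second approximation at the same rate, so
      \<open>summ\<close> applies to consecutive terms of \<open>a f\<close>.\<close>
    have ak': "bfs_norm \<rho> (\<lambda>x. f x - a f (Suc k) x) \<le> ennreal (c * (1 / 2) ^ k)" for k
    proof -
      have "bfs_norm \<rho> (\<lambda>x. f x - a f (Suc k) x) \<le> ennreal (c * (1 / 2) ^ Suc k)" by (rule ak)
      also have "\<dots> \<le> ennreal (c * (1 / 2) ^ k)" using c
        by (intro ennreal_leI mult_left_mono power_decreasing) auto
      finally show ?thesis .
    qed
    have c0: "c \<ge> 0" using c by simp
    have all1: "AE x in lebesgue. \<forall>k. S (a f k) x < \<infinity>"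
      unfolding AE_all_countable using Sfin a(1)[OF f] by blast
    have all2: "AE x in lebesgue. \<forall>k. S (a f (Suc k)) x \<le> S (a f k) x + S (\<lambda>y. a f (Suc k) y - a f k y) x \<and>
        S (a f k) x \<le> S (a f (Suc k)) x + S (\<lambda>y. a f (Suc k) y - a f k y) x"
      unfolding AE_all_countable using Sdiff a(1)[OF f] by blast
    have all3: "AE x in lebesgue. \<forall>k. S (h k) x \<le> S (a f k) x + S (\<lambda>y. h k y - a f k y) x \<and>
        S (a f k) x \<le> S (h k) x + S (\<lambda>y. h k y - a f k y) x"
      unfolding AE_all_countable using Sdiff a(1)[OF f] h(1) by blast
    have s1: "AE x in lebesgue. (\<Sum>k. S (\<lambda>y. a f (Suc k) y - a f k y) x) < \<infinity>"
      by (rule summ[OF f _ ak' _ ak c0]) (auto intro: a(1)[OF f])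
    have s2: "AE x in lebesgue. (\<Sum>k. S (\<lambda>y. h k y - a f k y) x) < \<infinity>"
      by (rule summ[OF f h _ ak c0]) (auto intro: a(1)[OF f])
    show ?thesis
      using all1 all2 all3 s1 s2
    proof eventually_elim
      case (elim x)
      obtain L where L: "L \<ge> 0" "(\<lambda>k. S (a f k) x) \<longlonglongrightarrow> ennreal L"
        by (rule ennreal_convergent_if_increments_summable[of "\<lambda>k. S (a f k) x"
            "\<lambda>k. S (\<lambda>y. a f (Suc k) y - a f k y) x"])
          (use elim in auto)
      then have "B f x = ennreal L" unfolding B_def using L(2) by (intro lim_imp_Liminf) auto
      moreover have "(\<lambda>k. S (h k) x) \<longlonglongrightarrow> ennreal L"
        by (rule ennreal_tendsto_if_close[OF L, where d="\<lambda>k. S (\<lambda>y. h k y - a f k y) x"]) (use elim in auto)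
      ultimately show ?case by simp
    qed
  qed
  have conv_a: "AE x in lebesgue. (\<lambda>k. S (a f k) x) \<longlonglongrightarrow> B f x \<and> B f x < \<infinity>" if "f \<in> bfs \<rho>" for f
    using a[OF that] by (intro conv[OF that, of _ 1]) (auto intro: less_imp_le)
  have aX: "a f k \<in> borel_measurable lebesgue" if "f \<in> bfs \<rho>" for f k using a(1)[OF that]
    by (rule Linf0_measurable)
  have fX: "f \<in> borel_measurable lebesgue" if "f \<in> bfs \<rho>" for f using that by (simp add: bfs_def)
  show ?thesis
    unfolding extends_to_bounded_def
  proof (intro exI[of _ B] conjI)
    show "extends_from Linf0 S B"
      unfolding extends_from_def
    proof
      fix f :: "real^'n \<Rightarrow> complex" assume f: "f \<in> Linf0"
      \<comment> \<open>The constant sequence \<open>f\<close> approximates itself with error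
        0.\<close>
      have "AE x in lebesgue. (\<lambda>k::nat. S f x) \<longlonglongrightarrow> B f x \<and> B f x < \<infinity>"
        using f by (intro conv[OF Linf0_bfs[OF bfn f], of
            "\<lambda>_. f" 1]) (auto simp: bfs_norm_def bfn_zero[OF bfn])
      then show "AE x in lebesgue. B f x = S f x"
        by eventually_elim (auto simp: LIMSEQ_const_iff)
    qed
    show "nonneg_sublinear_on (bfs \<rho>) B"
      unfolding nonneg_sublinear_on_def
    proof (intro conjI ballI impI allI)
      fix f assume f: "f \<in> bfs \<rho>"
      show "B f \<in> borel_measurable lebesgue"
        unfolding B_def using Sm a(1)[OF f] by (intro borel_measurable_liminf) auto
      show "AE x in lebesgue. B f x < \<infinity>" using conv_a[OF f] by eventually_elim auto
      fix c :: complex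
      define M where "M = max 1 (cmod c)"
      have M: "M \<ge> 1" "cmod c \<le> M" by (auto simp: M_def)
      have cf: "(\<lambda>y. c * f y) \<in> bfs \<rho>"
        using f fX[OF f] by (auto simp: bfs_def bfs_norm_cmult[OF bfn] ennreal_mult_less_top)
      have cn: "bfs_norm \<rho> (\<lambda>x. c * f x - c * a f k x) \<le> ennreal (M * (1 / 2) ^ k)" for k
      proof -
        have "bfs_norm \<rho> (\<lambda>x. c * f x - c * a f k x) = ennreal (cmod c) * bfs_norm \<rho> (\<lambda>x. f x - a f k x)"
          unfolding right_diff_distrib[symmetric] using fX[OF f] aX[OF f]
            by (intro bfs_norm_cmult[OF bfn]) auto
        also have "\<dots> \<le> ennreal M * ennreal ((1 / 2) ^ k)"
          using a(3)[OF f, of k] M by (intro mult_mono ennreal_leI less_imp_le[OF a(3)[OF f]]) auto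
        finally show ?thesis using M by (simp add: ennreal_mult)
      qed
      have "AE x in lebesgue. (\<lambda>k. S (\<lambda>y. c * a f k y) x) \<longlonglongrightarrow> B (\<lambda>y. c * f y) x \<and> B (\<lambda>y. c * f y) x < \<infinity>"
        by (rule conv[OF cf _ cn M(1)]) (intro Linf0_cmult a(1)[OF f])
      moreover have "AE x in lebesgue. \<forall>k. S (\<lambda>y. c * a f k y) x = ennreal (cmod c) * S (a f k) x"
        unfolding AE_all_countable using Sscale a(1)[OF f] by blast
      ultimately show "AE x in lebesgue. B (\<lambda>y. c * f y) x = ennreal (cmod c) * B f x"
        using conv_a[OF f]
      proof eventually_elim
        case (elim x)
        have "(\<lambda>k. ennreal (cmod c) * S (a f k) x) \<longlonglongrightarrow> ennreal (cmod c) * B f x"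
          using elim by (intro ennreal_tendsto_cmult) auto
        moreover have "(\<lambda>k. ennreal (cmod c) * S (a f k) x) \<longlonglongrightarrow> B (\<lambda>y. c * f y) x"
          using elim(1,2) by simp
        ultimately show ?case by (rule LIMSEQ_unique[rotated])
      qed
    next
      fix f g assume f: "f \<in> bfs \<rho>" and g: "g \<in> bfs \<rho>"
      have fg: "(\<lambda>y. f y + g y) \<in> bfs \<rho>"
      proof -
        note bfs_norm_triangle[OF bfn fX[OF f] fX[OF g]]
        also have "bfs_norm \<rho> f + bfs_norm \<rho> g < \<infinity>" using f g by (simp add: bfs_def)
        finally show ?thesis using fX[OF f] fX[OF g] by (simp add: bfs_def)
      qed
      have sn: "bfs_norm \<rho> (\<lambda>x. (f x + g x) - (a f k x + a g k x)) \<le> ennreal (2 * (1 / 2) ^ k)" for k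
      proof -
        have "bfs_norm \<rho> (\<lambda>x. (f x + g x) - (a f k x + a g k x))
            = bfs_norm \<rho> (\<lambda>x. (f x - a f k x) + (g x - a g k x))"
          by (simp add: algebra_simps)
        also have "\<dots> \<le> bfs_norm \<rho> (\<lambda>x. f x - a f k x) + bfs_norm \<rho> (\<lambda>x. g x - a g k x)"
          using fX[OF f] fX[OF g] aX[OF f] aX[OF g] by (intro bfs_norm_triangle[OF bfn]) auto
        also have "\<dots> \<le> ennreal ((1 / 2) ^ k) + ennreal ((1 / 2) ^ k)"
          using a(3)[OF f, of k] a(3)[OF g, of k] by (intro add_mono less_imp_le)
        also have "\<dots> = ennreal (2 * (1 / 2) ^ k)" by (subst ennreal_plus[symmetric]) auto
        finally show ?thesis .
      qed
      have "AE x in lebesgue. (\<lambda>k. S (\<lambda>y. a f k y + a g k y) x) \<longlonglongrightarrow> B (\<lambda>y. f y + g y) x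
          \<and> B (\<lambda>y. f y + g y) x < \<infinity>"
        by (rule conv[OF fg _ sn]) (auto intro: Linf0_add a(1)[OF f] a(1)[OF g])
      moreover have "AE x in lebesgue. \<forall>k. S (\<lambda>y. a f k y + a g k y) x \<le> S (a f k) x + S (a g k) x"
        unfolding AE_all_countable using Sadd a(1)[OF f] a(1)[OF g] by blast
      ultimately show "AE x in lebesgue. B (\<lambda>y. f y + g y) x \<le> B f x + B g x"
        using conv_a[OF f] conv_a[OF g]
      proof eventually_elim
        case (elim x)
        then show ?case by (intro LIMSEQ_le[of _ _ "\<lambda>k. S (a f k) x + S (a g k) x"] tendsto_add) auto
      qed
      assume ae: "AE x in lebesgue. f x = g x"
      \<comment> \<open>The sequence chosen for \<open>g\<close> also approximates \<open>f\<close>,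
        so both values are limits of one sequence.\<close>
      have "bfs_norm \<rho> (\<lambda>x. f x - a g k x) \<le> ennreal (1 * (1 / 2) ^ k)" for k
      proof -
        have "bfs_norm \<rho> (\<lambda>x. f x - a g k x) \<le> bfs_norm \<rho> (\<lambda>x. g x - a g k x)"
          using ae fX[OF f] fX[OF g] aX[OF g] by (intro bfs_norm_mono[OF bfn]) (auto elim!: eventually_mono)
        also have "\<dots> \<le> ennreal (1 * (1 / 2) ^ k)" using a(3)[OF g, of k] by simp
        finally show ?thesis .
      qed
      then have "AE x in lebesgue. (\<lambda>k. S (a g k) x) \<longlonglongrightarrow> B f x \<and> B f x < \<infinity>"
        using a(1)[OF g] by (intro conv[OF f, of _ 1]) auto
      then show "AE x in lebesgue. B f x = B g x"
        using conv_a[OF g] by eventually_elim (auto intro: LIMSEQ_unique)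
    qed
    show "bounded_on_bfs \<rho> B"
      unfolding bounded_on_bfs_def
    proof (intro exI[of _ C] conjI C ballI)
      fix f assume f: "f \<in> bfs \<rho>"
      show "\<rho> (B f) \<le> ennreal C * bfs_norm \<rho> f"
        unfolding B_def
      proof (rule bfn_liminf_le[OF bfn])
        fix k
        show "S (a f k) \<in> borel_measurable lebesgue" by (intro Sm a(1)[OF f])
        have "\<rho> (S (a f k)) \<le> ennreal C * bfs_norm \<rho> (a f k)" by (intro bdd a(1)[OF f])
        also have "\<dots> \<le> ennreal C * bfs_norm \<rho> f"
          using a(2)[OF f] fX[OF f] aX[OF f] by (intro mult_left_mono bfs_norm_mono[OF bfn]) auto
        finally show "\<rho> (S (a f k)) \<le> ennreal C * bfs_norm \<rho> f" .
      qed
    qed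
  qed
qed

theorem theorem3p1:
  fixes \<rho> :: "(real^'n \<Rightarrow> ennreal) \<Rightarrow> ennreal"
    and T :: "(real^'n \<Rightarrow> complex) \<Rightarrow> real^'n \<Rightarrow> complex"
    and I :: "'i set"
    and \<phi> :: "'i \<Rightarrow> real^'n \<Rightarrow> real"
  assumes "banach_function_norm \<rho>"
    and "bfs_separable \<rho>"
    and "bounded_on_bfs \<rho> hl_maximal"
    and "bounded_on_bfs (associate_norm \<rho>) hl_maximal"
    and "CZ_operator T"
    and "\<forall>\<alpha>\<in>I. \<phi> \<alpha> \<in> borel_measurable lebesgue"
    and "\<forall>r>1. extends_to_weak_type r (max_modulated T I \<phi>)"
  shows "extends_to_bounded \<rho> (max_modulated T I \<phi>)"
proof -
  obtain C where C: "C > 0" "\<And>f. f \<in> Linf0 \<Longrightarrow> \<rho> (max_modulated T I \<phi> f) \<le> ennreal C * bfs_norm \<rho> f"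
    using max_modulated_bounded_Linf0[OF assms(1,3-7)] by blast
  \<comment> \<open>Sublinearity is read off from the extension at exponent 2; any exponent above 1
    would serve.\<close>
  have "nonneg_sublinear_on Linf0 (max_modulated T I \<phi>)"
    using assms(7) by (intro max_modulated_weak(1)[OF assms(5,6), of 2]) auto
  then show ?thesis
    using C by (intro extends_to_bounded_if_dense[OF assms(1,2)])
qed

end
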